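(* Let $(M,\mathsf D)$ be a closed Dirac manifold, $f\in C^\infty(M)$ an admissible function of $(M,\mathsf D)$, and $X_f$ a Hamiltonian vector field for $f$. Let $\phi$ be the flow of $X_f$. Then the Dirac structure is invariant under $\phi_t$ for all $t$ for which $\phi_t$ is defined, that is, $(\phi_t^*X,\phi_t^*\alpha)\in\Gamma(\mathsf D)$ for all $(X,\alpha)\in\Gamma(\mathsf D)$.
   Context: Functions and sections may be locally defined (on open subsets); $\Gamma(\cdot)$ denotes local smooth sections. A Dirac structure on $M$ is a subbundle $\mathsf D\subseteq TM\oplus T^*M$ equal to its own orthogonal for the pairing $\langle(u,\alpha),(v,\beta)\rangle=\beta(u)+\alpha(v)$. It is closed if $\Gamma(\mathsf D)$ is closed under the bracket $[(X,\alpha),(Y,\beta)]=([X,Y],\pounds_X\beta-\mathbf i_Y\mathbf d\alpha)$. A function $f$ is admissible if there is a vector field $X_f$ with $(X_f,\mathbf df)\in\Gamma(\mathsf D)$; any such $X_f$ is called a Hamiltonian vector field for $f$. Here $\phi_t^*X=T\phi_{-t}\circ X\circ\phi_t$ (on the open set where this is defined). *)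

theory Defs
  imports "HOL-Analysis.Analysis"
begin

text \<open>
  A manifold is a Hausdorff, second countable type \<open>'m\<close> together with a smooth atlas modelled on the
  Euclidean space \<open>'e\<close>. The atlas need not be maximal: everything below depends only on the smooth
  structure that it generates. Functions and fields defined on an open set are total functions whose
  values outside that set are irrelevant.
\<close>


subsection \<open>Smooth manifolds\<close>

text \<open>Used for open \<open>S\<close> in a finite-dimensional space only, where the existence and continuity of
  all iterated directional derivatives is the usual notion.\<close>

primrec Ck_on ::
  "nat \<Rightarrow> 'a::real_normed_vector set \<Rightarrow> ('a \<Rightarrow> 'b::real_normed_vector) \<Rightarrow> bool" where
  "Ck_on 0 S f \<longleftrightarrow> continuous_on S f"
| "Ck_on (Suc k) S f \<longleftrightarrow>
     (\<forall>x\<in>S. f differentiable (at x)) \<and> (\<forall>v. Ck_on k S (\<lambda>x. frechet_derivative f (at x) v))"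

definition smooth_on ::
  "'a::real_normed_vector set \<Rightarrow> ('a \<Rightarrow> 'b::real_normed_vector) \<Rightarrow> bool" where
  "smooth_on S f \<longleftrightarrow> (\<forall>k. Ck_on k S f)"

type_synonym ('m, 'e) chart = "'m set \<times> ('m \<Rightarrow> 'e)"

definition smooth_atlas ::
  "('m::{t2_space,second_countable_topology}, 'e::euclidean_space) chart set \<Rightarrow> bool" where
  "smooth_atlas A \<longleftrightarrow>
     (\<Union>(U, x)\<in>A. U) = UNIV \<and>
     (\<forall>(U, x)\<in>A. open U \<and> open (x ` U) \<and> (\<exists>y. homeomorphism U (x ` U) x y)) \<and>
     (\<forall>(U, x)\<in>A. \<forall>(U', x')\<in>A. smooth_on (x ` (U \<inter> U')) (x' \<circ> inv_into U x))"

definition smooth_fun ::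
  "('m::topological_space, 'e::euclidean_space) chart set \<Rightarrow> 'm set \<Rightarrow> ('m \<Rightarrow> real) \<Rightarrow> bool" where
  "smooth_fun A V g \<longleftrightarrow> (\<forall>(U, x)\<in>A. smooth_on (x ` (U \<inter> V)) (g \<circ> inv_into U x))"

definition smooth_at ::
  "('m::topological_space, 'e::euclidean_space) chart set \<Rightarrow> 'm \<Rightarrow> ('m \<Rightarrow> real) \<Rightarrow> bool" where
  "smooth_at A p g \<longleftrightarrow> (\<exists>V. open V \<and> p \<in> V \<and> smooth_fun A V g)"


subsection \<open>Tangent and cotangent spaces\<close>

text \<open>Tangent vectors at \<open>p\<close> are derivations of the functions that are smooth near \<open>p\<close>; the Leibniz
  rule makes them depend only on germs. The values elsewhere are normalised to \<open>0\<close>, so that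
  equality in HOL is equality of tangent vectors; likewise for covectors.\<close>

type_synonym 'm vec = "('m \<Rightarrow> real) \<Rightarrow> real"
type_synonym 'm covec = "'m vec \<Rightarrow> real"

definition tangent_space ::
  "('m::topological_space, 'e::euclidean_space) chart set \<Rightarrow> 'm \<Rightarrow> 'm vec set" where
  "tangent_space A p = {v.
     (\<forall>g h. smooth_at A p g \<longrightarrow> smooth_at A p h \<longrightarrow>
        v (\<lambda>q. g q + h q) = v g + v h \<and> v (\<lambda>q. g q * h q) = v g * h p + g p * v h) \<and>
     (\<forall>a g. smooth_at A p g \<longrightarrow> v (\<lambda>q. a * g q) = a * v g) \<and>
     (\<forall>g. \<not> smooth_at A p g \<longrightarrow> v g = 0)}"

definition cotangent_space ::
  "('m::topological_space, 'e::euclidean_space) chart set \<Rightarrow> 'm \<Rightarrow> 'm covec set" where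
  "cotangent_space A p = {\<alpha>.
     (\<forall>u\<in>tangent_space A p. \<forall>v\<in>tangent_space A p. \<forall>a b.
        \<alpha> (\<lambda>g. a * u g + b * v g) = a * \<alpha> u + b * \<alpha> v) \<and>
     (\<forall>v. v \<notin> tangent_space A p \<longrightarrow> \<alpha> v = 0)}"

text \<open>The tangent map at \<open>p\<close> of a map \<open>F\<close> that is smooth near \<open>p\<close>.\<close>

definition tangent_map ::
  "('m::topological_space, 'e::euclidean_space) chart set \<Rightarrow> ('m \<Rightarrow> 'm) \<Rightarrow> 'm \<Rightarrow> 'm vec \<Rightarrow> 'm vec"
  where
  "tangent_map A F p v = (\<lambda>g. if smooth_at A (F p) g then v (g \<circ> F) else 0)"


subsection \<open>Vector fields and one-forms\<close>

definition vector_field ::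
  "('m::topological_space, 'e::euclidean_space) chart set \<Rightarrow> 'm set \<Rightarrow> ('m \<Rightarrow> 'm vec) \<Rightarrow> bool" where
  "vector_field A V X \<longleftrightarrow>
     (\<forall>p\<in>V. X p \<in> tangent_space A p) \<and>
     (\<forall>U g. open U \<and> U \<subseteq> V \<and> smooth_fun A U g \<longrightarrow> smooth_fun A U (\<lambda>p. X p g))"

definition one_form ::
  "('m::topological_space, 'e::euclidean_space) chart set \<Rightarrow> 'm set \<Rightarrow> ('m \<Rightarrow> 'm covec) \<Rightarrow> bool" where
  "one_form A V \<alpha> \<longleftrightarrow>
     (\<forall>p\<in>V. \<alpha> p \<in> cotangent_space A p) \<and>
     (\<forall>U X. open U \<and> U \<subseteq> V \<and> vector_field A U X \<longrightarrow> smooth_fun A U (\<lambda>p. \<alpha> p (X p)))"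

definition differential ::
  "('m::topological_space, 'e::euclidean_space) chart set \<Rightarrow> ('m \<Rightarrow> real) \<Rightarrow> 'm \<Rightarrow> 'm covec" where
  "differential A g p v = (if v \<in> tangent_space A p then v g else 0)"

definition lie_bracket ::
  "('m::topological_space, 'e::euclidean_space) chart set \<Rightarrow>
     ('m \<Rightarrow> 'm vec) \<Rightarrow> ('m \<Rightarrow> 'm vec) \<Rightarrow> 'm \<Rightarrow> 'm vec" where
  "lie_bracket A X Y p =
     (\<lambda>g. if smooth_at A p g then X p (\<lambda>q. Y q g) - Y p (\<lambda>q. X q g) else 0)"

text \<open>The invariant formulas
    \<open>(\<pounds>\<^sub>X \<beta>)(Z) = X(\<beta>(Z)) - \<beta>([X, Z])\<close>  and
    \<open>(d\<alpha>)(Y, Z) = Y(\<alpha>(Z)) - Z(\<alpha>(Y)) - \<alpha>([Y, Z])\<close>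
  are tensorial in \<open>Z\<close> and in \<open>Y, Z\<close>, respectively, so that they may be evaluated on tangent vectors at
  \<open>p\<close> by means of arbitrary local extensions to vector fields.\<close>

definition extension ::
  "('m::topological_space, 'e::euclidean_space) chart set \<Rightarrow> 'm \<Rightarrow> 'm vec \<Rightarrow> 'm \<Rightarrow> 'm vec" where
  "extension A p v = (SOME Z. \<exists>V. open V \<and> p \<in> V \<and> vector_field A V Z \<and> Z p = v)"

definition lie_derivative ::
  "('m::topological_space, 'e::euclidean_space) chart set \<Rightarrow>
     ('m \<Rightarrow> 'm vec) \<Rightarrow> ('m \<Rightarrow> 'm covec) \<Rightarrow> 'm \<Rightarrow> 'm covec" where
  "lie_derivative A X \<beta> p v =
     (if v \<in> tangent_space A p
      then let Z = extension A p v in X p (\<lambda>q. \<beta> q (Z q)) - \<beta> p (lie_bracket A X Z p)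
      else 0)"

definition exterior_derivative ::
  "('m::topological_space, 'e::euclidean_space) chart set \<Rightarrow>
     ('m \<Rightarrow> 'm covec) \<Rightarrow> 'm \<Rightarrow> 'm vec \<Rightarrow> 'm vec \<Rightarrow> real" where
  "exterior_derivative A \<alpha> p u v =
     (if u \<in> tangent_space A p \<and> v \<in> tangent_space A p
      then let Y = extension A p u; Z = extension A p v
           in Y p (\<lambda>q. \<alpha> q (Z q)) - Z p (\<lambda>q. \<alpha> q (Y q)) - \<alpha> p (lie_bracket A Y Z p)
      else 0)"

definition interior_product ::
  "('m \<Rightarrow> 'm vec) \<Rightarrow> ('m \<Rightarrow> 'm vec \<Rightarrow> 'm vec \<Rightarrow> real) \<Rightarrow> 'm \<Rightarrow> 'm covec" where
  "interior_product Y \<omega> p v = \<omega> p (Y p) v"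


subsection \<open>Dirac structures\<close>

text \<open>A family of subspaces of the fibres of \<open>TM \<oplus> T\<^sup>*M\<close> is a subbundle if near every point it has a
  frame of smooth sections.\<close>

definition lin_comb :: "nat \<Rightarrow> (nat \<Rightarrow> real) \<Rightarrow> (nat \<Rightarrow> 'm vec \<times> 'm covec) \<Rightarrow> 'm vec \<times> 'm covec" where
  "lin_comb r a s = (\<lambda>g. \<Sum>i<r. a i * fst (s i) g, \<lambda>v. \<Sum>i<r. a i * snd (s i) v)"

definition subbundle ::
  "('m::topological_space, 'e::euclidean_space) chart set \<Rightarrow> ('m \<Rightarrow> ('m vec \<times> 'm covec) set) \<Rightarrow> bool"
  where
  "subbundle A D \<longleftrightarrow>
     (\<forall>p. D p \<subseteq> tangent_space A p \<times> cotangent_space A p) \<and>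
     (\<forall>p. \<exists>V r X \<alpha>. open V \<and> p \<in> V \<and>
        (\<forall>i<r::nat. vector_field A V (X i) \<and> one_form A V (\<alpha> i)) \<and>
        (\<forall>q\<in>V. D q = {lin_comb r a (\<lambda>i. (X i q, \<alpha> i q)) | a. True} \<and>
           (\<forall>a. lin_comb r a (\<lambda>i. (X i q, \<alpha> i q)) = (\<lambda>g. 0, \<lambda>v. 0) \<longrightarrow> (\<forall>i<r. a i = 0))))"

fun pairing :: "'m vec \<times> 'm covec \<Rightarrow> 'm vec \<times> 'm covec \<Rightarrow> real" where
  "pairing (u, \<alpha>) (v, \<beta>) = \<beta> u + \<alpha> v"

definition dirac_structure ::
  "('m::topological_space, 'e::euclidean_space) chart set \<Rightarrow> ('m \<Rightarrow> ('m vec \<times> 'm covec) set) \<Rightarrow> bool"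
  where
  "dirac_structure A D \<longleftrightarrow> subbundle A D \<and>
     (\<forall>p. D p = {\<sigma> \<in> tangent_space A p \<times> cotangent_space A p. \<forall>\<tau>\<in>D p. pairing \<sigma> \<tau> = 0})"

definition sections ::
  "('m::topological_space, 'e::euclidean_space) chart set \<Rightarrow> ('m \<Rightarrow> ('m vec \<times> 'm covec) set) \<Rightarrow>
     'm set \<Rightarrow> (('m \<Rightarrow> 'm vec) \<times> ('m \<Rightarrow> 'm covec)) set" where
  "sections A D V = {(X, \<alpha>). open V \<and> vector_field A V X \<and> one_form A V \<alpha> \<and>
     (\<forall>p\<in>V. (X p, \<alpha> p) \<in> D p)}"

fun courant_bracket ::
  "('m::topological_space, 'e::euclidean_space) chart set \<Rightarrow>
     ('m \<Rightarrow> 'm vec) \<times> ('m \<Rightarrow> 'm covec) \<Rightarrow> ('m \<Rightarrow> 'm vec) \<times> ('m \<Rightarrow> 'm covec) \<Rightarrow>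
     ('m \<Rightarrow> 'm vec) \<times> ('m \<Rightarrow> 'm covec)" where
  "courant_bracket A (X, \<alpha>) (Y, \<beta>) =
     (lie_bracket A X Y,
      \<lambda>p v. lie_derivative A X \<beta> p v - interior_product Y (exterior_derivative A \<alpha>) p v)"

definition closed_dirac_structure ::
  "('m::topological_space, 'e::euclidean_space) chart set \<Rightarrow> ('m \<Rightarrow> ('m vec \<times> 'm covec) set) \<Rightarrow> bool"
  where
  "closed_dirac_structure A D \<longleftrightarrow> dirac_structure A D \<and>
     (\<forall>V. \<forall>\<sigma>\<in>sections A D V. \<forall>\<tau>\<in>sections A D V. courant_bracket A \<sigma> \<tau> \<in> sections A D V)"

definition hamiltonian_vector_field ::
  "('m::topological_space, 'e::euclidean_space) chart set \<Rightarrow> ('m \<Rightarrow> ('m vec \<times> 'm covec) set) \<Rightarrow>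
     'm set \<Rightarrow> ('m \<Rightarrow> real) \<Rightarrow> ('m \<Rightarrow> 'm vec) \<Rightarrow> bool" where
  "hamiltonian_vector_field A D W f X \<longleftrightarrow> (X, differential A f) \<in> sections A D W"

definition admissible ::
  "('m::topological_space, 'e::euclidean_space) chart set \<Rightarrow> ('m \<Rightarrow> ('m vec \<times> 'm covec) set) \<Rightarrow>
     'm set \<Rightarrow> ('m \<Rightarrow> real) \<Rightarrow> bool" where
  "admissible A D W f \<longleftrightarrow> smooth_fun A W f \<and> (\<exists>X. hamiltonian_vector_field A D W f X)"


subsection \<open>Flows\<close>

text \<open>The velocity of \<open>\<gamma>\<close> at time \<open>t\<close> is the derivation \<open>g \<mapsto> (g \<circ> \<gamma>)'(t)\<close>.\<close>

definition integral_curve ::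
  "('m::topological_space, 'e::euclidean_space) chart set \<Rightarrow> 'm set \<Rightarrow> ('m \<Rightarrow> 'm vec) \<Rightarrow>
     real set \<Rightarrow> (real \<Rightarrow> 'm) \<Rightarrow> bool" where
  "integral_curve A W X J \<gamma> \<longleftrightarrow>
     open J \<and> is_interval J \<and> continuous_on J \<gamma> \<and> \<gamma> ` J \<subseteq> W \<and>
     (\<forall>t\<in>J. \<forall>g. smooth_at A (\<gamma> t) g \<longrightarrow> ((\<lambda>s. g (\<gamma> s)) has_real_derivative X (\<gamma> t) g) (at t))"

text \<open>\<open>\<phi>\<close> is the flow on \<open>W\<close> of the vector field \<open>X\<close>: the curve \<open>t \<mapsto> \<phi> t p\<close>, defined for \<open>t \<in> J p\<close>, is the
  integral curve through \<open>p\<close> that cannot be extended to a larger interval. Smoothness of \<open>\<phi>\<close> and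
  openness of its domain are not part of the definition.\<close>

definition is_flow ::
  "('m::topological_space, 'e::euclidean_space) chart set \<Rightarrow> 'm set \<Rightarrow> ('m \<Rightarrow> 'm vec) \<Rightarrow>
     ('m \<Rightarrow> real set) \<Rightarrow> (real \<Rightarrow> 'm \<Rightarrow> 'm) \<Rightarrow> bool" where
  "is_flow A W X J \<phi> \<longleftrightarrow>
     (\<forall>p\<in>W. 0 \<in> J p \<and> \<phi> 0 p = p \<and> integral_curve A W X (J p) (\<lambda>t. \<phi> t p) \<and>
        (\<forall>J' \<gamma>. integral_curve A W X J' \<gamma> \<and> J p \<subseteq> J' \<and> (\<forall>t\<in>J p. \<gamma> t = \<phi> t p) \<longrightarrow> J' = J p))"

definition flow_pullback_vec ::
  "('m::topological_space, 'e::euclidean_space) chart set \<Rightarrow> (real \<Rightarrow> 'm \<Rightarrow> 'm) \<Rightarrow> real \<Rightarrow>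
     ('m \<Rightarrow> 'm vec) \<Rightarrow> 'm \<Rightarrow> 'm vec" where
  "flow_pullback_vec A \<phi> t X p = tangent_map A (\<phi> (- t)) (\<phi> t p) (X (\<phi> t p))"

definition flow_pullback_form ::
  "('m::topological_space, 'e::euclidean_space) chart set \<Rightarrow> (real \<Rightarrow> 'm \<Rightarrow> 'm) \<Rightarrow> real \<Rightarrow>
     ('m \<Rightarrow> 'm covec) \<Rightarrow> 'm \<Rightarrow> 'm covec" where
  "flow_pullback_form A \<phi> t \<alpha> p v =
     (if v \<in> tangent_space A p then \<alpha> (\<phi> t p) (tangent_map A (\<phi> t) p v) else 0)"

end

theory Submission
  imports Defs
begin

text \<open>
  Let \<open>(e\<^sub>i)\<close> be a local frame of \<open>D\<close>. As \<open>d(df) = 0\<close>, the pullback \<open>\<phi>\<^sub>t\<^sup>*e\<^sub>i\<close> has time derivative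
  \<open>\<phi>\<^sub>t\<^sup>*[(X\<^sub>f, df), e\<^sub>i]\<close>, and since \<open>D\<close> is closed, the bracket is a combination \<open>\<Sum>\<^sub>j c\<^sub>i\<^sub>j e\<^sub>j\<close> with locally bounded
  coefficients. Hence for a fixed \<open>\<tau> \<in> D p\<close> the pairings \<open>\<langle>(\<phi>\<^sub>t\<^sup>*e\<^sub>i) p, \<tau>\<rangle>\<close> solve a homogeneous linear system and
  vanish at \<open>t = 0\<close>, so they vanish for small \<open>t\<close>, and \<open>(\<phi>\<^sub>t\<^sup>*e\<^sub>i) p \<in> D p\<close> because \<open>D\<close> is its own orthogonal.
  The flow property propagates this along the whole integral curve.
\<close>

subsection \<open>Calculus of smooth functions\<close>

text \<open>The flow is given only as a family of maximal integral curves, so uniqueness, the flow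
  law, openness of its domain and smooth dependence on the initial point have to be derived from
  \<open>is_flow\<close>; this is why an ODE theory with parameters comes first. The coefficients
  \<open>c\<close> of the brackets are pointwise witnesses, and nothing is known about their
  regularity in \<open>t\<close>; a bound is enough, because only Gronwall's inequality is applied
  to the linear system and no equation with these coefficients is ever solved. Testing against a
  fixed \<open>\<tau>\<close> instead of comparing subspaces keeps the rank of \<open>D\<close> out
  of the argument. The pulled-back vector contains the inverse of the tangent map of the flow; its
  time derivative is not taken from a formula for inverses but solved from the product of the
  tangent map with the pulled-back vector, which is the frame along the curve. The passage from
  derivations to coordinates rests on Hadamard's lemma, whose smooth coefficients come from the same
  parameter theorem as the smoothness of the flow.\<close>

abbreviation fderiv :: "('a::real_normed_vector \<Rightarrow> 'b::real_normed_vector) \<Rightarrow> 'a \<Rightarrow> 'a \<Rightarrow> 'b" where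
  "fderiv f x \<equiv> frechet_derivative f (at x)"

lemma Ck_on_Suc_has_derivative:
  "Ck_on (Suc k) S f \<Longrightarrow> x \<in> S \<Longrightarrow> (f has_derivative fderiv f x) (at x)"
  by (simp add: frechet_derivative_works)

lemma Ck_on_subset: "Ck_on k S f \<Longrightarrow> T \<subseteq> S \<Longrightarrow> Ck_on k T f"
  by (induction k arbitrary: f) (auto intro: continuous_on_subset)

text \<open>Differentiability is taken in the full space, so it sees a neighbourhood of the point;
  openness of \<open>S\<close> is what lets the values outside be ignored.\<close>

lemma Ck_on_cong:
  assumes "open S" "\<And>x. x \<in> S \<Longrightarrow> f x = g x" "Ck_on k S f"
  shows "Ck_on k S g"
  using assms(2,3)
proof (induction k arbitrary: f g)
  case 0
  then show ?case by (simp cong: continuous_on_cong)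
next
  case (Suc k)
  have d: "f differentiable (at x)" if "x \<in> S" for x
    using Suc.prems(2) that by simp
  have eq: "fderiv f x = fderiv g x" if "x \<in> S" for x
    using frechet_derivative_transform_within_open[OF d[OF that] \<open>open S\<close> that] Suc.prems(1) by blast
  have "g differentiable (at x)" if "x \<in> S" for x
    using d[OF that] has_derivative_transform_within_open[OF _ \<open>open S\<close> that, of f _ UNIV g] Suc.prems(1)
    unfolding differentiable_def by blast
  moreover have "Ck_on k S (\<lambda>x. fderiv g x v)" for v
    using Suc.IH[of "\<lambda>x. fderiv f x v" "\<lambda>x. fderiv g x v"] Suc.prems eq
    by simp
  ultimately show ?case by simp
qed

text \<open>Lets a derivative computed by hand stand in for \<open>frechet_derivative\<close>, which
  is a choice operator; the two agree on \<open>S\<close> by uniqueness.\<close>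

lemma Ck_on_SucI:
  assumes "open S" "\<And>x. x \<in> S \<Longrightarrow> (f has_derivative f' x) (at x)"
    and "\<And>v. Ck_on k S (\<lambda>x. f' x v)"
  shows "Ck_on (Suc k) S f"
proof -
  have "fderiv f x = f' x" if "x \<in> S" for x
    using frechet_derivative_at[OF assms(2)[OF that]] by simp
  then have "Ck_on k S (\<lambda>x. fderiv f x v)" for v
    by (intro Ck_on_cong[OF assms(1) _ assms(3)[of v]]) simp
  with assms(2) show ?thesis by (auto simp: differentiable_def)
qed

lemma Ck_on_continuous_on: "Ck_on k S f \<Longrightarrow> continuous_on S f"
  by (cases k) (auto intro!: continuous_at_imp_continuous_on differentiable_imp_continuous_within)

lemma Ck_on_SucD: "Ck_on (Suc k) S f \<Longrightarrow> Ck_on k S f"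
proof (induction k arbitrary: f)
  case 0
  then show ?case using Ck_on_continuous_on Ck_on.simps(1) by blast
next
  case (Suc k)
  show ?case
    unfolding Ck_on.simps(2)[of k] using Suc.IH Suc.prems unfolding Ck_on.simps(2)[of "Suc k"] by blast
qed

lemma Ck_on_le: "Ck_on k S f \<Longrightarrow> j \<le> k \<Longrightarrow> Ck_on j S f"
proof (induction k)
  case (Suc k)
  then show ?case using Ck_on_SucD by (metis le_Suc_eq)
qed simp

lemma Ck_on_local:
  assumes "\<And>x. x \<in> S \<Longrightarrow> \<exists>T. open T \<and> x \<in> T \<and> Ck_on k T f"
  shows "Ck_on k S f"
  using assms
proof (induction k arbitrary: f)
  case 0
  then show ?case
    by (metis Ck_on.simps(1) continuous_at_imp_continuous_on continuous_on_eq_continuous_at)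
next
  case (Suc k)
  have "f differentiable (at x)" if "x \<in> S" for x
    using Suc.prems[OF that] by auto
  moreover have "Ck_on k S (\<lambda>x. fderiv f x v)" for v
  proof (rule Suc.IH)
    fix x assume "x \<in> S"
    then obtain T where "open T" "x \<in> T" "Ck_on (Suc k) T f" using Suc.prems by blast
    then show "\<exists>T. open T \<and> x \<in> T \<and> Ck_on k T (\<lambda>x. fderiv f x v)" by auto
  qed
  ultimately show ?case by simp
qed

lemma Ck_on_const: "Ck_on k S (\<lambda>x. c)"
  by (induction k arbitrary: c) (auto simp: frechet_derivative_const)

lemma Ck_on_bounded_linear:
  assumes "bounded_linear f"
  shows "Ck_on k S f"
proof (cases k)
  case 0
  then show ?thesis using assms by (simp add: linear_continuous_on)
next
  case (Suc j)
  have "fderiv f x = f" for x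
    using frechet_derivative_at bounded_linear_imp_has_derivative[OF assms] by metis
  then show ?thesis
    using Suc bounded_linear_imp_differentiable[OF assms] by (simp add: Ck_on_const)
qed

section \<open>Closure of \<open>Ck_on\<close> under sums, products, composition and
  differentiation\<close>

lemma Ck_on_add:
  assumes "open S" "Ck_on k S f" "Ck_on k S g"
  shows "Ck_on k S (\<lambda>x. f x + g x)"
  using assms(2,3)
proof (induction k arbitrary: f g)
  case 0
  then show ?case by (simp add: continuous_on_add)
next
  case (Suc k)
  show ?case
    by (rule Ck_on_SucI[OF \<open>open S\<close> has_derivative_add
          [OF Ck_on_Suc_has_derivative[OF Suc.prems(1)] Ck_on_Suc_has_derivative[OF Suc.prems(2)]]])
       (use Suc in auto)
qed

text \<open>The derivative of a product is a sum of two products, each with one factor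
  differentiated and the other kept; the kept factor enters the induction hypothesis through
  \<open>Ck_on_SucD\<close>. One proof serves scaling, multiplication and inner product.\<close>

lemma (in bounded_bilinear) Ck_on:
  assumes "open S" "Ck_on k S f" "Ck_on k S g"
  shows "Ck_on k S (\<lambda>x. prod (f x) (g x))"
  using assms(2,3)
proof (induction k arbitrary: f g)
  case 0
  then show ?case by (simp add: continuous_on)
next
  case (Suc k)
  show ?case
    by (rule Ck_on_SucI[OF \<open>open S\<close> FDERIV
          [OF Ck_on_Suc_has_derivative[OF Suc.prems(1)] Ck_on_Suc_has_derivative[OF Suc.prems(2)]]])
       (use Suc.prems Ck_on_SucD[OF Suc.prems(1)] Ck_on_SucD[OF Suc.prems(2)] in
         \<open>auto intro!: Ck_on_add[OF \<open>open S\<close>] Suc.IH\<close>)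
qed

lemmas Ck_on_scaleR = bounded_bilinear.Ck_on[OF bounded_bilinear_scaleR]
lemmas Ck_on_mult = bounded_bilinear.Ck_on[OF bounded_bilinear_mult]

lemma Ck_on_linear_comp:
  assumes "bounded_linear L" "open S" "Ck_on k S f"
  shows "Ck_on k S (\<lambda>x. L (f x))"
  using assms(3)
proof (induction k arbitrary: f)
  case 0
  then show ?case using assms(1) by (simp add: bounded_linear.continuous_on)
next
  case (Suc k)
  show ?case
    by (rule Ck_on_SucI[OF \<open>open S\<close> bounded_linear.has_derivative
          [OF assms(1) Ck_on_Suc_has_derivative[OF Suc.prems]]])
       (use Suc in auto)
qed

lemma Ck_on_sum:
  assumes "open S" "\<And>i. i \<in> I \<Longrightarrow> Ck_on k S (f i)"
  shows "Ck_on k S (\<lambda>x. \<Sum>i\<in>I. f i x)"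
  using assms(2)
  by (induction I rule: infinite_finite_induct) (auto intro: Ck_on_const Ck_on_add[OF \<open>open S\<close>])

lemma Ck_on_Pair:
  fixes f :: "'a::real_normed_vector \<Rightarrow> 'b::real_normed_vector"
    and g :: "'a::real_normed_vector \<Rightarrow> 'c::real_normed_vector"
  assumes "open S" "Ck_on k S f" "Ck_on k S g"
  shows "Ck_on k S (\<lambda>x. (f x, g x))"
proof -
  have "bounded_linear (\<lambda>u::'b. (u, 0::'c))" "bounded_linear (\<lambda>u::'c. (0::'b, u))"
    by (auto intro!: bounded_linear_Pair bounded_linear_ident bounded_linear_zero)
  then have "Ck_on k S (\<lambda>x. (f x, 0) + (0, g x))"
    using assms by (intro Ck_on_add Ck_on_linear_comp[of "\<lambda>u. (u, 0)"] Ck_on_linear_comp[of "\<lambda>u. (0, u)"])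
  then show ?thesis by simp
qed

text \<open>\<open>Ck_on\<close> controls derivatives in a fixed direction only. The expansion over
  \<open>Basis\<close> turns a direction that varies with the point into scalar coefficients in
  front of finitely many fixed directions.\<close>

lemma frechet_derivative_euclidean:
  fixes f :: "'a::euclidean_space \<Rightarrow> 'b::real_normed_vector"
  assumes "f differentiable (at x)"
  shows "fderiv f x v = (\<Sum>b\<in>Basis. (v \<bullet> b) *\<^sub>R fderiv f x b)"
proof -
  interpret bounded_linear "fderiv f x"
    using assms frechet_derivative_works has_derivative_bounded_linear by blast
  have "fderiv f x (\<Sum>b\<in>Basis. (v \<bullet> b) *\<^sub>R b)
      = (\<Sum>b\<in>Basis. (v \<bullet> b) *\<^sub>R fderiv f x b)"
    by (simp add: sum scaleR)
  then show ?thesis by (simp add: euclidean_representation)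
qed

text \<open>In the chain rule the direction \<open>fderiv f x v\<close> varies with
  \<open>x\<close>; after the expansion over \<open>Basis\<close> the induction hypothesis applies
  to \<open>\<lambda>y. fderiv g y b\<close> with \<open>b\<close> fixed.\<close>

lemma Ck_on_compose:
  fixes g :: "'b::euclidean_space \<Rightarrow> 'c::real_normed_vector"
    and f :: "'a::real_normed_vector \<Rightarrow> 'b"
  assumes "open S" "Ck_on k T g" "Ck_on k S f" "f ` S \<subseteq> T"
  shows "Ck_on k S (\<lambda>x. g (f x))"
  using assms(2,3)
proof (induction k arbitrary: g)
  case 0
  then show ?case using assms(4) by (auto intro: continuous_on_compose2)
next
  case (Suc k)
  have fT: "f x \<in> T" if "x \<in> S" for x using that assms(4) by auto
  have d: "((\<lambda>x. g (f x)) has_derivative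
      (\<lambda>v. \<Sum>b\<in>Basis. (fderiv f x v \<bullet> b) *\<^sub>R fderiv g (f x) b)) (at x)"
    if "x \<in> S" for x
  proof -
    have "((\<lambda>x. g (f x)) has_derivative
      (\<lambda>v. fderiv g (f x) (fderiv f x v))) (at x)"
      by (rule has_derivative_compose[OF Ck_on_Suc_has_derivative[OF Suc.prems(2) that]
            Ck_on_Suc_has_derivative[OF Suc.prems(1) fT[OF that]]])
    then show ?thesis
      using Suc.prems(1) fT[OF that] by (subst (asm) frechet_derivative_euclidean) auto
  qed
  show ?case
  proof (rule Ck_on_SucI[OF \<open>open S\<close> d])
    fix v
    have "Ck_on k S (\<lambda>x. fderiv f x v \<bullet> b)" for b
      using Suc.prems(2) by (intro Ck_on_linear_comp[OF bounded_linear_inner_left \<open>open S\<close>]) simp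
    moreover have "Ck_on k S (\<lambda>x. fderiv g (f x) b)" for b
      using Suc.prems by (intro Suc.IH[of "\<lambda>y. fderiv g y b"])
        (auto dest!: Ck_on_SucD simp del: Ck_on.simps simp: Ck_on.simps(2)[of k T])
    ultimately show "Ck_on k S (\<lambda>x. \<Sum>b\<in>Basis. (fderiv f x v \<bullet> b) *\<^sub>R
        fderiv g (f x) b)"
      by (intro Ck_on_sum Ck_on_scaleR \<open>open S\<close>)
  qed
qed

lemma Ck_on_frechet_derivative:
  fixes f :: "'a::euclidean_space \<Rightarrow> 'b::real_normed_vector"
  assumes "open S" "Ck_on (Suc k) T f" "Ck_on k S p" "Ck_on k S w" "p ` S \<subseteq> T"
  shows "Ck_on k S (\<lambda>x. fderiv f (p x) (w x))"
proof -
  have c: "Ck_on k S (\<lambda>x. \<Sum>b\<in>Basis. (w x \<bullet> b) *\<^sub>R fderiv f (p x) b)"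
  proof (intro Ck_on_sum Ck_on_scaleR \<open>open S\<close>)
    fix b
    show "Ck_on k S (\<lambda>x. fderiv f (p x) b)"
      using assms by (intro Ck_on_compose[OF \<open>open S\<close>, of k T "\<lambda>y. fderiv f y b"]) auto
    show "Ck_on k S (\<lambda>x. w x \<bullet> b)"
      using assms by (intro Ck_on_linear_comp[OF bounded_linear_inner_left])
  qed
  have eq: "(\<Sum>b\<in>Basis. (w x \<bullet> b) *\<^sub>R fderiv f (p x) b) =
      fderiv f (p x) (w x)" if "x \<in> S" for x
    using assms(2,5) that by (subst frechet_derivative_euclidean[of f _ "w x"]) auto
  show ?thesis by (rule Ck_on_cong[OF \<open>open S\<close> eq c])
qed

lemma Ck_on_euclidean:
  fixes f :: "'a::real_normed_vector \<Rightarrow> 'b::euclidean_space"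
  assumes "open S" "\<And>b. b \<in> Basis \<Longrightarrow> Ck_on k S (\<lambda>x. f x \<bullet> b)"
  shows "Ck_on k S f"
proof -
  have "Ck_on k S (\<lambda>x. \<Sum>b\<in>Basis. (f x \<bullet> b) *\<^sub>R b)"
    by (intro Ck_on_sum Ck_on_scaleR Ck_on_const assms)
  then show ?thesis by (simp add: euclidean_representation)
qed

section \<open>The same closure rules for smooth functions\<close>

lemma smooth_onD: "smooth_on S f \<Longrightarrow> Ck_on k S f"
  by (simp add: smooth_on_def)

lemma smooth_on_differentiable: "smooth_on S f \<Longrightarrow> x \<in> S \<Longrightarrow> f differentiable (at x)"
  using smooth_onD[of S f "Suc 0"] by simp

lemma smooth_on_has_derivative:
  "smooth_on S f \<Longrightarrow> x \<in> S \<Longrightarrow> (f has_derivative fderiv f x) (at x)"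
  using smooth_onD Ck_on_Suc_has_derivative by metis

lemma smooth_on_subset: "smooth_on S f \<Longrightarrow> T \<subseteq> S \<Longrightarrow> smooth_on T f"
  by (auto simp: smooth_on_def intro: Ck_on_subset)

lemma smooth_on_cong:
  "open S \<Longrightarrow> (\<And>x. x \<in> S \<Longrightarrow> f x = g x) \<Longrightarrow> smooth_on S f \<Longrightarrow> smooth_on S g"
  by (auto simp: smooth_on_def intro: Ck_on_cong)

lemma smooth_on_local:
  "(\<And>x. x \<in> S \<Longrightarrow> \<exists>T. open T \<and> x \<in> T \<and> smooth_on T f) \<Longrightarrow> smooth_on S f"
  unfolding smooth_on_def by (meson Ck_on_local)

lemma smooth_on_continuous_on: "smooth_on S f \<Longrightarrow> continuous_on S f"
  using Ck_on_continuous_on smooth_onD by blast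

lemma smooth_on_const: "smooth_on S (\<lambda>x. c)"
  by (simp add: smooth_on_def Ck_on_const)

lemma smooth_on_bounded_linear: "bounded_linear f \<Longrightarrow> smooth_on S f"
  by (simp add: smooth_on_def Ck_on_bounded_linear)

lemma smooth_on_add: "open S \<Longrightarrow> smooth_on S f \<Longrightarrow> smooth_on S g \<Longrightarrow> smooth_on S (\<lambda>x. f x + g x)"
  by (simp add: smooth_on_def Ck_on_add)

lemma smooth_on_mult:
  fixes f :: "_ \<Rightarrow> 'b::real_normed_algebra"
  shows "open S \<Longrightarrow> smooth_on S f \<Longrightarrow> smooth_on S g \<Longrightarrow> smooth_on S (\<lambda>x. f x * g x)"
  by (simp add: smooth_on_def Ck_on_mult)

lemma smooth_on_inner:
  "open S \<Longrightarrow> smooth_on S f \<Longrightarrow> smooth_on S g \<Longrightarrow> smooth_on S (\<lambda>x. f x \<bullet> g x)"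
  by (simp add: smooth_on_def bounded_bilinear.Ck_on[OF bounded_bilinear_inner])

lemma smooth_on_linear_comp:
  "bounded_linear L \<Longrightarrow> open S \<Longrightarrow> smooth_on S f \<Longrightarrow> smooth_on S (\<lambda>x. L (f x))"
  by (simp add: smooth_on_def Ck_on_linear_comp)

lemma smooth_on_Pair:
  "open S \<Longrightarrow> smooth_on S f \<Longrightarrow> smooth_on S g \<Longrightarrow> smooth_on S (\<lambda>x. (f x, g x))"
  by (simp add: smooth_on_def Ck_on_Pair)

lemma smooth_on_compose:
  fixes g :: "'b::euclidean_space \<Rightarrow> 'c::real_normed_vector"
    and f :: "'a::real_normed_vector \<Rightarrow> 'b"
  shows "open S \<Longrightarrow> smooth_on T g \<Longrightarrow> smooth_on S f \<Longrightarrow> f ` S \<subseteq> T \<Longrightarrow> smooth_on S (\<lambda>x. g (f x))"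
  unfolding smooth_on_def using Ck_on_compose by blast

lemma smooth_on_frechet_derivative:
  fixes f :: "'a::euclidean_space \<Rightarrow> 'b::real_normed_vector"
  shows "open S \<Longrightarrow> smooth_on T f \<Longrightarrow> smooth_on S p \<Longrightarrow> smooth_on S w \<Longrightarrow> p ` S \<subseteq> T \<Longrightarrow>
    smooth_on S (\<lambda>x. fderiv f (p x) (w x))"
  unfolding smooth_on_def using Ck_on_frechet_derivative by blast

lemma smooth_on_euclidean:
  fixes f :: "'a::real_normed_vector \<Rightarrow> 'b::euclidean_space"
  shows "open S \<Longrightarrow> (\<And>b. b \<in> Basis \<Longrightarrow> smooth_on S (\<lambda>x. f x \<bullet> b)) \<Longrightarrow> smooth_on S f"
  by (simp add: smooth_on_def Ck_on_euclidean)

subsection \<open>Ordinary differential equations\<close>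

text \<open>Origin of the contraction factor 1/2: integrating the weight
  \<open>exp (2 * L * t)\<close> divides it by \<open>2 * L\<close>, and the Lipschitz constant
  \<open>L\<close> in front leaves one half.\<close>

lemma weight_integral:
  fixes L a :: real
  assumes "L > 0"
  shows "((\<lambda>s. L * a * exp (2 * L * (a * s))) has_integral (exp (2 * L * a) - 1) / 2) {0..1}"
proof -
  have "((\<lambda>s. L * a * exp (2 * L * (a * s))) has_integral
      exp (2 * L * (a * 1)) / 2 - exp (2 * L * (a * 0)) / 2) {0..1}"
    by (intro fundamental_theorem_of_calculus)
       (auto intro!: derivative_eq_intros simp: has_real_derivative_iff_has_vector_derivative[symmetric])
  then show ?thesis by (simp add: diff_divide_distrib)
qed

text \<open>Bielecki's weight \<open>exp (2 L \<bar>t\<bar>)\<close> makes the Picard operator a contraction on a time interval of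
  arbitrary length. The integral from \<open>0\<close> to \<open>t\<close> is written as \<open>t\<close> times an integral over \<open>{0..1}\<close>,
  which treats both signs of \<open>t\<close> at once.\<close>

lemma picard_integral_solution:
  fixes G :: "real \<Rightarrow> 'p::metric_space \<Rightarrow> 'f::banach \<Rightarrow> 'f" and w :: "'p \<Rightarrow> 'f"
  assumes contG: "continuous_on UNIV (\<lambda>(t, p, z). G t p z)"
    and lip: "\<And>t p z z'. norm (G t p z - G t p z') \<le> L * norm (z - z')"
    and bndG: "\<And>t p. norm (G t p 0) \<le> C"
    and contw: "continuous_on UNIV w" and bndw: "\<And>p. norm (w p) \<le> C"
    and T: "T > 0" and L: "L > 0"
  obtains \<psi> where "continuous_on ({-T..T} \<times> UNIV) \<psi>"
    "\<And>t p. t \<in> {-T..T} \<Longrightarrow> \<psi> (t, p) = w p + t *\<^sub>R integral {0..1} (\<lambda>s. G (t * s) p (\<psi> (t * s, p)))"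
proof -
  \<comment> \<open>Clamping time to \<open>{-T..T}\<close> makes the operator act on functions on
    all of \<open>real \<times> 'p\<close>, so that the complete space of bounded continuous
    functions on a type can be used.\<close>
  define c :: "real \<Rightarrow> real" where "c t = max (-T) (min T t)" for t
  define e :: "real \<Rightarrow> real" where "e t = exp (2 * L * \<bar>t\<bar>)" for t
  have c: "\<bar>c t\<bar> \<le> T" for t using T by (auto simp: c_def)
  have c_id: "c t = t" if "t \<in> {-T..T}" for t using that by (auto simp: c_def)
  have cs: "\<bar>c t * s\<bar> \<le> T" if "s \<in> {0..1}" for t s
    using mult_mono[OF c[of t], of "\<bar>s\<bar>" 1] that T by (auto simp: abs_mult)
  have contc: "continuous_on S (\<lambda>x. c (f x))" if "continuous_on S f" for S and f :: "'q::topological_space \<Rightarrow> real"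
    unfolding c_def by (intro continuous_intros that)
  have conte: "continuous_on S (\<lambda>x. e (f x))" if "continuous_on S f" for S and f :: "'q::topological_space \<Rightarrow> real"
    unfolding e_def by (intro continuous_intros that)
  have e_pos: "e t > 0" for t by (simp add: e_def)
  have e_ge: "e t \<ge> 1" for t using L by (simp add: e_def)
  have contGc: "continuous_on S (\<lambda>x. G (f x) (g x) (h x))"
    if "continuous_on S f" "continuous_on S g" "continuous_on S h"
    for S and f :: "'q::topological_space \<Rightarrow> real" and g h
  proof -
    have "continuous_on S (\<lambda>x. (f x, g x, h x))" by (intro continuous_intros that)
    from continuous_on_compose2[OF contG this] show ?thesis by simp
  qed
  \<comment> \<open>The unknown \<open>h\<close> is the solution divided by the weight
    \<open>e\<close>; in this way the weighted norm becomes the plain supremum norm.\<close>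
  define I where "I h t p = integral {0..1} (\<lambda>s. G (c t * s) p (e (c t * s) *\<^sub>R h (c t * s, p)))"
    for h :: "real \<times> 'p \<Rightarrow> 'f" and t p
  define \<Phi> where "\<Phi> h = (\<lambda>(t, p). (1 / e (c t)) *\<^sub>R (w p + c t *\<^sub>R I h t p))" for h :: "real \<times> 'p \<Rightarrow> 'f"
  have contI: "continuous_on UNIV (\<lambda>x. I h (fst x) (snd x))" if "continuous_on UNIV h" for h
  proof -
    have "continuous_on (UNIV \<times> cbox 0 1)
        (\<lambda>(x::real \<times> 'p, s). G (c (fst x) * s) (snd x) (e (c (fst x) * s) *\<^sub>R h (c (fst x) * s, snd x)))"
      unfolding case_prod_beta
      by (intro contGc continuous_intros contc conte continuous_on_compose2[OF that]) auto
    from integral_continuous_on_param[OF this] show ?thesis by (simp add: I_def)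
  qed
  have contIs: "continuous_on {0..1} (\<lambda>s. G (c t * s) p (e (c t * s) *\<^sub>R h (c t * s, p)))"
    if "continuous_on UNIV h" for h t p
    by (intro contGc continuous_intros contc conte continuous_on_compose2[OF that]) auto
  have diffI: "norm (c t *\<^sub>R I h t p - c t *\<^sub>R I k t p) \<le> e (c t) / 2 * M"
    if h: "continuous_on UNIV h" and k: "continuous_on UNIV k" and M: "\<And>x. norm (h x - k x) \<le> M" for h k t p M
  proof -
    have M0: "0 \<le> M" using M order_trans[OF norm_ge_zero] by blast
    have "norm (I h t p - I k t p) = norm (integral {0..1} (\<lambda>s. G (c t * s) p (e (c t * s) *\<^sub>R h (c t * s, p))
        - G (c t * s) p (e (c t * s) *\<^sub>R k (c t * s, p))))"
      unfolding I_def
      by (subst integral_diff) (auto intro!: integrable_continuous_real contIs h k)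
    then have "\<bar>c t\<bar> * norm (I h t p - I k t p) = norm (integral {0..1} (\<lambda>s. \<bar>c t\<bar> *\<^sub>R (G (c t * s) p (e (c t * s) *\<^sub>R h (c t * s, p))
        - G (c t * s) p (e (c t * s) *\<^sub>R k (c t * s, p)))))"
      by simp
    also have "\<dots> \<le> integral {0..1} (\<lambda>s. L * \<bar>c t\<bar> * exp (2 * L * (\<bar>c t\<bar> * s)) * M)"
    proof (rule integral_norm_bound_integral)
      show "(\<lambda>s. \<bar>c t\<bar> *\<^sub>R (G (c t * s) p (e (c t * s) *\<^sub>R h (c t * s, p))
        - G (c t * s) p (e (c t * s) *\<^sub>R k (c t * s, p)))) integrable_on {0..1}"
        by (intro integrable_continuous_real continuous_intros contIs h k)
      show "(\<lambda>s. L * \<bar>c t\<bar> * exp (2 * L * (\<bar>c t\<bar> * s)) * M) integrable_on {0..1}"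
        by (intro integrable_continuous_real continuous_intros)
      fix s :: real assume s: "s \<in> {0..1}"
      have es: "e (c t * s) = exp (2 * L * (\<bar>c t\<bar> * s))" using s by (simp add: e_def abs_mult)
      have "norm (G (c t * s) p (e (c t * s) *\<^sub>R h (c t * s, p)) - G (c t * s) p (e (c t * s) *\<^sub>R k (c t * s, p)))
          \<le> L * norm (e (c t * s) *\<^sub>R h (c t * s, p) - e (c t * s) *\<^sub>R k (c t * s, p))" by (rule lip)
      also have "\<dots> = L * (e (c t * s) * norm (h (c t * s, p) - k (c t * s, p)))"
        using e_pos[of "c t * s"] by (simp flip: scaleR_diff_right)
      also have "\<dots> \<le> L * (e (c t * s) * M)"
        using L e_pos[of "c t * s"] M by (intro mult_left_mono) auto
      finally have "\<bar>c t\<bar> * norm (G (c t * s) p (e (c t * s) *\<^sub>R h (c t * s, p)) - G (c t * s) p (e (c t * s) *\<^sub>R k (c t * s, p)))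
          \<le> \<bar>c t\<bar> * (L * (e (c t * s) * M))" by (intro mult_left_mono) auto
      then show "norm (\<bar>c t\<bar> *\<^sub>R (G (c t * s) p (e (c t * s) *\<^sub>R h (c t * s, p))
        - G (c t * s) p (e (c t * s) *\<^sub>R k (c t * s, p)))) \<le> L * \<bar>c t\<bar> * exp (2 * L * (\<bar>c t\<bar> * s)) * M"
        unfolding es norm_scaleR by (simp add: mult_ac)
    qed
    also have "\<dots> = (e (c t) - 1) / 2 * M"
      using integral_unique[OF has_integral_mult_left[OF weight_integral[OF L, of "\<bar>c t\<bar>"], of M]]
      unfolding e_def abs_idempotent .
    also have "\<dots> \<le> e (c t) / 2 * M" using M0 by (intro mult_right_mono) auto
    finally show ?thesis by (simp flip: scaleR_diff_right)
  qed
  have cont\<Phi>: "continuous_on UNIV (\<Phi> h)" if "continuous_on UNIV h" for h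
  proof -
    have ne: "e t \<noteq> 0" for t using e_pos[of t] by simp
    have "continuous_on UNIV (\<lambda>x::real \<times> 'p. (1 / e (c (fst x))) *\<^sub>R (w (snd x) + c (fst x) *\<^sub>R I h (fst x) (snd x)))"
      by (intro continuous_intros conte contc contI that continuous_on_compose2[OF contw] ballI) (auto simp: ne)
    then show ?thesis by (simp add: \<Phi>_def case_prod_beta')
  qed
  have norm_inv: "norm ((1 / e (c t)) *\<^sub>R x) \<le> norm x" for t and x :: 'f
    using e_ge[of "c t"] mult_right_mono[of 1 "e (c t)" "norm x"] by (simp add: field_simps)
  have \<Phi>_mem: "\<Phi> h \<in> bcontfun" if h: "h \<in> bcontfun" for h
  proof -
    have ch: "continuous_on UNIV h" and "bounded (range h)" using h by (auto simp: bcontfun_def)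
    then obtain M where M: "\<And>x. norm (h x) \<le> M" by (auto simp: bounded_iff)
    have M0: "0 \<le> M" using M order_trans[OF norm_ge_zero] by blast
    have "norm (\<Phi> h (t, p)) \<le> C + (T * C + exp (2 * L * T) / 2 * M)" for t p
    proof -
      \<comment> \<open>Boundedness is measured from the zero function, at which the integrand is
        \<open>G t p 0\<close> and \<open>bndG\<close> applies.\<close>
      have I0: "norm (c t *\<^sub>R I (\<lambda>x. 0) t p) \<le> T * C"
      proof -
        have "norm (I (\<lambda>x. 0) t p) \<le> integral {0..1} (\<lambda>s::real. C)"
          unfolding I_def using contIs[of "\<lambda>x. 0" t p] bndG
          by (intro integral_norm_bound_integral) (auto intro!: integrable_continuous_real)
        then show ?thesis using c[of t] T by (simp add: mult_mono)
      qed
      have "norm (c t *\<^sub>R I h t p - c t *\<^sub>R I (\<lambda>x. 0) t p) \<le> e (c t) / 2 * M"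
        using M by (intro diffI ch) auto
      also have "\<dots> \<le> exp (2 * L * T) / 2 * M"
        using c[of t] L M0 by (intro mult_right_mono) (auto simp: e_def)
      finally have "norm (c t *\<^sub>R I h t p) \<le> T * C + exp (2 * L * T) / 2 * M"
        using I0 norm_triangle_sub[of "c t *\<^sub>R I h t p" "c t *\<^sub>R I (\<lambda>x. 0) t p"] by linarith
      then have "norm (w p + c t *\<^sub>R I h t p) \<le> C + (T * C + exp (2 * L * T) / 2 * M)"
        using bndw[of p] norm_triangle_ineq[of "w p" "c t *\<^sub>R I h t p"] by linarith
      then show ?thesis unfolding \<Phi>_def prod.case using norm_inv order_trans by blast
    qed
    then show ?thesis using cont\<Phi>[OF ch] by (auto simp: bcontfun_def bounded_iff)
  qed
  define \<Psi> where "\<Psi> h = Bcontfun (\<Phi> (apply_bcontfun h))" for h :: "(real \<times> 'p) \<Rightarrow>\<^sub>C 'f"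
  have \<Psi>: "apply_bcontfun (\<Psi> h) = \<Phi> (apply_bcontfun h)" for h
    unfolding \<Psi>_def by (rule Bcontfun_inverse[OF \<Phi>_mem[OF apply_bcontfun]])
  have "\<exists>!h. \<Psi> h = h"
  proof (rule banach_fix_type[of "1/2"])
    show "\<forall>h k. dist (\<Psi> h) (\<Psi> k) \<le> 1 / 2 * dist h k"
    proof (intro allI dist_bound)
      fix h k :: "(real \<times> 'p) \<Rightarrow>\<^sub>C 'f" and x :: "real \<times> 'p"
      obtain t p where x: "x = (t, p)" by (cases x)
      have "norm (c t *\<^sub>R I h t p - c t *\<^sub>R I k t p) \<le> e (c t) / 2 * dist h k"
        using dist_bounded[of h _ k] by (intro diffI) (auto simp: dist_norm)
      then have "(1 / e (c t)) * norm (c t *\<^sub>R I h t p - c t *\<^sub>R I k t p) \<le> (1 / e (c t)) * (e (c t) / 2 * dist h k)"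
        using e_pos[of "c t"] by (intro mult_left_mono) auto
      then have "norm ((1 / e (c t)) *\<^sub>R (c t *\<^sub>R I h t p - c t *\<^sub>R I k t p)) \<le> 1 / 2 * dist h k"
        using e_pos[of "c t"] by simp
      moreover have "\<Phi> h (t, p) - \<Phi> k (t, p) = (1 / e (c t)) *\<^sub>R (c t *\<^sub>R I h t p - c t *\<^sub>R I k t p)"
        by (simp add: \<Phi>_def algebra_simps)
      ultimately show "dist (\<Psi> h x) (\<Psi> k x) \<le> 1 / 2 * dist h k"
        by (simp add: \<Psi> x dist_norm)
    qed
  qed auto
  then obtain h where h: "\<Psi> h = h" by blast
  define \<psi> where "\<psi> = (\<lambda>(t, p). e t *\<^sub>R h (t, p))"
  show ?thesis
  proof
    have "continuous_on UNIV (\<lambda>x::real\<times>'p. e (fst x) *\<^sub>R h x)"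
      by (intro continuous_intros conte continuous_on_apply_bcontfun)
    then show "continuous_on ({-T..T} \<times> UNIV) \<psi>"
      unfolding \<psi>_def case_prod_beta' by (auto intro: continuous_on_subset)
    fix t p assume t: "t \<in> {-T..T}"
    have "\<psi> (t, p) = e t *\<^sub>R \<Phi> h (t, p)" using \<Psi>[of h] h by (simp add: \<psi>_def)
    also have "\<dots> = w p + t *\<^sub>R I h t p" using e_pos[of t] by (simp add: \<Phi>_def c_id[OF t])
    also have "I h t p = integral {0..1} (\<lambda>s. G (t * s) p (\<psi> (t * s, p)))"
      unfolding I_def \<psi>_def by (simp add: c_id[OF t])
    finally show "\<psi> (t, p) = w p + t *\<^sub>R integral {0..1} (\<lambda>s. G (t * s) p (\<psi> (t * s, p)))" .
  qed
qed

text \<open>A substitution turns the expression into a difference of two values of an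
  antiderivative. Basing the antiderivative at \<open>-T\<close> rather than at 0 avoids a case
  distinction on the sign of \<open>t\<close>.\<close>

lemma scaled_integral_has_vector_derivative:
  fixes g :: "real \<Rightarrow> 'f::banach"
  assumes g: "continuous_on {-T..T} g" and t: "\<bar>t\<bar> < T"
  shows "((\<lambda>t. t *\<^sub>R integral {0..1} (\<lambda>s. g (t * s))) has_vector_derivative g t) (at t)"
proof -
  define \<Gamma> where "\<Gamma> u = integral {-T..u} g" for u
  have \<Gamma>: "(\<Gamma> has_vector_derivative g u) (at u within {-T..T})" if "u \<in> {-T..T}" for u
    unfolding \<Gamma>_def by (rule integral_has_vector_derivative[OF g that])
  have eq: "u *\<^sub>R integral {0..1} (\<lambda>s. g (u * s)) = \<Gamma> u - \<Gamma> 0" if u: "u \<in> {-T<..<T}" for u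
  proof -
    have us: "u * s \<in> {-T..T}" if "s \<in> {0..1}" for s
    proof -
      have "\<bar>u * s\<bar> \<le> T * 1" unfolding abs_mult using u that by (intro mult_mono) auto
      then show ?thesis by auto
    qed
    have "((\<lambda>s. u *\<^sub>R g (u * s)) has_integral \<Gamma> (u * 1) - \<Gamma> (u * 0)) {0..1}"
    proof (rule fundamental_theorem_of_calculus)
      fix s :: real assume s: "s \<in> {0..1}"
      have "((\<Gamma> \<circ> (*) u) has_vector_derivative u *\<^sub>R g (u * s)) (at s within {0..1})"
      proof (rule vector_diff_chain_within)
        show "((*) u has_vector_derivative u) (at s within {0..1})"
          by (auto intro!: derivative_eq_intros simp: has_real_derivative_iff_has_vector_derivative[symmetric])
        show "(\<Gamma> has_vector_derivative g (u * s)) (at (u * s) within (*) u ` {0..1})"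
          by (rule has_vector_derivative_within_subset[OF \<Gamma>[OF us[OF s]]]) (use us in auto)
      qed
      then show "((\<lambda>s. \<Gamma> (u * s)) has_vector_derivative u *\<^sub>R g (u * s)) (at s within {0..1})"
        by (simp add: o_def)
    qed simp
    from integral_unique[OF this] show ?thesis by simp
  qed
  have "(\<Gamma> has_vector_derivative g t) (at t)"
    using has_vector_derivative_within_subset[OF \<Gamma>[of t], of "{-T<..<T}"] t
      at_within_open[of t "{-T<..<T}"] by (auto simp: abs_less_iff greaterThanLessThan_subseteq_atLeastAtMost_iff)
  then have "((\<lambda>u. \<Gamma> u - \<Gamma> 0) has_vector_derivative g t) (at t)"
    by (auto intro!: derivative_eq_intros)
  then show ?thesis
    by (rule has_vector_derivative_transform_within_open[of _ _ _ "{-T<..<T}"]) (use t eq in auto)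
qed

lemma picard_solution:
  fixes G :: "real \<Rightarrow> 'p::metric_space \<Rightarrow> 'f::banach \<Rightarrow> 'f" and w :: "'p \<Rightarrow> 'f"
  assumes contG: "continuous_on UNIV (\<lambda>(t, p, z). G t p z)"
    and lip: "\<And>t p z z'. norm (G t p z - G t p z') \<le> L * norm (z - z')"
    and bndG: "\<And>t p. norm (G t p 0) \<le> C"
    and contw: "continuous_on UNIV w" and bndw: "\<And>p. norm (w p) \<le> C"
    and T: "T > 0" and L: "L > 0"
  obtains \<psi> where "continuous_on ({-T..T} \<times> UNIV) \<psi>" "\<And>p. \<psi> (0, p) = w p"
    "\<And>t p. t \<in> {-T<..<T} \<Longrightarrow> ((\<lambda>t. \<psi> (t, p)) has_vector_derivative G t p (\<psi> (t, p))) (at t)"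
proof -
  obtain \<psi> where cont: "continuous_on ({-T..T} \<times> UNIV) \<psi>"
    and \<psi>: "\<And>t p. t \<in> {-T..T} \<Longrightarrow> \<psi> (t, p) = w p + t *\<^sub>R integral {0..1} (\<lambda>s. G (t * s) p (\<psi> (t * s, p)))"
    using picard_integral_solution[OF assms] by blast
  show ?thesis
  proof (rule that[OF cont])
    show "\<psi> (0, p) = w p" for p using \<psi>[of 0] T by simp
    fix t p assume t: "t \<in> {-T<..<T}"
    have "continuous_on {-T..T} (\<lambda>t. (t, p, \<psi> (t, p)))"
      by (intro continuous_intros continuous_on_compose2[OF cont]) auto
    from continuous_on_compose2[OF contG this]
    have "((\<lambda>t. t *\<^sub>R integral {0..1} (\<lambda>s. G (t * s) p (\<psi> (t * s, p)))) has_vector_derivative G t p (\<psi> (t, p))) (at t)"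
      using t by (intro scaled_integral_has_vector_derivative[of T "\<lambda>t. G t p (\<psi> (t, p))"]) auto
    from has_vector_derivative_add[OF has_vector_derivative_const this]
    have "((\<lambda>t. w p + t *\<^sub>R integral {0..1} (\<lambda>s. G (t * s) p (\<psi> (t * s, p)))) has_vector_derivative G t p (\<psi> (t, p))) (at t)"
      by simp
    then show "((\<lambda>t. \<psi> (t, p)) has_vector_derivative G t p (\<psi> (t, p))) (at t)"
      by (rule has_vector_derivative_transform_within_open[of _ _ _ "{-T<..<T}"]) (use t \<psi> in auto)
  qed
qed

text \<open>\<open>H (p, q)\<close> is the mean of the derivative over the segment from
  \<open>p\<close> to \<open>q\<close>, which stays in \<open>S\<close> by convexity. Its joint
  continuity up to the diagonal is what makes difference quotients of solutions tractable.\<close>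

lemma C1_mean_value_operator:
  fixes f :: "'a::euclidean_space \<Rightarrow> 'b::euclidean_space"
  assumes f: "Ck_on (Suc 0) S f" and S: "open S" "convex S"
  obtains H :: "'a \<times> 'a \<Rightarrow> 'a \<Rightarrow>\<^sub>L 'b" where "continuous_on (S \<times> S) H"
    "\<And>p q. p \<in> S \<Longrightarrow> q \<in> S \<Longrightarrow> f q - f p = H (p, q) (q - p)"
    "\<And>p v. p \<in> S \<Longrightarrow> H (p, p) v = fderiv f p v"
proof -
  define E where "E x = Blinfun (fderiv f x)" for x
  have f': "(f has_derivative fderiv f x) (at x)" if "x \<in> S" for x
    using Ck_on_Suc_has_derivative[OF f that] .
  have E: "blinfun_apply (E x) = fderiv f x" if "x \<in> S" for x
    unfolding E_def by (rule bounded_linear_Blinfun_apply[OF has_derivative_bounded_linear[OF f'[OF that]]])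
  have contE: "continuous_on S E"
  proof (rule continuous_on_blinfun_componentwise)
    fix i
    have "continuous_on S (\<lambda>x. fderiv f x i)" using f by simp
    then show "continuous_on S (\<lambda>x. E x i)" using E by (simp cong: continuous_on_cong)
  qed
  have seg: "p + s *\<^sub>R (q - p) \<in> S" if "p \<in> S" "q \<in> S" "s \<in> {0..1}" for p q and s :: real
  proof -
    have "(1 - s) *\<^sub>R p + s *\<^sub>R q \<in> S" using S(2) that by (auto simp: convex_alt)
    moreover have "(1 - s) *\<^sub>R p + s *\<^sub>R q = p + s *\<^sub>R (q - p)" by (simp add: algebra_simps)
    ultimately show ?thesis by simp
  qed
  define H where "H = (\<lambda>(p, q). integral {0..1} (\<lambda>s. E (p + s *\<^sub>R (q - p))))"
  have conts: "continuous_on {0..1} (\<lambda>s. E (p + s *\<^sub>R (q - p)))" if "p \<in> S" "q \<in> S" for p q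
    using seg[OF that] by (intro continuous_on_compose2[OF contE] continuous_intros) auto
  show ?thesis
  proof
    have "continuous_on ((S \<times> S) \<times> cbox 0 1) (\<lambda>(x, s::real). E (fst x + s *\<^sub>R (snd x - fst x)))"
      unfolding case_prod_beta
      by (intro continuous_on_compose2[OF contE] continuous_intros) (use seg in auto)
    from integral_continuous_on_param[OF this] show "continuous_on (S \<times> S) H"
      by (simp add: H_def case_prod_beta')
    fix p q assume pq: "p \<in> S" "q \<in> S"
    have "((\<lambda>s. E (p + s *\<^sub>R (q - p)) (q - p)) has_integral f (p + 1 *\<^sub>R (q - p)) - f (p + 0 *\<^sub>R (q - p))) {0..1}"
    proof (rule fundamental_theorem_of_calculus)
      fix s :: real assume s: "s \<in> {0..1}"
      have "((\<lambda>s. p + s *\<^sub>R (q - p)) has_derivative (\<lambda>h. h *\<^sub>R (q - p))) (at s within {0..1})"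
        by (auto intro!: derivative_eq_intros)
      from has_derivative_compose[OF this f'[OF seg[OF pq s]]]
      have "((\<lambda>s. f (p + s *\<^sub>R (q - p))) has_derivative (\<lambda>h. E (p + s *\<^sub>R (q - p)) (h *\<^sub>R (q - p)))) (at s within {0..1})"
        using E[OF seg[OF pq s]] by simp
      then show "((\<lambda>s. f (p + s *\<^sub>R (q - p))) has_vector_derivative E (p + s *\<^sub>R (q - p)) (q - p)) (at s within {0..1})"
        by (simp add: has_vector_derivative_def blinfun.scaleR_right)
    qed simp
    from integral_unique[OF this] show "f q - f p = H (p, q) (q - p)"
      unfolding H_def prod.case
      by (simp add: blinfun_apply_integral[OF integrable_continuous_real[OF conts[OF pq]]])
  next
    fix p v assume "p \<in> S"
    then show "H (p, p) v = fderiv f p v" by (simp add: H_def E)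
  qed
qed

text \<open>The function \<open>exp (- (2 * L * t)) * (d t \<bullet> d t)\<close> is nonnegative,
  vanishes at \<open>t0\<close>, and is nonincreasing by Cauchy-Schwarz and the bound on
  \<open>d'\<close>.\<close>

lemma gronwall_zero_right:
  fixes d :: "real \<Rightarrow> 'f::real_inner"
  assumes d: "\<And>t. t \<in> {t0..<b} \<Longrightarrow> (d has_vector_derivative d' t) (at t)"
    and le: "\<And>t. t \<in> {t0..<b} \<Longrightarrow> norm (d' t) \<le> L * norm (d t)"
    and d0: "d t0 = 0" and t: "t \<in> {t0..<b}"
  shows "d t = 0"
proof -
  define h where "h t = exp (- (2 * L * t)) * (d t \<bullet> d t)" for t
  have "h t \<le> h t0"
  proof (rule DERIV_nonpos_imp_nonincreasing[of t0 t h])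
    show "t0 \<le> t" using t by simp
    fix s assume s: "t0 \<le> s" "s \<le> t"
    then have s': "s \<in> {t0..<b}" using t by auto
    have "((\<lambda>s. d s \<bullet> d s) has_real_derivative 2 * (d s \<bullet> d' s)) (at s)"
      using bounded_bilinear.has_vector_derivative[OF bounded_bilinear_inner d[OF s'] d[OF s']]
      by (simp add: has_real_derivative_iff_has_vector_derivative inner_commute)
    then have "(h has_real_derivative (- (2 * L) * exp (- (2 * L * s)) * (d s \<bullet> d s)
        + exp (- (2 * L * s)) * (2 * (d s \<bullet> d' s)))) (at s)"
      unfolding h_def by (auto intro!: derivative_eq_intros)
    moreover have "- (2 * L) * exp (- (2 * L * s)) * (d s \<bullet> d s) + exp (- (2 * L * s)) * (2 * (d s \<bullet> d' s))
      = exp (- (2 * L * s)) * (2 * ((d s \<bullet> d' s) - L * (d s \<bullet> d s)))"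
      by (simp add: algebra_simps)
    moreover have "d s \<bullet> d' s \<le> L * (d s \<bullet> d s)"
    proof -
      have "d s \<bullet> d' s \<le> norm (d s) * norm (d' s)" by (rule norm_cauchy_schwarz)
      also have "\<dots> \<le> norm (d s) * (L * norm (d s))" using le[OF s'] by (intro mult_left_mono) auto
      finally show ?thesis by (simp add: power2_norm_eq_inner[symmetric] power2_eq_square mult_ac)
    qed
    ultimately show "\<exists>y. (h has_real_derivative y) (at s) \<and> y \<le> 0"
      by (smt (verit) exp_ge_zero mult_nonneg_nonpos)
  qed
  then have "d t \<bullet> d t \<le> 0" using d0 by (simp add: h_def mult_le_0_iff)
  then show ?thesis by (metis inner_eq_zero_iff inner_ge_zero order_antisym)
qed

text \<open>Times before \<open>t0\<close> are covered by reversing time, which preserves the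
  bound.\<close>

lemma gronwall_zero:
  fixes d :: "real \<Rightarrow> 'f::real_inner"
  assumes d: "\<And>t. t \<in> {a<..<b} \<Longrightarrow> (d has_vector_derivative d' t) (at t)"
    and le: "\<And>t. t \<in> {a<..<b} \<Longrightarrow> norm (d' t) \<le> L * norm (d t)"
    and t0: "t0 \<in> {a<..<b}" "d t0 = 0" and t: "t \<in> {a<..<b}"
  shows "d t = 0"
proof (cases "t0 \<le> t")
  case True
  then show ?thesis using gronwall_zero_right[of t0 b d d' L t] assms by auto
next
  case False
  have "((\<lambda>s. d (- s)) has_vector_derivative - d' (- s)) (at s)" if "s \<in> {-t0..<-a}" for s
  proof -
    have "(d has_vector_derivative d' (- s)) (at (- s))" using that t0 by (intro d) auto
    moreover have "(uminus has_vector_derivative (-1::real)) (at s)"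
      by (auto intro!: derivative_eq_intros simp: has_real_derivative_iff_has_vector_derivative[symmetric])
    ultimately show ?thesis using vector_diff_chain_at[of uminus "-1" s d "d' (- s)"] by (simp add: o_def)
  qed
  then have "d (- (- t)) = 0"
    using False assms by (intro gronwall_zero_right[of "-t0" "-a" "\<lambda>s. d (- s)" "\<lambda>s. - d' (- s)" L "-t"]) auto
  then show ?thesis by simp
qed

text \<open>The initial value is affine in the parameter so that this class of problems is stable
  under differentiation in \<open>y\<close>: the derivative in direction \<open>v\<close> starts at
  the constant \<open>L v\<close>, the case of linear part 0. Convexity of \<open>B\<close> and
  \<open>S\<close> serves the mean value operator of \<open>G\<close>.\<close>

locale param_ode =
  fixes \<epsilon> :: real and B :: "'y::euclidean_space set" and S :: "'e::euclidean_space set"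
    and G :: "real \<times> 'y \<times> 'e \<Rightarrow> 'e" and \<psi> :: "real \<times> 'y \<Rightarrow> 'e" and L :: "'y \<Rightarrow>\<^sub>L 'e" and c :: 'e
  assumes \<epsilon>: "\<epsilon> > 0" and B: "open B" "convex B" and S: "open S" "convex S"
    and cont: "continuous_on ({-\<epsilon><..<\<epsilon>} \<times> B) \<psi>"
    and inS: "\<And>t y. t \<in> {-\<epsilon><..<\<epsilon>} \<Longrightarrow> y \<in> B \<Longrightarrow> \<psi> (t, y) \<in> S"
    and ode: "\<And>t y. t \<in> {-\<epsilon><..<\<epsilon>} \<Longrightarrow> y \<in> B \<Longrightarrow>
      ((\<lambda>t. \<psi> (t, y)) has_vector_derivative G (t, y, \<psi> (t, y))) (at t)"
    and init: "\<And>y. y \<in> B \<Longrightarrow> \<psi> (0, y) = L y + c"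
begin

text \<open>By the mean value theorem the difference \<open>\<psi> (t, y + k) - \<psi> (t, y)\<close> solves a linear equation whose
  coefficients depend continuously on \<open>(t, y, k)\<close>, up to and including \<open>k = 0\<close>. Hence it equals \<open>V (t, y, k) k\<close>
  for the continuous operator-valued solution \<open>V\<close>, and \<open>V (t, y, 0)\<close> is the derivative.\<close>

lemma local_derivative:
  assumes G: "Ck_on (Suc 0) ({-\<epsilon><..<\<epsilon>} \<times> B \<times> S) G" and y0: "y0 \<in> B" and T: "0 < T" "T < \<epsilon>"
  obtains \<rho> and U :: "real \<times> 'y \<Rightarrow> 'y \<Rightarrow>\<^sub>L 'e" where "\<rho> > 0" "ball y0 \<rho> \<subseteq> B"
    "continuous_on ({-T<..<T} \<times> ball y0 \<rho>) U"
    "\<And>t y. t \<in> {-T<..<T} \<Longrightarrow> y \<in> ball y0 \<rho> \<Longrightarrow>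
      (\<psi> has_derivative (\<lambda>(\<tau>, v). \<tau> *\<^sub>R G (t, y, \<psi> (t, y)) + U (t, y) v)) (at (t, y))"
    "\<And>y. U (0, y) = L"
    "\<And>t y v. t \<in> {-T<..<T} \<Longrightarrow> y \<in> ball y0 \<rho> \<Longrightarrow> ((\<lambda>t. U (t, y) v) has_vector_derivative
        fderiv G (t, y, \<psi> (t, y)) (0, v, U (t, y) v)) (at t)"
proof -
  define \<Omega> where "\<Omega> = {-\<epsilon><..<\<epsilon>} \<times> B \<times> S"
  have \<Omega>: "open \<Omega>" "convex \<Omega>" unfolding \<Omega>_def using B S by (auto intro!: open_Times convex_Times)
  obtain H where contH: "continuous_on (\<Omega> \<times> \<Omega>) H"
    and H: "\<And>p q. p \<in> \<Omega> \<Longrightarrow> q \<in> \<Omega> \<Longrightarrow> G q - G p = blinfun_apply (H (p, q)) (q - p)"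
    and H': "\<And>p v. p \<in> \<Omega> \<Longrightarrow> H (p, p) v = fderiv G p v"
    using C1_mean_value_operator[OF G[folded \<Omega>_def] \<Omega>] by blast
  obtain \<rho>' where \<rho>': "\<rho>' > 0" "cball y0 \<rho>' \<subseteq> B"
    using open_contains_cball_eq[OF B(1)] y0 by blast
  define \<rho> where "\<rho> = \<rho>' / 2"
  have \<rho>: "\<rho> > 0" using \<rho>' by (simp add: \<rho>_def)
  have yB: "y \<in> B" if "y \<in> cball y0 \<rho>" for y using that \<rho>' by (auto simp: \<rho>_def)
  have ykB: "y + k \<in> B" if "y \<in> cball y0 \<rho>" "k \<in> cball 0 \<rho>" for y k
  proof -
    have "dist y0 (y + k) \<le> \<rho>'"
      using that norm_triangle_ineq4[of "y0 - y" k] by (simp add: \<rho>_def dist_norm algebra_simps)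
    then show ?thesis using \<rho>'(2) by auto
  qed
  define K where "K = {-T..T} \<times> cball y0 \<rho> \<times> cball (0::'y) \<rho>"
  have K: "compact K" "convex K" "K \<noteq> {}"
    unfolding K_def using \<rho> T by (auto intro!: compact_Times convex_Times)
  define P where "P t y = (t, y, \<psi> (t, y))" for t y
  have P: "P t y \<in> \<Omega>" if "t \<in> {-T..T}" "y \<in> B" for t y
    using that T inS by (auto simp: P_def \<Omega>_def)
  define a where "a = (\<lambda>(t, y, k). H (P t y, P t (y + k)))"
  have conta: "continuous_on K a"
    unfolding a_def case_prod_beta' P_def
    by (intro continuous_on_compose2[OF contH] continuous_on_compose2[OF cont] continuous_intros)
       (use T yB ykB inS in \<open>auto simp: K_def \<Omega>_def\<close>)
  \<comment> \<open>\<open>picard_solution\<close> asks for coefficients that are defined and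
    bounded everywhere; composing with the nearest-point projection onto the compact convex set
    \<open>K\<close> provides them without changing anything on \<open>K\<close>.\<close>
  define a' where "a' x = a (closest_point K x)" for x
  have a'_a: "a' x = a x" if "x \<in> K" for x using that by (simp add: a'_def closest_point_self)
  have clK: "closest_point K x \<in> K" for x
    using K by (intro closest_point_in_set) (auto simp: compact_imp_closed)
  have conta': "continuous_on UNIV a'"
    unfolding a'_def using K clK
    by (intro continuous_on_compose2[OF conta] continuous_on_closest_point) (auto simp: compact_imp_closed)
  obtain M where M: "M > 0" "\<And>x. norm (a' x) \<le> M"
  proof -
    have "bounded (a ` K)" by (intro compact_imp_bounded compact_continuous_image conta K)
    then obtain M where "M > 0" "\<forall>x\<in>a ` K. norm x \<le> M" by (auto simp: bounded_pos)
    then show ?thesis using clK by (intro that[of M]) (auto simp: a'_def)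
  qed
  have bl3: "bounded_linear (\<lambda>z::'e. (0::real, 0::'y, z))" and bl2: "bounded_linear (\<lambda>v::'y. (0::real, v, 0::'e))"
    by (auto intro!: bounded_linear_Pair bounded_linear_ident bounded_linear_zero)
  define J3 where "J3 = Blinfun (\<lambda>z::'e. (0::real, 0::'y, z))"
  define J2 where "J2 = Blinfun (\<lambda>v::'y. (0::real, v, 0::'e))"
  have J3: "J3 z = (0, 0, z)" for z unfolding J3_def by (simp add: bounded_linear_Blinfun_apply[OF bl3])
  have J2: "J2 v = (0, v, 0)" for v unfolding J2_def by (simp add: bounded_linear_Blinfun_apply[OF bl2])
  \<comment> \<open>Right-hand side of the variational equation for an operator \<open>V\<close>,
    with the partial derivatives of \<open>G\<close> averaged between the two solutions;
    \<open>J3\<close> and \<open>J2\<close> insert a vector into the third and the second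
    slot.\<close>
  define g where "g t p V = ((a' (t, p) o\<^sub>L J3) o\<^sub>L V) + (a' (t, p) o\<^sub>L J2)"
    for t and p :: "'y \<times> 'y" and V :: "'y \<Rightarrow>\<^sub>L 'e"
  have contg: "continuous_on UNIV (\<lambda>(t, p, V). g t p V)"
    unfolding g_def case_prod_beta'
    by (intro continuous_intros continuous_on_compose2[OF conta'] bounded_bilinear.continuous_on[OF bounded_bilinear_blinfun_compose]) auto
  have aJ: "norm (a' x o\<^sub>L J) \<le> M * norm J" for x and J :: "'b::real_normed_vector \<Rightarrow>\<^sub>L (real \<times> 'y \<times> 'e)"
    using norm_blinfun_compose[of "a' x" J] M(2)[of x] by (meson mult_right_mono norm_ge_zero order_trans)
  have lipg: "norm (g t p V - g t p V') \<le> (M * norm J3 + 1) * norm (V - V')" for t p V V'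
  proof -
    have "g t p V - g t p V' = (a' (t, p) o\<^sub>L J3) o\<^sub>L (V - V')"
      unfolding g_def by (simp add: bounded_bilinear.diff_right[OF bounded_bilinear_blinfun_compose])
    then have "norm (g t p V - g t p V') \<le> norm (a' (t, p) o\<^sub>L J3) * norm (V - V')"
      using norm_blinfun_compose by metis
    also have "\<dots> \<le> (M * norm J3 + 1) * norm (V - V')"
      using aJ[of "(t, p)" J3] by (intro mult_right_mono) auto
    finally show ?thesis .
  qed
  have bndg: "norm (g t p 0) \<le> M * norm J2 + norm L" for t p
  proof -
    have "g t p 0 = a' (t, p) o\<^sub>L J2"
      by (simp add: g_def bounded_bilinear.zero_right[OF bounded_bilinear_blinfun_compose])
    then have "norm (g t p 0) \<le> M * norm J2" using aJ[of "(t, p)" J2] by simp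
    then show ?thesis using norm_ge_zero[of L] by linarith
  qed
  have M3: "M * norm J3 + 1 > 0" using M(1) by (simp add: add_nonneg_pos)
  obtain V where contV: "continuous_on ({-T..T} \<times> UNIV) V" and V0: "\<And>p. V (0, p) = L"
    and V': "\<And>t p. t \<in> {-T<..<T} \<Longrightarrow> ((\<lambda>t. V (t, p)) has_vector_derivative g t p (V (t, p))) (at t)"
    by (rule picard_solution[OF contg lipg bndg, of "\<lambda>_. L" T]) (use M T M3 in auto)
  have Vv': "((\<lambda>t. V (t, p) v) has_vector_derivative (a' (t, p)) (0, v, V (t, p) v)) (at t)"
    if "t \<in> {-T<..<T}" for t p v
  proof -
    have "((\<lambda>t. V (t, p) v) has_vector_derivative g t p (V (t, p)) v) (at t)"
      by (rule bounded_linear.has_vector_derivative[OF blinfun.bounded_linear_left V'[OF that]])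
    moreover have "g t p (V (t, p)) v = a' (t, p) (0, v, V (t, p) v)"
      by (simp add: g_def blinfun.add_left J3 J2 blinfun.add_right[symmetric])
    ultimately show ?thesis by simp
  qed
  \<comment> \<open>Both sides start at \<open>L k\<close>, and their difference \<open>d\<close>
    solves a homogeneous linear equation, so it vanishes by Gronwall.\<close>
  have incr: "\<psi> (t, y + k) - \<psi> (t, y) = V (t, y, k) k"
    if t: "t \<in> {-T<..<T}" and y: "y \<in> ball y0 \<rho>" and k: "k \<in> ball 0 \<rho>" for t y k
  proof -
    have y': "y \<in> cball y0 \<rho>" and k': "k \<in> cball 0 \<rho>" using y k by auto
    define d where "d t = (\<psi> (t, y + k) - \<psi> (t, y)) - V (t, y, k) k" for t
    have "d t = 0"
    proof (rule gronwall_zero[of "-T" T d _ M 0])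
      fix t assume t: "t \<in> {-T<..<T}"
      then have tI: "t \<in> {-\<epsilon><..<\<epsilon>}" "t \<in> {-T..T}" using T by auto
      show "(d has_vector_derivative a' (t, y, k) (0, 0, d t)) (at t)"
      proof -
        have "(d has_vector_derivative (G (P t (y + k)) - G (P t y)) - a' (t, y, k) (0, k, V (t, y, k) k)) (at t)"
          unfolding d_def P_def
          by (intro has_vector_derivative_diff ode Vv' t tI yB ykB y' k')
        moreover have "G (P t (y + k)) - G (P t y) = a' (t, y, k) (0, k, \<psi> (t, y + k) - \<psi> (t, y))"
          using H[OF P[OF tI(2) yB[OF y']] P[OF tI(2) ykB[OF y' k']]] y' k' tI
          by (subst a'_a) (auto simp: K_def a_def P_def)
        ultimately show ?thesis by (simp add: d_def blinfun.diff_right[symmetric])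
      qed
      have "norm (a' (t, y, k) (0, 0, d t)) \<le> norm (a' (t, y, k)) * norm (0::real, 0::'y, d t)"
        by (rule norm_blinfun)
      also have "\<dots> \<le> M * norm (d t)" using M(2)[of "(t, y, k)"] by (simp add: norm_Pair mult_right_mono)
      finally show "norm (a' (t, y, k) (0, 0, d t)) \<le> M * norm (d t)" .
    next
      show "d 0 = 0" using init[OF yB[OF y']] init[OF ykB[OF y' k']] by (simp add: d_def V0 blinfun.add_right)
    qed (use t T in auto)
    then show ?thesis by (simp add: d_def)
  qed
  define U where "U = (\<lambda>(t, y). V (t, y, 0))"
  have contU: "continuous_on ({-T<..<T} \<times> ball y0 \<rho>) U"
    unfolding U_def case_prod_beta'
    by (intro continuous_on_compose2[OF contV] continuous_intros) auto
  \<comment> \<open>The remainder is \<open>V (t, y, k) - V (t, y, 0)\<close> applied to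
    \<open>k\<close>, so differentiability is continuity of \<open>V\<close> at
    \<open>k = 0\<close>.\<close>
  have part: "((\<lambda>y. \<psi> (t, y)) has_derivative blinfun_apply (U (t, y))) (at y)"
    if t: "t \<in> {-T<..<T}" and y: "y \<in> ball y0 \<rho>" for t y
    unfolding has_derivative_at
  proof
    have "continuous_on UNIV (\<lambda>k. V (t, y, k))"
      using t by (intro continuous_on_compose2[OF contV] continuous_intros) auto
    then have "(\<lambda>k. V (t, y, k)) \<midarrow>0\<rightarrow> V (t, y, 0)" by (simp add: continuous_on_def)
    then have lim: "(\<lambda>k. norm (V (t, y, k) - V (t, y, 0))) \<midarrow>0\<rightarrow> 0"
      by (simp add: LIM_zero tendsto_norm_zero)
    show "(\<lambda>k. norm (\<psi> (t, y + k) - \<psi> (t, y) - U (t, y) k) / norm k) \<midarrow>0\<rightarrow> 0"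
    proof (rule Lim_null_comparison[OF _ lim])
      have "\<forall>\<^sub>F k in at 0. k \<in> ball (0::'y) \<rho>" using \<rho> by (intro eventually_at_in_open') auto
      then show "\<forall>\<^sub>F k in at 0. norm (norm (\<psi> (t, y + k) - \<psi> (t, y) - U (t, y) k) / norm k)
          \<le> norm (V (t, y, k) - V (t, y, 0))"
      proof eventually_elim
        case (elim k)
        have "norm (\<psi> (t, y + k) - \<psi> (t, y) - U (t, y) k) \<le> norm (V (t, y, k) - V (t, y, 0)) * norm k"
          using norm_blinfun[of "V (t, y, k) - V (t, y, 0)" k] incr[OF t y elim]
          by (simp add: U_def blinfun.diff_left)
        then show ?case by (cases "k = 0") (auto simp: divide_le_eq)
      qed
    qed
  qed (rule blinfun.bounded_linear_right)
  show ?thesis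
  proof (rule that[of \<rho> U])
    show "ball y0 \<rho> \<subseteq> B" using yB by auto
    fix t y assume t: "t \<in> {-T<..<T}" and y: "y \<in> ball y0 \<rho>"
    have tI: "t \<in> {-\<epsilon><..<\<epsilon>}" "t \<in> {-T..T}" using t T by auto
    have yB': "y \<in> B" using y yB by auto
    \<comment> \<open>Total differentiability from partial derivatives, of which the one in
      \<open>y\<close> is jointly continuous.\<close>
    have "((\<lambda>(t, y). \<psi> (t, y)) has_derivative (\<lambda>(\<tau>, v). \<tau> *\<^sub>R G (t, y, \<psi> (t, y)) + (\<lambda>t y. U (t, y)) t y v))
        (at (t, y) within {-T<..<T} \<times> ball y0 \<rho>)"
    proof (rule has_derivative_partialsI)
      show "((\<lambda>t. \<psi> (t, y)) has_derivative (\<lambda>\<tau>. \<tau> *\<^sub>R G (t, y, \<psi> (t, y)))) (at t within {-T<..<T})"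
        using ode[OF tI(1) yB'] by (auto simp: has_vector_derivative_def intro: has_derivative_at_withinI)
      show "((\<lambda>y. \<psi> (x, y)) has_derivative blinfun_apply (U (x, z))) (at z within ball y0 \<rho>)"
        if "x \<in> {-T<..<T}" "z \<in> ball y0 \<rho>" for x z
        using part[OF that] by (rule has_derivative_at_withinI)
      show "continuous (at (t, y) within {-T<..<T} \<times> ball y0 \<rho>) (\<lambda>(x, y). U (x, y))"
        using contU t y by (simp add: continuous_on_eq_continuous_within case_prod_beta')
    qed (use y in auto)
    moreover have "at (t, y) within {-T<..<T} \<times> ball y0 \<rho> = at (t, y)"
      using t y by (intro at_within_open) (auto intro!: open_Times)
    ultimately show "(\<psi> has_derivative (\<lambda>(\<tau>, v). \<tau> *\<^sub>R G (t, y, \<psi> (t, y)) + U (t, y) v)) (at (t, y))"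
      by simp
    fix v
    have "(t, y, 0) \<in> K" using t y \<rho> by (auto simp: K_def)
    then have "a' (t, y, 0) (0, v, V (t, y, 0) v) = fderiv G (t, y, \<psi> (t, y)) (0, v, V (t, y, 0) v)"
      using H'[OF P[OF tI(2) yB']] by (simp add: a'_a a_def P_def)
    then show "((\<lambda>t. U (t, y) v) has_vector_derivative
        fderiv G (t, y, \<psi> (t, y)) (0, v, U (t, y) v)) (at t)"
      using Vv'[OF t, of "(y, 0)" v] by (simp add: U_def)
  qed (use \<rho> contU V0 in \<open>auto simp: U_def\<close>)
qed

text \<open>The operators \<open>U\<close> of \<open>local_derivative\<close> depend on the chosen
  \<open>T\<close> and radius. Expressed as Frechet derivatives in the directions
  \<open>(0, v)\<close> they become one function on the whole domain, as the induction on the order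
  of differentiability requires.\<close>

lemma partial_derivative:
  assumes G: "Ck_on (Suc 0) ({-\<epsilon><..<\<epsilon>} \<times> B \<times> S) G"
  defines "u \<equiv> \<lambda>v x. fderiv \<psi> x (0, v)"
  shows "x \<in> {-\<epsilon><..<\<epsilon>} \<times> B \<Longrightarrow>
      (\<psi> has_derivative (\<lambda>h. fst h *\<^sub>R G (fst x, snd x, \<psi> x) + u (snd h) x)) (at x)"
    and "continuous_on ({-\<epsilon><..<\<epsilon>} \<times> B) (u v)"
    and "y \<in> B \<Longrightarrow> u v (0, y) = L v"
    and "t \<in> {-\<epsilon><..<\<epsilon>} \<Longrightarrow> y \<in> B \<Longrightarrow> ((\<lambda>t. u v (t, y)) has_vector_derivative
        fderiv G (t, y, \<psi> (t, y)) (0, v, u v (t, y))) (at t)"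
proof -
  have loc: "\<exists>N T U. open N \<and> (t, y) \<in> N \<and> t \<in> {-T<..<T} \<and> {-T<..<T} \<times> {y} \<subseteq> N \<and> continuous_on N U \<and>
      (\<forall>x\<in>N. \<forall>v. u v x = blinfun_apply (U x) v) \<and> U (0, y) = L \<and>
      (\<psi> has_derivative (\<lambda>(\<tau>, v). \<tau> *\<^sub>R G (t, y, \<psi> (t, y)) + U (t, y) v)) (at (t, y)) \<and>
      (\<forall>v. ((\<lambda>t. U (t, y) v) has_vector_derivative
        fderiv G (t, y, \<psi> (t, y)) (0, v, U (t, y) v)) (at t))"
    if tI: "t \<in> {-\<epsilon><..<\<epsilon>}" and yB: "y \<in> B" for t y
  proof -
    have "\<bar>t\<bar> < \<epsilon>" using tI by auto
    then obtain T where T: "\<bar>t\<bar> < T" "T < \<epsilon>" using dense by blast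
    have T0: "0 < T" and t: "t \<in> {-T<..<T}" using T by (auto simp: abs_less_iff)
    obtain \<rho> and U :: "real \<times> 'y \<Rightarrow> 'y \<Rightarrow>\<^sub>L 'e" where U: "\<rho> > 0" "continuous_on ({-T<..<T} \<times> ball y \<rho>) U"
      "\<And>t z. t \<in> {-T<..<T} \<Longrightarrow> z \<in> ball y \<rho> \<Longrightarrow>
        (\<psi> has_derivative (\<lambda>(\<tau>, v). \<tau> *\<^sub>R G (t, z, \<psi> (t, z)) + U (t, z) v)) (at (t, z))"
      "\<And>z. U (0, z) = L"
      "\<And>t z v. t \<in> {-T<..<T} \<Longrightarrow> z \<in> ball y \<rho> \<Longrightarrow> ((\<lambda>t. U (t, z) v) has_vector_derivative
        fderiv G (t, z, \<psi> (t, z)) (0, v, U (t, z) v)) (at t)"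
      by (rule local_derivative[OF G yB T0 T(2)]) blast+
    have "u v x = U x v" if "x \<in> {-T<..<T} \<times> ball y \<rho>" for x v
      using that frechet_derivative_at[OF U(3), symmetric] by (auto simp: u_def)
    moreover have "open ({-T<..<T} \<times> ball y \<rho>)" by (intro open_Times) auto
    ultimately show ?thesis
      using U t by (intro exI[of _ "{-T<..<T} \<times> ball y \<rho>"] exI[of _ T] exI[of _ U]) auto
  qed
  show "(\<psi> has_derivative (\<lambda>h. fst h *\<^sub>R G (fst x, snd x, \<psi> x) + u (snd h) x)) (at x)"
    if xIB: "x \<in> {-\<epsilon><..<\<epsilon>} \<times> B"
  proof -
    obtain t y where x: "x = (t, y)" "t \<in> {-\<epsilon><..<\<epsilon>}" "y \<in> B" using xIB by blast
    from loc[OF x(2,3)] show ?thesis unfolding x(1) by (auto simp: case_prod_beta')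
  qed
  show "continuous_on ({-\<epsilon><..<\<epsilon>} \<times> B) (u v)"
    unfolding Ck_on.simps(1)[symmetric]
  proof (rule Ck_on_local)
    fix x assume "x \<in> {-\<epsilon><..<\<epsilon>} \<times> B"
    then obtain t y where x: "x = (t, y)" "t \<in> {-\<epsilon><..<\<epsilon>}" "y \<in> B" by blast
    from loc[OF x(2,3)] obtain N and U :: "real \<times> 'y \<Rightarrow> 'y \<Rightarrow>\<^sub>L 'e" where N: "open N" "x \<in> N" "continuous_on N U"
      "\<forall>x\<in>N. \<forall>v. u v x = blinfun_apply (U x) v" unfolding x(1) by blast
    have "continuous_on N (\<lambda>x. U x v)"
      by (rule bounded_linear.continuous_on[OF blinfun.bounded_linear_left N(3)])
    with N show "\<exists>T. open T \<and> x \<in> T \<and> Ck_on 0 T (u v)"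
      by (intro exI[of _ N]) (simp cong: continuous_on_cong)
  qed
  show "u v (0, y) = L v" if "y \<in> B"
    using loc[of 0 y] that \<epsilon> by fastforce
  assume ty: "t \<in> {-\<epsilon><..<\<epsilon>}" "y \<in> B"
  from loc[OF this] obtain T and U :: "real \<times> 'y \<Rightarrow> 'y \<Rightarrow>\<^sub>L 'e" where t: "t \<in> {-T<..<T}"
    and U: "\<And>s v. s \<in> {-T<..<T} \<Longrightarrow> u v (s, y) = U (s, y) v"
      "\<And>v. ((\<lambda>t. U (t, y) v) has_vector_derivative fderiv G (t, y, \<psi> (t, y)) (0, v, U (t, y) v)) (at t)"
    by (elim exE conjE) blast
  have "((\<lambda>t. U (t, y) v) has_vector_derivative fderiv G (t, y, \<psi> (t, y)) (0, v, u v (t, y))) (at t)"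
    unfolding U(1)[OF t] by (rule U(2))
  then show "((\<lambda>t. u v (t, y)) has_vector_derivative fderiv G (t, y, \<psi> (t, y)) (0, v, u v (t, y))) (at t)"
    by (rule has_vector_derivative_transform_within_open[of _ _ _ "{-T<..<T}"]) (use t U(1) in auto)
qed

end

text \<open>The derivative of \<open>\<psi>\<close> in a parameter direction solves an equation of the same kind, whose right-hand side
  has one derivative less; this drives the induction on the order of differentiability.\<close>

lemma ode_param_Ck_on:
  assumes "param_ode \<epsilon> B S G \<psi> L c" and "Ck_on k ({-\<epsilon><..<\<epsilon>} \<times> B \<times> S) G"
  shows "Ck_on k ({-\<epsilon><..<\<epsilon>} \<times> B) \<psi>"
  using assms
proof (induction k arbitrary: G S \<psi> L c)
  case 0
  then show ?case by (simp add: param_ode.cont)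
next
  case (Suc k)
  interpret param_ode \<epsilon> B S G \<psi> L c by (rule Suc.prems(1))
  define I where "I = {-\<epsilon><..<\<epsilon>}"
  define u where "u v = (\<lambda>x. fderiv \<psi> x (0, v))" for v
  define g where "g v = (\<lambda>x. fderiv G (fst x, fst (snd x), \<psi> (fst x, fst (snd x))) (0, v, snd (snd x)))" for v
  have openIB: "open (I \<times> B)" "open (I \<times> B \<times> (UNIV::'b set))"
    unfolding I_def using B by (auto intro!: open_Times)
  have Gk: "Ck_on k ({-\<epsilon><..<\<epsilon>} \<times> B \<times> S) G" by (rule Ck_on_SucD[OF Suc.prems(2)])
  \<comment> \<open>The equation for \<open>u v\<close> contains \<open>\<psi>\<close> in its
    coefficients, so order \<open>k\<close> of \<open>\<psi>\<close> itself has to be available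
    first.\<close>
  have \<psi>k: "Ck_on k (I \<times> B) \<psi>" unfolding I_def by (rule Suc.IH[OF Suc.prems(1) Gk])
  have G1: "Ck_on (Suc 0) ({-\<epsilon><..<\<epsilon>} \<times> B \<times> S) G" using Suc.prems(2) by (rule Ck_on_le) simp
  \<comment> \<open>A derivative may be any vector, hence the state space \<open>UNIV\<close>; its
    initial value \<open>L v\<close> no longer depends on the parameter.\<close>
  have "param_ode \<epsilon> B UNIV (g v) (u v) 0 (blinfun_apply L v)" for v
    unfolding u_def g_def
    by unfold_locales (use B \<epsilon> partial_derivative(2-4)[OF G1] in \<open>simp_all del: greaterThanLessThan_iff\<close>)
  moreover have "Ck_on k (I \<times> B \<times> UNIV) (g v)" for v
    unfolding g_def
  proof (rule Ck_on_frechet_derivative[OF openIB(2) Suc.prems(2)[folded I_def]])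
    have "Ck_on k (I \<times> B \<times> (UNIV::'b set)) (\<lambda>x. (fst x, fst (snd x)))"
      by (intro Ck_on_bounded_linear bounded_linear_intros)
    then show "Ck_on k (I \<times> B \<times> UNIV) (\<lambda>x::real \<times> 'a \<times> 'b. (fst x, fst (snd x), \<psi> (fst x, fst (snd x))))"
      by (intro Ck_on_Pair openIB Ck_on_compose[OF _ \<psi>k] Ck_on_bounded_linear bounded_linear_intros) auto
    show "Ck_on k (I \<times> B \<times> UNIV) (\<lambda>x::real \<times> 'a \<times> 'b. (0, v, snd (snd x)))"
      by (intro Ck_on_Pair openIB Ck_on_const Ck_on_bounded_linear bounded_linear_intros)
  qed (use inS in \<open>auto simp: I_def\<close>)
  ultimately have "Ck_on k (I \<times> B) (u v)" for v unfolding I_def by (rule Suc.IH)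
  moreover have "Ck_on k (I \<times> B) (\<lambda>x. G (fst x, snd x, \<psi> x))"
    using inS
    by (intro Ck_on_compose[OF openIB(1) Gk[folded I_def]] Ck_on_Pair openIB \<psi>k
        Ck_on_bounded_linear bounded_linear_intros) (auto simp: I_def)
  ultimately have "Ck_on k (I \<times> B) (\<lambda>x. fst h *\<^sub>R G (fst x, snd x, \<psi> x) + u (snd h) x)" for h
    by (intro Ck_on_add Ck_on_scaleR Ck_on_const openIB)
  then have "Ck_on (Suc k) (I \<times> B) \<psi>"
    unfolding I_def u_def by (intro Ck_on_SucI[OF _ partial_derivative(1)[OF G1]]) (use B in \<open>auto intro: open_Times\<close>)
  then show ?case by (simp add: I_def)
qed

section \<open>Local flows of smooth vector fields in Euclidean space\<close>

lemma smooth_on_locally_lipschitz: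
  fixes F :: "'a::euclidean_space \<Rightarrow> 'b::euclidean_space"
  assumes F: "smooth_on S F" and S: "open S" and x0: "x0 \<in> S"
  obtains r L where "r > 0" "L > 0" "cball x0 r \<subseteq> S"
    "\<And>a b. a \<in> cball x0 r \<Longrightarrow> b \<in> cball x0 r \<Longrightarrow> norm (F a - F b) \<le> L * norm (a - b)"
proof -
  obtain R where R: "R > 0" "ball x0 R \<subseteq> S" using open_contains_ball S x0 by blast
  define r where "r = R / 2"
  have r: "r > 0" "cball x0 r \<subseteq> ball x0 R" using R by (auto simp: r_def)
  obtain H where H: "continuous_on (ball x0 R \<times> ball x0 R) H"
    "\<And>p q. p \<in> ball x0 R \<Longrightarrow> q \<in> ball x0 R \<Longrightarrow> F q - F p = blinfun_apply (H (p, q)) (q - p)"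
    "\<And>p v. p \<in> ball x0 R \<Longrightarrow> H (p, p) v = fderiv F p v"
    by (rule C1_mean_value_operator[OF Ck_on_subset[OF smooth_onD[OF F] R(2)] open_ball convex_ball]) blast
  have "bounded (H ` (cball x0 r \<times> cball x0 r))"
    by (intro compact_imp_bounded compact_continuous_image continuous_on_subset[OF H(1)] compact_Times
        compact_cball Sigma_mono r)
  then obtain L where L: "L > 0" "\<And>x. x \<in> cball x0 r \<times> cball x0 r \<Longrightarrow> norm (H x) \<le> L"
    unfolding bounded_pos by blast
  show ?thesis
  proof (rule that[of r L])
    fix a b assume ab: "a \<in> cball x0 r" "b \<in> cball x0 r"
    have "norm (F a - F b) \<le> norm (H (b, a)) * norm (a - b)"
      using H(2)[of b a] ab r(2) norm_blinfun[of "H (b, a)" "a - b"] by (auto simp: subset_iff)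
    also have "\<dots> \<le> L * norm (a - b)" using L(2)[of "(b, a)"] ab by (intro mult_right_mono) auto
    finally show "norm (F a - F b) \<le> L * norm (a - b)" .
  qed (use r R L in auto)
qed

text \<open>The last conjunct is the variational equation for the derivative in the initial value.\<close>

definition local_flow_on ::
  "('e::euclidean_space \<Rightarrow> 'e) \<Rightarrow> 'e set \<Rightarrow> real \<Rightarrow> 'e set \<Rightarrow> (real \<times> 'e \<Rightarrow> 'e) \<Rightarrow> bool" where
  "local_flow_on F S \<epsilon> B \<psi> \<longleftrightarrow> \<epsilon> > 0 \<and> smooth_on ({-\<epsilon><..<\<epsilon>} \<times> B) \<psi> \<and> (\<forall>y\<in>B. \<psi> (0, y) = y) \<and>
     (\<forall>t\<in>{-\<epsilon><..<\<epsilon>}. \<forall>y\<in>B. \<psi> (t, y) \<in> S \<and>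
        ((\<lambda>t. \<psi> (t, y)) has_vector_derivative F (\<psi> (t, y))) (at t) \<and>
        (\<forall>v. ((\<lambda>t. fderiv \<psi> (t, y) (0, v)) has_vector_derivative
          fderiv F (\<psi> (t, y)) (fderiv \<psi> (t, y) (0, v))) (at t)))"

lemma local_flow_onD:
  assumes "local_flow_on F S \<epsilon> B \<psi>"
  shows "\<epsilon> > 0" "smooth_on ({-\<epsilon><..<\<epsilon>} \<times> B) \<psi>" "y \<in> B \<Longrightarrow> \<psi> (0, y) = y"
    and "t \<in> {-\<epsilon><..<\<epsilon>} \<Longrightarrow> y \<in> B \<Longrightarrow> \<psi> (t, y) \<in> S"
    and "t \<in> {-\<epsilon><..<\<epsilon>} \<Longrightarrow> y \<in> B \<Longrightarrow> ((\<lambda>t. \<psi> (t, y)) has_vector_derivative F (\<psi> (t, y))) (at t)"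
    and "t \<in> {-\<epsilon><..<\<epsilon>} \<Longrightarrow> y \<in> B \<Longrightarrow> ((\<lambda>t. fderiv \<psi> (t, y) (0, v)) has_vector_derivative
          fderiv F (\<psi> (t, y)) (fderiv \<psi> (t, y) (0, v))) (at t)"
  using assms by (simp_all add: local_flow_on_def)

lemma local_flow:
  fixes F :: "'e::euclidean_space \<Rightarrow> 'e"
  assumes F: "smooth_on S F" and S: "open S" and x0: "x0 \<in> S"
  obtains \<epsilon> r \<psi> where "r > 0" "local_flow_on F S \<epsilon> (ball x0 r) \<psi>"
proof -
  obtain R L where R: "R > 0" "L > 0" "cball x0 R \<subseteq> S"
    and lip: "\<And>a b. a \<in> cball x0 R \<Longrightarrow> b \<in> cball x0 R \<Longrightarrow> norm (F a - F b) \<le> L * norm (a - b)"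
    using smooth_on_locally_lipschitz[OF assms] by blast
  define r where "r = R / 2"
  have r: "r > 0" using R by (simp add: r_def)
  \<comment> \<open>The nearest-point projection has Lipschitz constant 1, so
    \<open>F \<circ> cl\<close> is bounded and Lipschitz on the whole space with the constant
    \<open>L\<close>, and it equals \<open>F\<close> on the ball.\<close>
  define cl where "cl = closest_point (cball x0 R)"
  have ne: "cball x0 R \<noteq> {}" using R by simp
  have cl_in: "cl z \<in> cball x0 R" for z unfolding cl_def by (rule closest_point_in_set[OF closed_cball ne])
  have cl_id: "cl z = z" if "z \<in> cball x0 R" for z unfolding cl_def by (rule closest_point_self[OF that])
  have cl_lip: "norm (cl z - cl z') \<le> norm (z - z')" for z z'
    unfolding cl_def using closest_point_lipschitz[OF convex_cball closed_cball ne, of z z'] by (simp add: dist_norm)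
  have cl_cont: "continuous_on A cl" for A
    unfolding cl_def by (rule continuous_on_closest_point[OF convex_cball closed_cball ne])
  define M where "M = norm (F x0) + L * R + 1"
  have M: "norm (F (cl z)) < M" for z
  proof -
    have "norm (F (cl z) - F x0) \<le> L * norm (cl z - x0)" using cl_in[of z] R by (intro lip) auto
    also have "\<dots> \<le> L * R" using cl_in[of z] R by (intro mult_left_mono) (auto simp: dist_norm norm_minus_commute)
    finally show ?thesis using norm_triangle_sub[of "F (cl z)" "F x0"] by (simp add: M_def)
  qed
  have M0: "M > 0" using M[of x0] norm_ge_zero le_less_trans by blast
  \<comment> \<open>At speed below \<open>M\<close>, a time below \<open>r / M\<close> moves a point
    by less than \<open>r = R / 2\<close>; solutions starting in \<open>ball x0 r\<close> thus
    remain where \<open>cl\<close> is the identity, and the cut-off is invisible.\<close>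
  define \<epsilon> where "\<epsilon> = r / M"
  have \<epsilon>: "\<epsilon> > 0" using r M0 by (simp add: \<epsilon>_def)
  obtain \<psi> where cont\<psi>: "continuous_on ({-\<epsilon>..\<epsilon>} \<times> UNIV) \<psi>" and \<psi>0: "\<And>y. \<psi> (0, y) = cl y"
    and \<psi>': "\<And>t y. t \<in> {-\<epsilon><..<\<epsilon>} \<Longrightarrow> ((\<lambda>t. \<psi> (t, y)) has_vector_derivative F (cl (\<psi> (t, y)))) (at t)"
  proof (rule picard_solution[of "\<lambda>t (p::'e) z. F (cl z)" L "M + norm x0 + R" cl \<epsilon>])
    show "continuous_on UNIV (\<lambda>(t, p, z). F (cl z))"
      unfolding case_prod_beta'
      by (intro continuous_on_compose2[OF smooth_on_continuous_on[OF F]] continuous_on_compose2[OF cl_cont] continuous_intros)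
         (use cl_in R in auto)
    show "norm (F (cl z) - F (cl z')) \<le> L * norm (z - z')" for z z'
      using lip[OF cl_in cl_in, of z z'] cl_lip[of z z'] R by (meson less_imp_le mult_left_mono order_trans)
    show "norm (F (cl 0)) \<le> M + norm x0 + R" using M[of 0] R norm_ge_zero[of x0] by linarith
    show "norm (cl p) \<le> M + norm x0 + R" for p
      using cl_in[of p] norm_triangle_sub[of "cl p" x0] M0 by (simp add: dist_norm norm_minus_commute)
  qed (use cl_cont \<epsilon> R in auto)
  have near: "\<psi> (t, y) \<in> ball x0 R" if t: "t \<in> {-\<epsilon><..<\<epsilon>}" and y: "y \<in> ball x0 r" for t y
  proof -
    have y': "y \<in> cball x0 R" using y R by (auto simp: r_def)
    have "norm (\<psi> (t, y) - \<psi> (0, y)) \<le> M * norm (t - 0)"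
    proof (rule differentiable_bound[of "{-\<epsilon><..<\<epsilon>}"])
      fix s assume s: "s \<in> {-\<epsilon><..<\<epsilon>}"
      show "((\<lambda>t. \<psi> (t, y)) has_derivative (\<lambda>h. h *\<^sub>R F (cl (\<psi> (s, y))))) (at s within {-\<epsilon><..<\<epsilon>})"
        using \<psi>'[OF s] by (auto simp: has_vector_derivative_def intro: has_derivative_at_withinI)
      show "onorm (\<lambda>h. h *\<^sub>R F (cl (\<psi> (s, y)))) \<le> M"
        using M[of "\<psi> (s, y)"] by (intro onorm_le) (auto simp: mult.commute[of M] intro!: mult_left_mono)
    qed (use t \<epsilon> in auto)
    also have "\<dots> < r"
    proof -
      have "\<bar>t\<bar> < r / M" using t unfolding \<epsilon>_def by auto
      then show ?thesis using M0 by (simp add: field_simps)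
    qed
    finally have "dist y (\<psi> (t, y)) < r" using cl_id[OF y'] by (simp add: \<psi>0 dist_norm norm_minus_commute)
    then show ?thesis using y dist_triangle_less_add[of x0 y r "\<psi> (t, y)" r] by (simp add: r_def dist_commute)
  qed
  have flow_ode: "((\<lambda>t. \<psi> (t, y)) has_vector_derivative F (\<psi> (t, y))) (at t)"
    if "t \<in> {-\<epsilon><..<\<epsilon>}" "y \<in> ball x0 r" for t y
    using \<psi>'[OF that(1), of y] cl_id[of "\<psi> (t, y)"] near[OF that] by simp
  have init: "\<psi> (0, y) = blinfun_apply id_blinfun y + 0" if "y \<in> ball x0 r" for y
    using that R \<psi>0[of y] cl_id[of y] by (simp add: r_def)
  define G where "G = (\<lambda>(t::real, y::'e, z). F z)"
  have smF: "smooth_on (ball x0 R) F" using R(3) by (intro smooth_on_subset[OF F]) auto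
  have op: "open ({-\<epsilon><..<\<epsilon>} \<times> ball x0 r \<times> ball x0 R)" by (intro open_Times) auto
  have CkG: "Ck_on k ({-\<epsilon><..<\<epsilon>} \<times> ball x0 r \<times> ball x0 R) G" for k
    unfolding G_def case_prod_beta'
    by (intro Ck_on_compose[OF op smooth_onD[OF smF]] Ck_on_bounded_linear bounded_linear_intros) auto
  interpret param_ode \<epsilon> "ball x0 r" "ball x0 R" G \<psi> id_blinfun 0
  proof
    show "continuous_on ({-\<epsilon><..<\<epsilon>} \<times> ball x0 r) \<psi>" by (rule continuous_on_subset[OF cont\<psi>]) auto
  qed (use near flow_ode init \<epsilon> in \<open>auto simp: G_def simp del: mem_ball\<close>)
  have "smooth_on ({-\<epsilon><..<\<epsilon>} \<times> ball x0 r) \<psi>"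
    unfolding smooth_on_def by (intro allI ode_param_Ck_on[OF param_ode_axioms CkG])
  moreover have "((\<lambda>t. fderiv \<psi> (t, y) (0, v)) has_vector_derivative
      fderiv F (\<psi> (t, y)) (fderiv \<psi> (t, y) (0, v))) (at t)"
    if t: "t \<in> {-\<epsilon><..<\<epsilon>}" and y: "y \<in> ball x0 r" for t y v
  proof -
    have FS: "(F has_derivative fderiv F (\<psi> (t, y))) (at (\<psi> (t, y)))"
      using near[OF t y] by (intro smooth_on_has_derivative[OF smF])
    \<comment> \<open>\<open>G\<close> is constant in \<open>t\<close> and \<open>y\<close>, so its
      derivative in the direction \<open>(0, v, z)\<close> is that of \<open>F\<close> in the
      direction \<open>z\<close>.\<close>
    have "(G has_derivative (\<lambda>(_, _, z). fderiv F (\<psi> (t, y)) z)) (at (t, y, \<psi> (t, y)))"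
      unfolding G_def case_prod_beta'
      by (rule has_derivative_compose[of "\<lambda>x. snd (snd x)" "\<lambda>x. snd (snd x)" "(t, y, \<psi> (t, y))" UNIV F])
         (use FS in \<open>auto intro!: derivative_intros\<close>)
    from partial_derivative(4)[OF CkG t y, of v, unfolded frechet_derivative_at[OF this, symmetric]]
    show ?thesis by simp
  qed
  moreover have "\<psi> (t, y) \<in> S" if "t \<in> {-\<epsilon><..<\<epsilon>}" "y \<in> ball x0 r" for t y using near[OF that] R(3) by auto
  ultimately have "local_flow_on F S \<epsilon> (ball x0 r) \<psi>"
    unfolding local_flow_on_def using \<epsilon> flow_ode init by (auto simp del: mem_ball greaterThanLessThan_iff)
  then show ?thesis by (rule that[OF r])
qed

subsection \<open>Smooth manifolds in charts\<close>

text \<open>\<open>h b y\<close> is the integral of the derivative of \<open>g\<close> in direction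
  \<open>b\<close> along the segment from \<open>x0\<close> to \<open>y\<close>. Its smoothness in
  \<open>y\<close> is a case of the parameter theorem for ODEs: the integral is the value at time 1
  of a solution whose velocity depends on time and parameter alone.\<close>

lemma smooth_on_hadamard:
  fixes g :: "'a::euclidean_space \<Rightarrow> real"
  assumes g: "smooth_on S g" and S: "open S" and x0: "x0 \<in> S"
  obtains r h where "r > 0" "ball x0 r \<subseteq> S" "\<And>b. smooth_on (ball x0 r) (h b)"
    "\<And>b. h b x0 = fderiv g x0 b"
    "\<And>y. y \<in> ball x0 r \<Longrightarrow> g y = g x0 + (\<Sum>b\<in>Basis. ((y - x0) \<bullet> b) * h b y)"
proof -
  obtain R where R: "R > 0" "ball x0 R \<subseteq> S" using open_contains_ball S x0 by blast
  \<comment> \<open>Halving the radius leaves room for all \<open>t\<close> in the open interval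
    from -2 to 2, which has to contain time 1 in its interior.\<close>
  define r where "r = R / 2"
  have r: "r > 0" using R by (simp add: r_def)
  have seg: "x0 + t *\<^sub>R (y - x0) \<in> S" if "y \<in> ball x0 r" "\<bar>t\<bar> < 2" for t y
  proof -
    have "\<bar>t\<bar> * norm (y - x0) \<le> 2 * norm (y - x0)" using that by (intro mult_right_mono) auto
    moreover have "norm (y - x0) < R / 2" using that by (simp add: r_def dist_norm norm_minus_commute)
    ultimately have "x0 + t *\<^sub>R (y - x0) \<in> ball x0 R" by (simp add: dist_norm)
    then show ?thesis using R by auto
  qed
  \<comment> \<open>The state \<open>z\<close> is carried along to give \<open>G\<close> the shape
    of \<open>param_ode\<close>; the equation is a pure quadrature.\<close>
  define G where "G b = (\<lambda>(t::real, y, z::real). fderiv g (x0 + t *\<^sub>R (y - x0)) b)" for b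
  define \<psi> where "\<psi> b = (\<lambda>(t, y). t *\<^sub>R integral {0..1} (\<lambda>s. G b (t * s, y, 0)))" for b
  have op: "open ({-2::real<..<2} \<times> ball x0 r \<times> (UNIV::real set))" by (intro open_Times) auto
  have CkG: "Ck_on k ({-2::real<..<2} \<times> ball x0 r \<times> UNIV) (G b)" for k b
    unfolding G_def case_prod_beta'
  proof (rule Ck_on_frechet_derivative[OF op smooth_onD[OF g]])
    have "Ck_on k ({-2::real<..<2} \<times> ball x0 r \<times> (UNIV::real set)) (\<lambda>x. x0 + fst x *\<^sub>R (fst (snd x) + (- x0)))"
      by (intro Ck_on_add Ck_on_scaleR Ck_on_const op Ck_on_bounded_linear bounded_linear_intros)
    then show "Ck_on k ({-2::real<..<2} \<times> ball x0 r \<times> (UNIV::real set)) (\<lambda>x. x0 + fst x *\<^sub>R (fst (snd x) - x0))"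
      by simp
  qed (use seg in \<open>auto simp: Ck_on_const abs_less_iff\<close>)
  have contG: "continuous_on ({-2::real<..<2} \<times> ball x0 r) (\<lambda>(t, y). G b (t, y, 0))" for b
    unfolding case_prod_beta'
    by (intro continuous_on_compose2[OF Ck_on_continuous_on[OF CkG]] continuous_intros) auto
  have ts: "\<bar>t * s\<bar> < 2" if "\<bar>t\<bar> < 2" "s \<in> {0..1}" for t s :: real
  proof -
    have "\<bar>t * s\<bar> \<le> \<bar>t\<bar> * 1" unfolding abs_mult using that by (intro mult_left_mono) auto
    then show ?thesis using that by simp
  qed
  have ts': "t * s \<in> {-2::real<..<2}" if "t \<in> {-2::real<..<2}" "s \<in> {0..1}" for t s :: real
    using ts[of t s] that by (auto simp: abs_less_iff)
  have "param_ode 2 (ball x0 r) UNIV (G b) (\<psi> b) 0 0" for b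
  proof
    have "continuous_on (({-2::real<..<2} \<times> ball x0 r) \<times> cbox 0 1) (\<lambda>(x, s::real). G b (fst x * s, snd x, 0))"
      unfolding case_prod_beta
      by (rule continuous_on_compose2[OF contG[of b], of _ "\<lambda>x. (fst (fst x) * snd x, snd (fst x))", simplified case_prod_beta fst_conv snd_conv])
         (use ts' in \<open>auto intro!: continuous_intros\<close>)
    from integral_continuous_on_param[OF this]
    show "continuous_on ({-2::real<..<2} \<times> ball x0 r) (\<psi> b)"
      unfolding \<psi>_def case_prod_beta' by (intro continuous_intros) simp
    fix t y assume t: "t \<in> {-2::real<..<2}" and y: "y \<in> ball x0 r"
    obtain T where T: "\<bar>t\<bar> < T" "T < 2" using dense[of "\<bar>t\<bar>" 2] t by (auto simp: abs_less_iff)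
    have "continuous_on {-T..T} (\<lambda>t. G b (t, y, 0))"
      using y T by (intro continuous_on_compose2[OF contG[of b], of _ "\<lambda>t. (t, y)", simplified] continuous_intros) auto
    from scaled_integral_has_vector_derivative[OF this T(1)]
    show "((\<lambda>t. \<psi> b (t, y)) has_vector_derivative G b (t, y, \<psi> b (t, y))) (at t)"
      by (simp add: \<psi>_def G_def)
  qed (auto simp: \<psi>_def)
  from ode_param_Ck_on[OF this CkG]
  have Ck\<psi>: "Ck_on k ({-2::real<..<2} \<times> ball x0 r) (\<psi> b)" for k b .
  define h where "h b y = \<psi> b (1, y)" for b y
  show ?thesis
  proof (rule that[of r h])
    show "ball x0 r \<subseteq> S" using R by (auto simp: r_def)
    show "smooth_on (ball x0 r) (h b)" for b
      unfolding smooth_on_def h_def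
      by (intro allI Ck_on_compose[OF open_ball Ck\<psi>] Ck_on_Pair Ck_on_const Ck_on_bounded_linear bounded_linear_intros) auto
    show "h b x0 = fderiv g x0 b" for b by (simp add: h_def \<psi>_def G_def)
    fix y assume y: "y \<in> ball x0 r"
    have ints: "(\<lambda>s. fderiv g (x0 + s *\<^sub>R (y - x0)) b) integrable_on {0..1}" for b
    proof (intro integrable_continuous_real)
      show "continuous_on {0..1} (\<lambda>s. fderiv g (x0 + s *\<^sub>R (y - x0)) b)"
      proof -
        have "continuous_on {0..1} (\<lambda>t. (t, y))" and "(\<lambda>t. (t, y)) ` {0..1} \<subseteq> {-2::real<..<2} \<times> ball x0 r"
          using y by (auto intro!: continuous_intros)
        from continuous_on_compose2[OF contG[of b] this] show ?thesis by (simp add: G_def)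
      qed
    qed
    have "((\<lambda>s. fderiv g (x0 + s *\<^sub>R (y - x0)) (y - x0)) has_integral
        g (x0 + 1 *\<^sub>R (y - x0)) - g (x0 + 0 *\<^sub>R (y - x0))) {0..1}"
    proof (rule fundamental_theorem_of_calculus)
      fix s :: real assume s: "s \<in> {0..1}"
      have gs: "(g has_derivative fderiv g (x0 + s *\<^sub>R (y - x0))) (at (x0 + s *\<^sub>R (y - x0)))"
        using s y by (intro smooth_on_has_derivative[OF g] seg) auto
      then interpret bounded_linear "fderiv g (x0 + s *\<^sub>R (y - x0))"
        by (rule has_derivative_bounded_linear)
      have "((\<lambda>s. x0 + s *\<^sub>R (y - x0)) has_derivative (\<lambda>h. h *\<^sub>R (y - x0))) (at s within {0..1})"
        by (auto intro!: derivative_eq_intros)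
      from has_derivative_compose[OF this gs]
      show "((\<lambda>s. g (x0 + s *\<^sub>R (y - x0))) has_vector_derivative fderiv g (x0 + s *\<^sub>R (y - x0)) (y - x0)) (at s within {0..1})"
        by (simp add: has_vector_derivative_def scaleR)
    qed simp
    from integral_unique[OF this]
    have "g y - g x0 = integral {0..1} (\<lambda>s. fderiv g (x0 + s *\<^sub>R (y - x0)) (y - x0))"
      by simp
    also have "\<dots> = integral {0..1} (\<lambda>s. \<Sum>b\<in>Basis. ((y - x0) \<bullet> b) *\<^sub>R fderiv g (x0 + s *\<^sub>R (y - x0)) b)"
      using seg[OF y] by (intro integral_cong frechet_derivative_euclidean smooth_on_differentiable[OF g]) auto
    also have "\<dots> = (\<Sum>b\<in>Basis. ((y - x0) \<bullet> b) *\<^sub>R integral {0..1} (\<lambda>s. fderiv g (x0 + s *\<^sub>R (y - x0)) b))"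
      by (subst integral_sum) (auto intro!: integrable_on_mult_right ints)
    finally show "g y = g x0 + (\<Sum>b\<in>Basis. ((y - x0) \<bullet> b) * h b y)" by (simp add: h_def \<psi>_def G_def)
  qed (rule r)
qed

section \<open>Derivations, smooth functions and locality\<close>

lemma tangent_add: "v \<in> tangent_space A p \<Longrightarrow> smooth_at A p g \<Longrightarrow> smooth_at A p h \<Longrightarrow>
    v (\<lambda>q. g q + h q) = v g + v h"
  and tangent_mult: "v \<in> tangent_space A p \<Longrightarrow> smooth_at A p g \<Longrightarrow> smooth_at A p h \<Longrightarrow>
    v (\<lambda>q. g q * h q) = v g * h p + g p * v h"
  and tangent_cmult: "v \<in> tangent_space A p \<Longrightarrow> smooth_at A p g \<Longrightarrow> v (\<lambda>q. a * g q) = a * v g"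
  and tangent_nonsmooth: "v \<in> tangent_space A p \<Longrightarrow> \<not> smooth_at A p g \<Longrightarrow> v g = 0"
  by (simp_all add: tangent_space_def)

lemma tangent_spaceI:
  assumes "\<And>g h. smooth_at A p g \<Longrightarrow> smooth_at A p h \<Longrightarrow> v (\<lambda>q. g q + h q) = v g + v h"
    "\<And>g h. smooth_at A p g \<Longrightarrow> smooth_at A p h \<Longrightarrow> v (\<lambda>q. g q * h q) = v g * h p + g p * v h"
    "\<And>a g. smooth_at A p g \<Longrightarrow> v (\<lambda>q. a * g q) = a * v g"
    "\<And>g. \<not> smooth_at A p g \<Longrightarrow> v g = 0"
  shows "v \<in> tangent_space A p"
  using assms by (simp add: tangent_space_def)

lemma smooth_atlas_cover: "smooth_atlas A \<Longrightarrow> \<exists>U x. (U, x) \<in> A \<and> p \<in> U"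
proof -
  assume "smooth_atlas A"
  then have "p \<in> (\<Union>(U, x)\<in>A. U)" by (simp add: smooth_atlas_def)
  then show ?thesis by auto
qed

lemma smooth_fun_subset: "smooth_fun A V g \<Longrightarrow> V' \<subseteq> V \<Longrightarrow> smooth_fun A V' g"
  unfolding smooth_fun_def
proof clarify
  fix U x
  assume "V' \<subseteq> V" "(U, x) \<in> A" and g: "\<forall>(U, x)\<in>A. smooth_on (x ` (U \<inter> V)) (g \<circ> inv_into U x)"
  then have "smooth_on (x ` (U \<inter> V)) (g \<circ> inv_into U x)" by auto
  then show "smooth_on (x ` (U \<inter> V')) (g \<circ> inv_into U x)"
    using \<open>V' \<subseteq> V\<close> by (elim smooth_on_subset) auto
qed

lemma smooth_fun_imp_at: "smooth_fun A V g \<Longrightarrow> open V \<Longrightarrow> p \<in> V \<Longrightarrow> smooth_at A p g"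
  unfolding smooth_at_def by blast

locale smooth_chart =
  fixes A :: "('m::{t2_space,second_countable_topology}, 'e::euclidean_space) chart set"
    and U :: "'m set" and x :: "'m \<Rightarrow> 'e"
  assumes atlas: "smooth_atlas A" and chart: "(U, x) \<in> A"
begin

abbreviation xi where "xi \<equiv> inv_into U x"

lemma open_U: "open U" and open_xU: "open (x ` U)"
  using bspec[OF conjunct1[OF conjunct2[OF atlas[unfolded smooth_atlas_def]]] chart] by simp_all

text \<open>The atlas provides some continuous inverse of the chart; by injectivity it coincides
  with \<open>inv_into U x\<close> on the image.\<close>

lemma homeo: "homeomorphism U (x ` U) x xi"
proof -
  obtain y where y: "homeomorphism U (x ` U) x y" 
    using bspec[OF conjunct1[OF conjunct2[OF atlas[unfolded smooth_atlas_def]]] chart] by auto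
  have inj: "inj_on x U" using homeomorphism_apply1[OF y] by (metis inj_onI)
  have "y z = xi z" if "z \<in> x ` U" for z
    using that homeomorphism_apply1[OF y] inv_into_f_f[OF inj] by auto
  then show ?thesis using y by (auto simp: homeomorphism_def cong: continuous_on_cong)
qed

lemma xi_x [simp]: "q \<in> U \<Longrightarrow> xi (x q) = q"
  using homeo by (simp add: homeomorphism_def)

lemma x_xi [simp]: "z \<in> x ` U \<Longrightarrow> x (xi z) = z"
  by (rule f_inv_into_f)

lemma xi_in: "z \<in> x ` U \<Longrightarrow> xi z \<in> U"
  by (rule inv_into_into)

lemma xi_mem: "z \<in> x ` V \<Longrightarrow> V \<subseteq> U \<Longrightarrow> xi z \<in> V"
  by (auto simp: subset_iff)

lemma continuous_x: "continuous_on U x" and continuous_xi: "continuous_on (x ` U) xi"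
  using homeo by (auto simp: homeomorphism_def)

lemma open_image: "open V \<Longrightarrow> V \<subseteq> U \<Longrightarrow> open (x ` V)"
  using homeomorphism_imp_open_map[OF homeo, of V] open_U open_xU
  by (simp add: openin_open_eq)

lemma open_preimage: "open T \<Longrightarrow> open {q \<in> U. x q \<in> T}"
  using continuous_open_preimage[OF continuous_x open_U, of T] by (simp add: vimage_def Int_def)

lemma transition_smooth: "(U', x') \<in> A \<Longrightarrow> smooth_on (x' ` (U' \<inter> U)) (\<lambda>z. x (inv_into U' x' z))"
  using bspec[OF bspec[OF conjunct2[OF conjunct2[OF atlas[unfolded smooth_atlas_def]]], of "(U', x')", simplified] chart]
  by (simp add: o_def)

end

lemma smooth_chartI: "smooth_atlas A \<Longrightarrow> (U, x) \<in> A \<Longrightarrow> smooth_chart A U x"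
  by (simp add: smooth_chart_def)

text \<open>One chart around \<open>V\<close> suffices, since every other chart differs from it by a
  smooth transition map.\<close>

lemma (in smooth_chart) smooth_fun_iff:
  assumes V: "open V" "V \<subseteq> U"
  shows "smooth_fun A V g \<longleftrightarrow> smooth_on (x ` V) (\<lambda>z. g (xi z))"
proof
  assume "smooth_fun A V g"
  then have "smooth_on (x ` (U \<inter> V)) (g \<circ> xi)" unfolding smooth_fun_def using chart by blast
  then show "smooth_on (x ` V) (\<lambda>z. g (xi z))" using V by (simp add: Int_absorb1 o_def)
next
  assume g: "smooth_on (x ` V) (\<lambda>z. g (xi z))"
  show "smooth_fun A V g"
    unfolding smooth_fun_def
  proof clarify
    fix U' x' assume c': "(U', x') \<in> A"
    interpret c': smooth_chart A U' x' by (rule smooth_chartI[OF atlas c'])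
    have op: "open (x' ` (U' \<inter> V))" using V by (intro c'.open_image) (auto intro: c'.open_U)
    have tr: "smooth_on (x' ` (U' \<inter> V)) (\<lambda>z. x (inv_into U' x' z))"
      by (rule smooth_on_subset[OF transition_smooth[OF c']]) (use V in auto)
    have "smooth_on (x' ` (U' \<inter> V)) (\<lambda>z. g (xi (x (inv_into U' x' z))))"
      by (rule smooth_on_compose[OF op g tr]) auto
    then show "smooth_on (x' ` (U' \<inter> V)) (g \<circ> inv_into U' x')"
      by (rule smooth_on_cong[OF op, rotated]) (use V in auto)
  qed
qed

lemma smooth_fun_iff_at:
  fixes A :: "('m::{t2_space,second_countable_topology}, 'e::euclidean_space) chart set"
  assumes atlas: "smooth_atlas A" and V: "open V"
  shows "smooth_fun A V g \<longleftrightarrow> (\<forall>p\<in>V. smooth_at A p g)"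
proof
  show "smooth_fun A V g \<Longrightarrow> \<forall>p\<in>V. smooth_at A p g" using V smooth_fun_imp_at by blast
  assume at: "\<forall>p\<in>V. smooth_at A p g"
  show "smooth_fun A V g"
    unfolding smooth_fun_def
  proof clarify
    fix U x assume c: "(U, x) \<in> A"
    interpret smooth_chart A U x by (rule smooth_chartI[OF atlas c])
    show "smooth_on (x ` (U \<inter> V)) (g \<circ> xi)"
    proof (rule smooth_on_local)
      fix z assume "z \<in> x ` (U \<inter> V)"
      then obtain p where p: "p \<in> U" "p \<in> V" "z = x p" by blast
      with at obtain N where N: "open N" "p \<in> N" "smooth_fun A N g" unfolding smooth_at_def by blast
      then show "\<exists>T. open T \<and> z \<in> T \<and> smooth_on T (g \<circ> xi)"
        using p c open_U by (intro exI[of _ "x ` (U \<inter> N)"]) (auto simp: smooth_fun_def intro!: open_image)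
    qed
  qed
qed

lemma smooth_at_cong:
  fixes A :: "('m::{t2_space,second_countable_topology}, 'e::euclidean_space) chart set"
  assumes atlas: "smooth_atlas A" and V: "open V" "p \<in> V" and eq: "\<And>q. q \<in> V \<Longrightarrow> g q = h q" and g: "smooth_at A p g"
  shows "smooth_at A p h"
proof -
  obtain N where N: "open N" "p \<in> N" "smooth_fun A N g" using g unfolding smooth_at_def by blast
  have "smooth_fun A (N \<inter> V) h"
    unfolding smooth_fun_def
  proof clarify
    fix U x assume c: "(U, x) \<in> A"
    interpret smooth_chart A U x by (rule smooth_chartI[OF atlas c])
    have op: "open (x ` (U \<inter> (N \<inter> V)))" using N V open_U by (intro open_image) auto
    have "smooth_on (x ` (U \<inter> (N \<inter> V))) (g \<circ> xi)"
      using N(3) c by (auto simp: smooth_fun_def intro: smooth_on_subset)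
    then show "smooth_on (x ` (U \<inter> (N \<inter> V))) (h \<circ> xi)"
      by (rule smooth_on_cong[OF op, rotated]) (use eq in \<open>auto\<close>)
  qed
  then show ?thesis using N V by (intro smooth_fun_imp_at[of A "N \<inter> V"]) auto
qed

context smooth_chart
begin

lemma smooth_at_iff:
  assumes p: "p \<in> U"
  shows "smooth_at A p g \<longleftrightarrow> (\<exists>T. open T \<and> x p \<in> T \<and> T \<subseteq> x ` U \<and> smooth_on T (\<lambda>z. g (xi z)))"
proof
  assume "smooth_at A p g"
  then obtain N where N: "open N" "p \<in> N" "smooth_fun A N g" unfolding smooth_at_def by blast
  have "smooth_on (x ` (U \<inter> N)) (\<lambda>z. g (xi z))" using N(3) chart by (auto simp: smooth_fun_def o_def)
  then show "\<exists>T. open T \<and> x p \<in> T \<and> T \<subseteq> x ` U \<and> smooth_on T (\<lambda>z. g (xi z))"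
    using N p open_U by (intro exI[of _ "x ` (U \<inter> N)"]) (auto intro!: open_image)
next
  assume "\<exists>T. open T \<and> x p \<in> T \<and> T \<subseteq> x ` U \<and> smooth_on T (\<lambda>z. g (xi z))"
  then obtain T where T: "open T" "x p \<in> T" "T \<subseteq> x ` U" "smooth_on T (\<lambda>z. g (xi z))" by blast
  have "smooth_on (x ` {q \<in> U. x q \<in> T}) (\<lambda>z. g (xi z))" by (rule smooth_on_subset[OF T(4)]) auto
  then have "smooth_fun A {q \<in> U. x q \<in> T} g" using open_preimage[OF T(1)] by (subst smooth_fun_iff) auto
  then show "smooth_at A p g" using p T open_preimage[OF T(1)] by (intro smooth_fun_imp_at[of A "{q \<in> U. x q \<in> T}"]) auto
qed

lemma smooth_at_comp_chart:
  assumes p: "p \<in> U" and T: "open T" "x p \<in> T" and h: "smooth_on T h"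
  shows "smooth_at A p (\<lambda>q. h (x q))"
proof -
  have op: "open (T \<inter> x ` U)" using T open_xU by auto
  have "smooth_on (T \<inter> x ` U) (\<lambda>z. h (x (xi z)))"
    by (rule smooth_on_cong[OF op _ smooth_on_subset[OF h]]) auto
  then show ?thesis using p T op by (subst smooth_at_iff) auto
qed

lemma smooth_at_coord: "p \<in> U \<Longrightarrow> smooth_at A p (\<lambda>q. x q \<bullet> b)"
  using smooth_at_comp_chart[of p UNIV "\<lambda>z. z \<bullet> b"]
  by (simp add: smooth_on_bounded_linear bounded_linear_inner_left)

lemma smooth_at_has_derivative:
  "smooth_at A p g \<Longrightarrow> p \<in> U \<Longrightarrow> ((\<lambda>z. g (xi z)) has_derivative fderiv (\<lambda>z. g (xi z)) (x p)) (at (x p))"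
  by (auto simp: smooth_at_iff intro: smooth_on_has_derivative)

end

context
  fixes A :: "('m::{t2_space,second_countable_topology}, 'e::euclidean_space) chart set"
  assumes atlas: "smooth_atlas A"
begin

lemma smooth_at_const: "smooth_at A p (\<lambda>q. c)"
proof -
  obtain U x where "(U, x) \<in> A" "p \<in> U" using smooth_atlas_cover[OF atlas] by blast
  then interpret smooth_chart A U x by (intro smooth_chartI[OF atlas])
  show ?thesis using \<open>p \<in> U\<close> open_xU by (subst smooth_at_iff) (auto simp: smooth_on_const)
qed

lemma smooth_at_binop:
  fixes F :: "real \<Rightarrow> real \<Rightarrow> real"
  assumes F: "\<And>S u v. open (S::'e set) \<Longrightarrow> smooth_on S u \<Longrightarrow> smooth_on S v \<Longrightarrow> smooth_on S (\<lambda>z. F (u z) (v z))"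
    and g: "smooth_at A p g" and h: "smooth_at A p h"
  shows "smooth_at A p (\<lambda>q. F (g q) (h q))"
proof -
  obtain U x where "(U, x) \<in> A" "p \<in> U" using smooth_atlas_cover[OF atlas] by blast
  then interpret smooth_chart A U x by (intro smooth_chartI[OF atlas])
  obtain T where T: "open T" "x p \<in> T" "T \<subseteq> x ` U" "smooth_on T (\<lambda>z. g (xi z))"
    using g \<open>p \<in> U\<close> by (auto simp: smooth_at_iff)
  obtain T' where T': "open T'" "x p \<in> T'" "T' \<subseteq> x ` U" "smooth_on T' (\<lambda>z. h (xi z))"
    using h \<open>p \<in> U\<close> by (auto simp: smooth_at_iff)
  have "smooth_on (T \<inter> T') (\<lambda>z. F (g (xi z)) (h (xi z)))"
    using T T' by (intro F smooth_on_subset[OF T(4)] smooth_on_subset[OF T'(4)]) auto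
  then show ?thesis using T T' \<open>p \<in> U\<close> by (subst smooth_at_iff) (auto intro!: exI[of _ "T \<inter> T'"])
qed

lemma smooth_at_add: "smooth_at A p g \<Longrightarrow> smooth_at A p h \<Longrightarrow> smooth_at A p (\<lambda>q. g q + h q)"
  by (rule smooth_at_binop[OF smooth_on_add])

lemma smooth_at_mult: "smooth_at A p g \<Longrightarrow> smooth_at A p h \<Longrightarrow> smooth_at A p (\<lambda>q. g q * h q)"
  by (rule smooth_at_binop[OF smooth_on_mult])

lemma smooth_at_cmult: "smooth_at A p g \<Longrightarrow> smooth_at A p (\<lambda>q. c * g q)"
  by (rule smooth_at_mult[OF smooth_at_const])

lemma smooth_at_sum: "(\<And>i. i \<in> I \<Longrightarrow> smooth_at A p (g i)) \<Longrightarrow> smooth_at A p (\<lambda>q. \<Sum>i\<in>I. g i q)"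
  by (induction I rule: infinite_finite_induct) (simp_all add: smooth_at_const smooth_at_add)

lemma tangent_sum:
  assumes v: "v \<in> tangent_space A p" and g: "\<And>i. i \<in> I \<Longrightarrow> smooth_at A p (g i)"
  shows "v (\<lambda>q. \<Sum>i\<in>I. g i q) = (\<Sum>i\<in>I. v (g i))"
proof -
  have zero: "v (\<lambda>q. 0) = 0"
  proof -
    have "v (\<lambda>q. 0 * (0::real)) = 0 * v (\<lambda>q. 0)"
      by (rule tangent_cmult[OF v smooth_at_const])
    then show ?thesis by simp
  qed
  show ?thesis
    using g
  proof (induction I rule: infinite_finite_induct)
    case (insert i F)
    then show ?case using smooth_at_sum[of F p g] by (simp add: tangent_add[OF v])
  next
    case (infinite F)
    show ?case using zero by (simp only: sum.infinite[OF infinite.hyps])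
  next
    case empty
    show ?case using zero by (simp only: sum.empty)
  qed
qed

lemma tangent_const:
  assumes v: "v \<in> tangent_space A p"
  shows "v (\<lambda>q. c) = 0"
proof -
  have 1: "smooth_at A p (\<lambda>q. 1)" by (rule smooth_at_const)
  have "v (\<lambda>q. 1 * 1) = v (\<lambda>q. 1) * 1 + 1 * v (\<lambda>q. 1)"
    by (rule tangent_mult[OF v 1 1])
  then have "v (\<lambda>q. 1) = 0" by simp
  moreover have "v (\<lambda>q. c * 1) = c * v (\<lambda>q. 1)" by (rule tangent_cmult[OF v 1])
  ultimately show ?thesis by simp
qed

text \<open>The difference \<open>d\<close> of two functions with the same germ at \<open>p\<close> satisfies \<open>d = k * d\<close>, where \<open>k\<close> is \<open>0\<close> near \<open>p\<close>
  and \<open>1\<close> elsewhere, so no bump function is needed.\<close>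

lemma tangent_cong:
  assumes v: "v \<in> tangent_space A p" and V: "open V" "p \<in> V" and eq: "\<And>q. q \<in> V \<Longrightarrow> g q = h q"
  shows "v g = v h"
proof (cases "smooth_at A p g")
  case True
  have h: "smooth_at A p h" by (rule smooth_at_cong[OF atlas V eq True])
  define k :: "'m \<Rightarrow> real" where "k q = (if q \<in> V then 0 else 1)" for q
  have k: "smooth_at A p k" by (rule smooth_at_cong[OF atlas V _ smooth_at_const[of p 0]]) (simp add: k_def)
  define d where "d q = g q + (- 1) * h q" for q
  have d: "smooth_at A p d" unfolding d_def by (intro smooth_at_add smooth_at_cmult True h)
  have kd: "(\<lambda>q. k q * d q) = d" using eq by (auto simp: k_def d_def)
  have "v (\<lambda>q. k q * d q) = v k * d p + k p * v d" by (rule tangent_mult[OF v k d])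
  then have "v d = 0" using V eq[OF V(2)] unfolding kd by (simp add: k_def d_def)
  moreover have "v (\<lambda>q. h q + d q) = v h + v d" by (rule tangent_add[OF v h d])
  moreover have "(\<lambda>q. h q + d q) = g" by (simp add: d_def)
  ultimately show ?thesis by simp
next
  \<comment> \<open>Both functions then fail to be smooth at \<open>p\<close>, and the normalisation
    of tangent vectors makes both values 0.\<close>
  case False
  then have "\<not> smooth_at A p h" using smooth_at_cong[OF atlas V, of h g] eq by metis
  with False show ?thesis by (simp add: tangent_nonsmooth[OF v])
qed

end

section \<open>Vector fields, one-forms and the Lie bracket\<close>

lemma vector_field_tangent: "vector_field A V X \<Longrightarrow> p \<in> V \<Longrightarrow> X p \<in> tangent_space A p"
  by (simp add: vector_field_def)

lemma vector_field_smooth_fun: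
  "vector_field A V X \<Longrightarrow> open V' \<Longrightarrow> V' \<subseteq> V \<Longrightarrow> smooth_fun A V' g \<Longrightarrow> smooth_fun A V' (\<lambda>p. X p g)"
  by (simp add: vector_field_def)

lemma vector_field_subset: "vector_field A V X \<Longrightarrow> V' \<subseteq> V \<Longrightarrow> vector_field A V' X"
  unfolding vector_field_def by (meson subset_iff subset_trans)

lemma one_form_cotangent: "one_form A V \<alpha> \<Longrightarrow> p \<in> V \<Longrightarrow> \<alpha> p \<in> cotangent_space A p"
  by (simp add: one_form_def)

lemma one_form_smooth_fun:
  "one_form A V \<alpha> \<Longrightarrow> open V' \<Longrightarrow> V' \<subseteq> V \<Longrightarrow> vector_field A V' X \<Longrightarrow> smooth_fun A V' (\<lambda>p. \<alpha> p (X p))"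
  by (simp add: one_form_def)

lemma one_form_subset: "one_form A V \<alpha> \<Longrightarrow> V' \<subseteq> V \<Longrightarrow> one_form A V' \<alpha>"
  unfolding one_form_def by (meson subset_iff subset_trans)

lemma cotangent_linear:
  "\<alpha> \<in> cotangent_space A p \<Longrightarrow> u \<in> tangent_space A p \<Longrightarrow> v \<in> tangent_space A p \<Longrightarrow>
    \<alpha> (\<lambda>g. a * u g + b * v g) = a * \<alpha> u + b * \<alpha> v"
  by (simp add: cotangent_space_def)

lemma cotangent_outside: "\<alpha> \<in> cotangent_space A p \<Longrightarrow> v \<notin> tangent_space A p \<Longrightarrow> \<alpha> v = 0"
  by (simp add: cotangent_space_def)

lemma smooth_at_nhd:
  assumes "smooth_at A p g"
  obtains N where "open N" "p \<in> N" "smooth_fun A N g" "\<And>q. q \<in> N \<Longrightarrow> smooth_at A q g"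
  using assms unfolding smooth_at_def by blast

lemma vector_field_smooth_at:
  assumes X: "vector_field A V X" and V: "open V" "p \<in> V" and g: "smooth_at A p g"
  shows "smooth_at A p (\<lambda>q. X q g)"
proof -
  obtain N where N: "open N" "p \<in> N" "smooth_fun A N g" using smooth_at_nhd[OF g] by metis
  have "smooth_fun A (N \<inter> V) (\<lambda>q. X q g)"
    using N V by (intro vector_field_smooth_fun[OF X] smooth_fun_subset[OF N(3)]) auto
  then show ?thesis by (rule smooth_fun_imp_at) (use N V in auto)
qed

text \<open>In the Leibniz rule the mixed terms \<open>X p g * Y p h\<close> and
  \<open>Y p g * X p h\<close> occur in both iterated derivatives and cancel. The rules for the
  inner field hold only near \<open>p\<close>, hence the passage through
  \<open>tangent_cong\<close>.\<close>

lemma lie_bracket_tangent: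
  fixes A :: "('m::{t2_space,second_countable_topology}, 'e::euclidean_space) chart set"
  assumes atlas: "smooth_atlas A" and V: "open V" "p \<in> V"
    and X: "vector_field A V X" and Y: "vector_field A V Y"
  shows "lie_bracket A X Y p \<in> tangent_space A p"
proof (rule tangent_spaceI)
  note Xp = vector_field_tangent[OF X V(2)] and Yp = vector_field_tangent[OF Y V(2)]
  note Xs = vector_field_smooth_at[OF X V] and Ys = vector_field_smooth_at[OF Y V]
  fix g h assume g: "smooth_at A p g" and h: "smooth_at A p h"
  obtain N where N: "open N" "p \<in> N" "\<And>q. q \<in> N \<Longrightarrow> smooth_at A q g" using smooth_at_nhd[OF g] by metis
  obtain N' where N': "open N'" "p \<in> N'" "\<And>q. q \<in> N' \<Longrightarrow> smooth_at A q h" using smooth_at_nhd[OF h] by metis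
  define M where "M = V \<inter> (N \<inter> N')"
  have M: "open M" "p \<in> M" unfolding M_def using V N N' by auto
  have gM: "smooth_at A q g" and hM: "smooth_at A q h" and XM: "X q \<in> tangent_space A q" and YM: "Y q \<in> tangent_space A q"
    if "q \<in> M" for q
    using that N N' vector_field_tangent[OF X] vector_field_tangent[OF Y] by (auto simp: M_def)
  have "X p (\<lambda>q. Y q (\<lambda>q. g q + h q)) = X p (\<lambda>q. Y q g + Y q h)"
    by (rule tangent_cong[OF atlas Xp M]) (simp add: tangent_add[OF YM gM hM])
  moreover have "Y p (\<lambda>q. X q (\<lambda>q. g q + h q)) = Y p (\<lambda>q. X q g + X q h)"
    by (rule tangent_cong[OF atlas Yp M]) (simp add: tangent_add[OF XM gM hM])
  ultimately show "lie_bracket A X Y p (\<lambda>q. g q + h q) = lie_bracket A X Y p g + lie_bracket A X Y p h"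
    using g h by (simp add: lie_bracket_def smooth_at_add[OF atlas] tangent_add[OF Xp Ys Ys] tangent_add[OF Yp Xs Xs])
  have "X p (\<lambda>q. Y q (\<lambda>q. g q * h q)) = X p (\<lambda>q. Y q g * h q + g q * Y q h)"
    by (rule tangent_cong[OF atlas Xp M]) (simp add: tangent_mult[OF YM gM hM])
  also have "\<dots> = X p (\<lambda>q. Y q g) * h p + Y p g * X p h + (X p g * Y p h + g p * X p (\<lambda>q. Y q h))"
    using g h by (simp add: tangent_add[OF Xp] tangent_mult[OF Xp] smooth_at_mult[OF atlas] Ys)
  finally have 1: "X p (\<lambda>q. Y q (\<lambda>q. g q * h q)) = X p (\<lambda>q. Y q g) * h p + Y p g * X p h + (X p g * Y p h + g p * X p (\<lambda>q. Y q h))" .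
  have "Y p (\<lambda>q. X q (\<lambda>q. g q * h q)) = Y p (\<lambda>q. X q g * h q + g q * X q h)"
    by (rule tangent_cong[OF atlas Yp M]) (simp add: tangent_mult[OF XM gM hM])
  also have "\<dots> = Y p (\<lambda>q. X q g) * h p + X p g * Y p h + (Y p g * X p h + g p * Y p (\<lambda>q. X q h))"
    using g h by (simp add: tangent_add[OF Yp] tangent_mult[OF Yp] smooth_at_mult[OF atlas] Xs)
  finally have 2: "Y p (\<lambda>q. X q (\<lambda>q. g q * h q)) = Y p (\<lambda>q. X q g) * h p + X p g * Y p h + (Y p g * X p h + g p * Y p (\<lambda>q. X q h))" .
  show "lie_bracket A X Y p (\<lambda>q. g q * h q) = lie_bracket A X Y p g * h p + g p * lie_bracket A X Y p h"
    using g h by (simp add: lie_bracket_def smooth_at_mult[OF atlas] 1 2 algebra_simps)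
next
  note Xp = vector_field_tangent[OF X V(2)] and Yp = vector_field_tangent[OF Y V(2)]
  note Xs = vector_field_smooth_at[OF X V] and Ys = vector_field_smooth_at[OF Y V]
  fix a g assume g: "smooth_at A p g"
  obtain N where N: "open N" "p \<in> N" "\<And>q. q \<in> N \<Longrightarrow> smooth_at A q g" using smooth_at_nhd[OF g] by metis
  have M: "open (V \<inter> N)" "p \<in> V \<inter> N" using V N by auto
  have "X p (\<lambda>q. Y q (\<lambda>q. a * g q)) = X p (\<lambda>q. a * Y q g)"
    by (rule tangent_cong[OF atlas Xp M]) (use N in \<open>simp add: tangent_cmult[OF vector_field_tangent[OF Y]]\<close>)
  moreover have "Y p (\<lambda>q. X q (\<lambda>q. a * g q)) = Y p (\<lambda>q. a * X q g)"
    by (rule tangent_cong[OF atlas Yp M]) (use N in \<open>simp add: tangent_cmult[OF vector_field_tangent[OF X]]\<close>)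
  ultimately show "lie_bracket A X Y p (\<lambda>q. a * g q) = a * lie_bracket A X Y p g"
    using g by (simp add: lie_bracket_def smooth_at_cmult[OF atlas] tangent_cmult[OF Xp Ys] tangent_cmult[OF Yp Xs] algebra_simps)
qed (simp add: lie_bracket_def)

section \<open>Coordinates of vectors, covectors, brackets and Lie derivatives\<close>

context smooth_chart
begin

text \<open>The tangent vector at \<open>p\<close> with coordinate vector \<open>w\<close>. The
  value 0 off the functions smooth at \<open>p\<close> is the normalisation that
  \<open>tangent_space\<close> demands.\<close>

definition pd :: "'m \<Rightarrow> 'e \<Rightarrow> 'm vec" where
  "pd p w = (\<lambda>g. if smooth_at A p g then fderiv (\<lambda>z. g (xi z)) (x p) w else 0)"

definition vcoord :: "'m vec \<Rightarrow> 'e" where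
  "vcoord v = (\<Sum>b\<in>Basis. v (\<lambda>q. x q \<bullet> b) *\<^sub>R b)"

definition ccoord :: "'m \<Rightarrow> 'm covec \<Rightarrow> 'e" where
  "ccoord p \<alpha> = (\<Sum>b\<in>Basis. \<alpha> (pd p b) *\<^sub>R b)"

abbreviation vec_rep where "vec_rep Y \<equiv> \<lambda>z. vcoord (Y (xi z))"
abbreviation form_rep where "form_rep \<beta> \<equiv> \<lambda>z. ccoord (xi z) (\<beta> (xi z))"

lemma vcoord_inner: "b \<in> Basis \<Longrightarrow> vcoord v \<bullet> b = v (\<lambda>q. x q \<bullet> b)"
  by (simp add: vcoord_def inner_sum_left inner_Basis if_distrib[of "(*) _"] sum.delta cong: if_cong)

lemma ccoord_inner: "b \<in> Basis \<Longrightarrow> ccoord p \<alpha> \<bullet> b = \<alpha> (pd p b)"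
  by (simp add: ccoord_def inner_sum_left inner_Basis if_distrib[of "(*) _"] sum.delta cong: if_cong)

lemma pd_comp:
  assumes p: "p \<in> U" and T: "open T" "x p \<in> T" "smooth_on T h"
  shows "pd p w (\<lambda>q. h (x q)) = fderiv h (x p) w"
proof -
  have "fderiv h (x p) = fderiv (\<lambda>z. h (x (xi z))) (x p)"
    by (rule frechet_derivative_transform_within_open[of _ _ "T \<inter> x ` U"])
       (use p T open_xU in \<open>auto intro: smooth_on_differentiable\<close>)
  then show ?thesis using smooth_at_comp_chart[OF p T] by (simp add: pd_def)
qed

lemma pd_tangent:
  assumes p: "p \<in> U"
  shows "pd p w \<in> tangent_space A p"
proof (rule tangent_spaceI)
  fix g h assume g: "smooth_at A p g" and h: "smooth_at A p h"
  note g' = smooth_at_has_derivative[OF g p] and h' = smooth_at_has_derivative[OF h p]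
  show "pd p w (\<lambda>q. g q + h q) = pd p w g + pd p w h"
    using g h frechet_derivative_at[OF has_derivative_add[OF g' h'], symmetric] by (simp add: pd_def smooth_at_add[OF atlas])
  show "pd p w (\<lambda>q. g q * h q) = pd p w g * h p + g p * pd p w h"
    using g h p frechet_derivative_at[OF has_derivative_mult[OF g' h'], symmetric] by (simp add: pd_def smooth_at_mult[OF atlas])
next
  fix a g assume g: "smooth_at A p g"
  show "pd p w (\<lambda>q. a * g q) = a * pd p w g"
    using g frechet_derivative_at[OF has_derivative_mult_right[OF smooth_at_has_derivative[OF g p]], symmetric]
    by (simp add: pd_def smooth_at_cmult[OF atlas])
qed (simp add: pd_def)

lemma vcoord_pd:
  assumes p: "p \<in> U"
  shows "vcoord (pd p w) = w"
proof (rule euclidean_eqI)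
  fix b :: 'e assume b: "b \<in> Basis"
  have bl: "bounded_linear (\<lambda>z::'e. z \<bullet> b)" by (rule bounded_linear_inner_left)
  have "pd p w (\<lambda>q. x q \<bullet> b) = fderiv (\<lambda>z. z \<bullet> b) (x p) w"
    by (rule pd_comp[OF p open_UNIV UNIV_I smooth_on_bounded_linear[OF bl]])
  also have "\<dots> = w \<bullet> b"
    using frechet_derivative_at[OF bounded_linear_imp_has_derivative[OF bl]] by metis
  finally show "vcoord (pd p w) \<bullet> b = w \<bullet> b" by (simp add: vcoord_inner[OF b])
qed

text \<open>Hadamard's lemma writes \<open>g\<close> near \<open>p\<close> as a constant plus
  products of \<open>x q \<bullet> b - x p \<bullet> b\<close> with smooth functions. A derivation
  kills the constant, and since the first factors vanish at \<open>p\<close>, the Leibniz rule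
  leaves only its values on the coordinate functions.\<close>

lemma tangent_eq_pd:
  assumes p: "p \<in> U" and v: "v \<in> tangent_space A p"
  shows "v = pd p (vcoord v)"
proof
  fix g
  show "v g = pd p (vcoord v) g"
  proof (cases "smooth_at A p g")
    case False
    then show ?thesis using tangent_nonsmooth[OF v] by (simp add: pd_def)
  next
    case True
    then obtain T where T: "open T" "x p \<in> T" "T \<subseteq> x ` U" "smooth_on T (\<lambda>z. g (xi z))"
      using p by (auto simp: smooth_at_iff)
    obtain r h where r: "r > 0" "ball (x p) r \<subseteq> T" and h: "\<And>b. smooth_on (ball (x p) r) (h b)"
      "\<And>b. h b (x p) = fderiv (\<lambda>z. g (xi z)) (x p) b"
      "\<And>y. y \<in> ball (x p) r \<Longrightarrow> g (xi y) = g (xi (x p)) + (\<Sum>b\<in>Basis. ((y - x p) \<bullet> b) * h b y)"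
      using smooth_on_hadamard[OF T(4,1,2)] by blast
    have xpr: "x p \<in> ball (x p) r" using r by simp
    have hs: "smooth_at A p (\<lambda>q. h b (x q))" for b
      by (rule smooth_at_comp_chart[OF p open_ball xpr h(1)])
    have cs: "smooth_at A p (\<lambda>q. x q \<bullet> b + (- (x p \<bullet> b)))" for b
      by (intro smooth_at_add[OF atlas] smooth_at_coord p smooth_at_const[OF atlas])
    define V where "V = {q \<in> U. x q \<in> ball (x p) r}"
    have V: "open V" "p \<in> V" unfolding V_def using open_preimage[OF open_ball] xpr p by auto
    have "v g = v (\<lambda>q. g p + (\<Sum>b\<in>Basis. (x q \<bullet> b + (- (x p \<bullet> b))) * h b (x q)))"
    proof (rule tangent_cong[OF atlas v V])
      fix q assume "q \<in> V"
      then show "g q = g p + (\<Sum>b\<in>Basis. (x q \<bullet> b + (- (x p \<bullet> b))) * h b (x q))"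
        using h(3)[of "x q"] p by (auto simp: V_def inner_diff_left)
    qed
    also have "\<dots> = v (\<lambda>q. g p) + v (\<lambda>q. \<Sum>b\<in>Basis. (x q \<bullet> b + (- (x p \<bullet> b))) * h b (x q))"
      by (intro tangent_add[OF v] smooth_at_const[OF atlas] smooth_at_sum[OF atlas] smooth_at_mult[OF atlas] hs cs)
    also have "v (\<lambda>q. g p) = 0" by (rule tangent_const[OF atlas v])
    also have "v (\<lambda>q. \<Sum>b\<in>Basis. (x q \<bullet> b + (- (x p \<bullet> b))) * h b (x q))
        = (\<Sum>b\<in>Basis. v (\<lambda>q. (x q \<bullet> b + (- (x p \<bullet> b))) * h b (x q)))"
      by (intro tangent_sum[OF atlas v] smooth_at_mult[OF atlas] hs cs)
    also have "\<dots> = (\<Sum>b\<in>Basis. (vcoord v \<bullet> b) * h b (x p))"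
    proof (rule sum.cong)
      fix b :: 'e assume b: "b \<in> Basis"
      have "v (\<lambda>q. x q \<bullet> b + (- (x p \<bullet> b))) = v (\<lambda>q. x q \<bullet> b) + v (\<lambda>q. - (x p \<bullet> b))"
        by (rule tangent_add[OF v smooth_at_coord[OF p] smooth_at_const[OF atlas]])
      also have "\<dots> = vcoord v \<bullet> b" by (simp add: vcoord_inner[OF b] tangent_const[OF atlas v])
      finally show "v (\<lambda>q. (x q \<bullet> b + (- (x p \<bullet> b))) * h b (x q)) = (vcoord v \<bullet> b) * h b (x p)"
        using tangent_mult[OF v cs hs, of b b] by simp
    qed simp
    also have "\<dots> = fderiv (\<lambda>z. g (xi z)) (x p) (vcoord v)"
      using smooth_on_differentiable[OF T(4,2)] by (subst frechet_derivative_euclidean) (auto simp: h(2))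
    finally show ?thesis using True by (simp add: pd_def)
  qed
qed

lemma tangent_eqI: "p \<in> U \<Longrightarrow> u \<in> tangent_space A p \<Longrightarrow> v \<in> tangent_space A p \<Longrightarrow> vcoord u = vcoord v \<Longrightarrow> u = v"
  using tangent_eq_pd by metis

lemma tangent_apply:
  assumes "p \<in> U" "v \<in> tangent_space A p" "smooth_at A p g"
  shows "v g = fderiv (\<lambda>z. g (xi z)) (x p) (vcoord v)"
  using fun_cong[OF tangent_eq_pd[OF assms(1,2)], of g] assms(3) by (simp add: pd_def)

lemma tangent_apply_comp:
  assumes "p \<in> U" "v \<in> tangent_space A p" "open T" "x p \<in> T" "smooth_on T h"
  shows "v (\<lambda>q. h (x q)) = fderiv h (x p) (vcoord v)"
  using fun_cong[OF tangent_eq_pd[OF assms(1,2)]] pd_comp[OF assms(1,3-)] by metis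

lemma pd_linear:
  assumes p: "p \<in> U"
  shows "pd p (a *\<^sub>R w + b *\<^sub>R w') = (\<lambda>g. a * pd p w g + b * pd p w' g)"
proof
  fix g
  show "pd p (a *\<^sub>R w + b *\<^sub>R w') g = a * pd p w g + b * pd p w' g"
  proof (cases "smooth_at A p g")
    case True
    from has_derivative_bounded_linear[OF smooth_at_has_derivative[OF this p]]
    interpret bounded_linear "fderiv (\<lambda>z. g (xi z)) (x p)" .
    show ?thesis using True by (simp add: pd_def add scaleR)
  qed (simp add: pd_def)
qed

text \<open>A covector is linear only on actual tangent vectors, so linearity is used for
  \<open>\<lambda>w. \<alpha> (pd p w)\<close>, where every argument is one.\<close>

lemma cotangent_apply:
  assumes p: "p \<in> U" and \<alpha>: "\<alpha> \<in> cotangent_space A p" and v: "v \<in> tangent_space A p"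
  shows "\<alpha> v = ccoord p \<alpha> \<bullet> vcoord v"
proof -
  have lin: "\<alpha> (pd p (a *\<^sub>R w + b *\<^sub>R w')) = a * \<alpha> (pd p w) + b * \<alpha> (pd p w')" for a b w w'
    unfolding pd_linear[OF p] by (rule cotangent_linear[OF \<alpha> pd_tangent[OF p] pd_tangent[OF p]])
  have "linear (\<lambda>w. \<alpha> (pd p w))"
  proof (rule linearI)
    show "\<alpha> (pd p (w + w')) = \<alpha> (pd p w) + \<alpha> (pd p w')" for w w' using lin[of 1 w 1 w'] by simp
    show "\<alpha> (pd p (a *\<^sub>R w)) = a *\<^sub>R \<alpha> (pd p w)" for a w using lin[of a w 0 w] by simp
  qed
  then interpret linear "\<lambda>w. \<alpha> (pd p w)" .
  have "\<alpha> (pd p (\<Sum>b\<in>Basis. (vcoord v \<bullet> b) *\<^sub>R b)) = (\<Sum>b\<in>Basis. (vcoord v \<bullet> b) * \<alpha> (pd p b))"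
    by (simp add: sum scale)
  also have "\<dots> = ccoord p \<alpha> \<bullet> vcoord v"
    by (subst (2) euclidean_inner) (simp add: ccoord_inner mult.commute)
  finally show ?thesis by (simp add: euclidean_representation flip: tangent_eq_pd[OF p v])
qed

lemma vector_field_coord_smooth:
  assumes X: "vector_field A V X" and V: "open V" "V \<subseteq> U"
  shows "smooth_on (x ` V) (vec_rep X)"
proof (rule smooth_on_euclidean[OF open_image[OF V]])
  fix b :: 'e assume b: "b \<in> Basis"
  have "smooth_fun A V (\<lambda>q. x q \<bullet> b)"
    using smooth_at_coord V by (subst smooth_fun_iff_at[OF atlas]) auto
  then have "smooth_fun A V (\<lambda>q. X q (\<lambda>q. x q \<bullet> b))"
    using V by (intro vector_field_smooth_fun[OF X]) auto
  then show "smooth_on (x ` V) (\<lambda>z. vcoord (X (xi z)) \<bullet> b)"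
    using V by (simp add: smooth_fun_iff vcoord_inner[OF b])
qed

text \<open>Fields with constant coordinates serve as test fields for one-forms and as the local
  extensions behind \<open>extension\<close>.\<close>

lemma pd_vector_field: "vector_field A U (\<lambda>q. pd q w)"
  unfolding vector_field_def
proof (intro conjI ballI allI impI; (elim conjE)?)
  fix V g assume V: "open V" "V \<subseteq> U" and g: "smooth_fun A V g"
  have op: "open (x ` V)" by (rule open_image[OF V])
  have g': "smooth_on (x ` V) (\<lambda>z. g (xi z))" using g V by (simp add: smooth_fun_iff)
  have "smooth_on (x ` V) (\<lambda>z. fderiv (\<lambda>z. g (xi z)) z w)"
    by (rule smooth_on_frechet_derivative[OF op g' smooth_on_bounded_linear[OF bounded_linear_ident] smooth_on_const]) auto
  then have "smooth_on (x ` V) (\<lambda>z. pd (xi z) w g)"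
  proof (rule smooth_on_cong[OF op, rotated])
    fix z assume "z \<in> x ` V"
    then have "xi z \<in> V" "x (xi z) = z" using V xi_mem x_xi by auto
    then show "fderiv (\<lambda>z. g (xi z)) z w = pd (xi z) w g"
      using smooth_fun_imp_at[OF g V(1)] by (simp add: pd_def)
  qed
  then show "smooth_fun A V (\<lambda>q. pd q w g)" using V by (simp add: smooth_fun_iff)
qed (rule pd_tangent)

lemma one_form_coord_smooth:
  assumes \<alpha>: "one_form A V \<alpha>" and V: "open V" "V \<subseteq> U"
  shows "smooth_on (x ` V) (form_rep \<alpha>)"
proof (rule smooth_on_euclidean[OF open_image[OF V]])
  fix b :: 'e assume b: "b \<in> Basis"
  have "smooth_fun A V (\<lambda>q. \<alpha> q (pd q b))"
    using V by (intro one_form_smooth_fun[OF \<alpha>] vector_field_subset[OF pd_vector_field]) auto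
  then show "smooth_on (x ` V) (\<lambda>z. ccoord (xi z) (\<alpha> (xi z)) \<bullet> b)"
    using V by (simp add: smooth_fun_iff ccoord_inner[OF b])
qed

text \<open>The coordinates of the bracket are its values on the coordinate functions, and
  \<open>X\<close> applied to a component of \<open>Y\<close> is a directional derivative of
  \<open>vec_rep Y\<close>.\<close>

lemma lie_bracket_coord:
  assumes V: "open V" "V \<subseteq> U" "p \<in> V" and X: "vector_field A V X" and Y: "vector_field A V Y"
  shows "vcoord (lie_bracket A X Y p) =
    fderiv (vec_rep Y) (x p) (vcoord (X p)) -
    fderiv (vec_rep X) (x p) (vcoord (Y p))"
proof (rule euclidean_eqI)
  fix b :: 'e assume b: "b \<in> Basis"
  have p: "p \<in> U" using V by auto
  have key: "X p (\<lambda>q. Y q (\<lambda>q. x q \<bullet> b)) = fderiv (vec_rep Y) (x p) (vcoord (X p)) \<bullet> b"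
    if X: "vector_field A V X" and Y: "vector_field A V Y" for X Y
  proof -
    have Ys: "smooth_on (x ` V) (vec_rep Y)" by (rule vector_field_coord_smooth[OF Y V(1,2)])
    have xp: "x p \<in> x ` V" using V by auto
    have "X p (\<lambda>q. Y q (\<lambda>q. x q \<bullet> b)) = X p (\<lambda>q. vcoord (Y (xi (x q))) \<bullet> b)"
      using V by (intro tangent_cong[OF atlas vector_field_tangent[OF X V(3)] V(1,3)]) (auto simp: vcoord_inner[OF b] subset_iff)
    also have "\<dots> = fderiv (\<lambda>z. vcoord (Y (xi z)) \<bullet> b) (x p) (vcoord (X p))"
      by (rule tangent_apply_comp[OF p vector_field_tangent[OF X V(3)] open_image[OF V(1,2)] xp
            smooth_on_linear_comp[OF bounded_linear_inner_left open_image[OF V(1,2)] Ys]])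
    also have "\<dots> = fderiv (vec_rep Y) (x p) (vcoord (X p)) \<bullet> b"
      using frechet_derivative_at[OF bounded_linear.has_derivative[OF bounded_linear_inner_left[of b] smooth_on_has_derivative[OF Ys xp]], symmetric]
      by simp
    finally show ?thesis .
  qed
  show "vcoord (lie_bracket A X Y p) \<bullet> b =
    (fderiv (vec_rep Y) (x p) (vcoord (X p)) -
    fderiv (vec_rep X) (x p) (vcoord (Y p))) \<bullet> b"
    using smooth_at_coord[OF p, of b] by (simp add: vcoord_inner[OF b] lie_bracket_def inner_diff_left key[OF X Y] key[OF Y X])
qed

end

text \<open>All that is ever used about the chosen extension; existence is shown by the field with
  constant coordinates.\<close>

lemma extension_local:
  fixes A :: "('m::{t2_space,second_countable_topology}, 'e::euclidean_space) chart set"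
  assumes atlas: "smooth_atlas A" and v: "v \<in> tangent_space A p"
  obtains V where "open V" "p \<in> V" "vector_field A V (extension A p v)" "extension A p v p = v"
proof -
  obtain U x where c: "(U, x) \<in> A" "p \<in> U" using smooth_atlas_cover[OF atlas] by blast
  interpret smooth_chart A U x by (rule smooth_chartI[OF atlas c(1)])
  have "\<exists>V. open V \<and> p \<in> V \<and> vector_field A V (\<lambda>q. pd q (vcoord v)) \<and> pd p (vcoord v) = v"
    using open_U c(2) pd_vector_field tangent_eq_pd[OF c(2) v] by metis
  then have "\<exists>V. open V \<and> p \<in> V \<and> vector_field A V (extension A p v) \<and> extension A p v p = v"
    unfolding extension_def
    by (rule someI[where P = "\<lambda>Z. \<exists>V. open V \<and> p \<in> V \<and> vector_field A V Z \<and> Z p = v"])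
  then show ?thesis using that by blast
qed

text \<open>The invariant formula becomes \<open>Y (Z f) - Z (Y f) - [Y, Z] f\<close>, which is zero
  by the definition of the bracket. The extensions are vector fields near \<open>p\<close> only, so
  \<open>df (Z)\<close> is replaced by \<open>Z f\<close> by way of germs.\<close>

lemma exterior_derivative_differential:
  fixes A :: "('m::{t2_space,second_countable_topology}, 'e::euclidean_space) chart set"
  assumes atlas: "smooth_atlas A" and f: "smooth_at A p f"
  shows "exterior_derivative A (differential A f) p u v = 0"
proof (cases "u \<in> tangent_space A p \<and> v \<in> tangent_space A p")
  case True
  define Y where "Y = extension A p u"
  define Z where "Z = extension A p v"
  obtain V where V: "open V" "p \<in> V" "vector_field A V Y"
    using extension_local[OF atlas, of u p] True unfolding Y_def by metis
  obtain V' where V': "open V'" "p \<in> V'" "vector_field A V' Z"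
    using extension_local[OF atlas, of v p] True unfolding Z_def by metis
  have "Y p (\<lambda>q. differential A f q (Z q)) = Y p (\<lambda>q. Z q f)"
    by (rule tangent_cong[OF atlas vector_field_tangent[OF V(3,2)] V'(1,2)])
       (use vector_field_tangent[OF V'(3)] in \<open>simp add: differential_def\<close>)
  moreover have "Z p (\<lambda>q. differential A f q (Y q)) = Z p (\<lambda>q. Y q f)"
    by (rule tangent_cong[OF atlas vector_field_tangent[OF V'(3,2)] V(1,2)])
       (use vector_field_tangent[OF V(3)] in \<open>simp add: differential_def\<close>)
  moreover have "lie_bracket A Y Z p \<in> tangent_space A p"
    using V V' by (intro lie_bracket_tangent[OF atlas, of "V \<inter> V'"] vector_field_subset[OF V(3)] vector_field_subset[OF V'(3)]) auto
  then have "differential A f p (lie_bracket A Y Z p) = Y p (\<lambda>q. Z q f) - Z p (\<lambda>q. Y q f)"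
    using f by (simp add: differential_def lie_bracket_def)
  ultimately show ?thesis by (simp add: exterior_derivative_def Let_def Y_def Z_def)
qed (auto simp: exterior_derivative_def)

text \<open>The derivative of the coordinates of the extension \<open>Z\<close> along
  \<open>X\<close> occurs in both terms of the invariant formula and cancels; this is the
  tensoriality that makes the choice of \<open>Z\<close> immaterial.\<close>

lemma (in smooth_chart) lie_derivative_coord:
  assumes V: "open V" "V \<subseteq> U" "p \<in> V" and X: "vector_field A V X" and \<beta>: "one_form A V \<beta>"
    and v: "v \<in> tangent_space A p"
  shows "lie_derivative A X \<beta> p v =
    fderiv (form_rep \<beta>) (x p) (vcoord (X p)) \<bullet> vcoord v +
    ccoord p (\<beta> p) \<bullet> fderiv (vec_rep X) (x p) (vcoord v)"
proof -
  define Z where "Z = extension A p v"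
  obtain V' where V': "open V'" "p \<in> V'" "vector_field A V' Z" "Z p = v"
    using extension_local[OF atlas v] unfolding Z_def by metis
  define N where "N = V \<inter> V'"
  have N: "open N" "N \<subseteq> U" "p \<in> N" using V V' by (auto simp: N_def)
  have p: "p \<in> U" using V by auto
  have XN: "vector_field A N X" and ZN: "vector_field A N Z" and \<beta>N: "one_form A N \<beta>"
    using vector_field_subset[OF X] vector_field_subset[OF V'(3)] one_form_subset[OF \<beta>] by (auto simp: N_def)
  define B where "B z = ccoord (xi z) (\<beta> (xi z))" for z
  define C where "C z = vcoord (Z (xi z))" for z
  have Bs: "smooth_on (x ` N) B" unfolding B_def by (rule one_form_coord_smooth[OF \<beta>N N(1,2)])
  have Cs: "smooth_on (x ` N) C" unfolding C_def by (rule vector_field_coord_smooth[OF ZN N(1,2)])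
  have xp: "x p \<in> x ` N" using N by auto
  note Xp = vector_field_tangent[OF X V(3)]
  have "X p (\<lambda>q. \<beta> q (Z q)) = X p (\<lambda>q. B (x q) \<bullet> C (x q))"
  proof (rule tangent_cong[OF atlas Xp N(1,3)])
    fix q assume q: "q \<in> N"
    then have "q \<in> U" using N by auto
    with q show "\<beta> q (Z q) = B (x q) \<bullet> C (x q)"
      using cotangent_apply[OF _ one_form_cotangent[OF \<beta>N q] vector_field_tangent[OF ZN q]] by (simp add: B_def C_def)
  qed
  also have "\<dots> = fderiv (\<lambda>z. B z \<bullet> C z) (x p) (vcoord (X p))"
    by (rule tangent_apply_comp[OF p Xp open_image[OF N(1,2)] xp smooth_on_inner[OF open_image[OF N(1,2)] Bs Cs]])
  also have "\<dots> = B (x p) \<bullet> fderiv C (x p) (vcoord (X p)) +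
      fderiv B (x p) (vcoord (X p)) \<bullet> C (x p)"
    using frechet_derivative_at[OF has_derivative_inner[OF smooth_on_has_derivative[OF Bs xp] smooth_on_has_derivative[OF Cs xp]], symmetric]
    by simp
  finally have 1: "X p (\<lambda>q. \<beta> q (Z q)) = B (x p) \<bullet> fderiv C (x p) (vcoord (X p)) +
      fderiv B (x p) (vcoord (X p)) \<bullet> C (x p)" .
  have "\<beta> p (lie_bracket A X Z p) = ccoord p (\<beta> p) \<bullet> vcoord (lie_bracket A X Z p)"
    by (rule cotangent_apply[OF p one_form_cotangent[OF \<beta> V(3)] lie_bracket_tangent[OF atlas N(1,3) XN ZN]])
  also have "vcoord (lie_bracket A X Z p) = fderiv C (x p) (vcoord (X p)) -
      fderiv (vec_rep X) (x p) (vcoord v)"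
    using lie_bracket_coord[OF N XN ZN] V'(4) by (simp add: C_def[abs_def])
  finally have 2: "\<beta> p (lie_bracket A X Z p) = ccoord p (\<beta> p) \<bullet> (fderiv C (x p) (vcoord (X p)) -
      fderiv (vec_rep X) (x p) (vcoord v))" .
  have "B (x p) = ccoord p (\<beta> p)" "C (x p) = vcoord v" using p V'(4) by (simp_all add: B_def C_def)
  then show ?thesis
    using v 1 2 by (simp add: lie_derivative_def Let_def flip: Z_def) (simp add: inner_diff_right B_def[abs_def])
qed

subsection \<open>Integral curves and flows\<close>

text \<open>The step condition is symmetric in \<open>u\<close> and \<open>u'\<close>, so the truth
  value of \<open>P\<close> is locally constant, and \<open>K\<close> is connected. Used for
  uniqueness of integral curves, for smoothness of the flow and for invariance of
  \<open>D\<close>.\<close>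

lemma open_interval_induction:
  fixes K :: "real set"
  assumes K: "open K" "is_interval K" and st: "s \<in> K" "t \<in> K" "P s"
    and step: "\<And>a. a \<in> K \<Longrightarrow> \<exists>e>0. \<forall>u\<in>K \<inter> ball a e. \<forall>u'\<in>K \<inter> ball a e. P u \<longrightarrow> P u'"
  shows "P t"
proof (rule connected_induction_simple[of K s t P])
  show "connected K" using K(2) is_interval_connected by blast
  fix a assume a: "a \<in> K"
  with step obtain e where "e > 0" "\<forall>u\<in>K \<inter> ball a e. \<forall>u'\<in>K \<inter> ball a e. P u \<longrightarrow> P u'" by blast
  then show "\<exists>T. openin (top_of_set K) T \<and> a \<in> T \<and> (\<forall>x\<in>T. \<forall>y\<in>T. P x \<longrightarrow> P y)"
    using a by (intro exI[of _ "K \<inter> ball a e"]) (auto simp: openin_open)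
qed (use st in auto)

lemma open_contains_ballE:
  fixes S :: "'a::metric_space set"
  assumes "open S" "a \<in> S"
  obtains e where "e > 0" "ball a e \<subseteq> S"
  using assms open_contains_ball by blast

lemma integral_curveD:
  assumes "integral_curve A W X J \<gamma>"
  shows "open J" "is_interval J" "continuous_on J \<gamma>" "\<gamma> ` J \<subseteq> W" "t \<in> J \<Longrightarrow> \<gamma> t \<in> W"
  using assms unfolding integral_curve_def by blast+

lemma integral_curveI:
  assumes "open J" "is_interval J" "continuous_on J \<gamma>" "\<And>t. t \<in> J \<Longrightarrow> \<gamma> t \<in> W"
    "\<And>t g. t \<in> J \<Longrightarrow> smooth_at A (\<gamma> t) g \<Longrightarrow> ((\<lambda>s. g (\<gamma> s)) has_real_derivative X (\<gamma> t) g) (at t)"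
  shows "integral_curve A W X J \<gamma>"
  using assms unfolding integral_curve_def by blast

lemma integral_curve_has_derivative:
  "integral_curve A W X J \<gamma> \<Longrightarrow> t \<in> J \<Longrightarrow> smooth_at A (\<gamma> t) g \<Longrightarrow>
    ((\<lambda>s. g (\<gamma> s)) has_real_derivative X (\<gamma> t) g) (at t)"
  by (simp add: integral_curve_def)

lemma integral_curve_open_preimage:
  assumes "integral_curve A W X J \<gamma>" "open V"
  shows "open {s \<in> J. \<gamma> s \<in> V}"
  using continuous_open_preimage[OF integral_curveD(3,1)[OF assms(1)] assms(2)] by (simp add: vimage_def Int_def)

lemma integral_curve_cong:
  assumes \<gamma>: "integral_curve A W X J \<gamma>" and eq: "\<And>t. t \<in> J \<Longrightarrow> \<gamma> t = \<gamma>' t"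
  shows "integral_curve A W X J \<gamma>'"
proof (rule integral_curveI)
  show J: "open J" and "is_interval J" by (rule integral_curveD[OF \<gamma>])+
  show "continuous_on J \<gamma>'" using integral_curveD(3)[OF \<gamma>] eq by (simp cong: continuous_on_cong)
  show "\<gamma>' t \<in> W" if "t \<in> J" for t using integral_curveD(5)[OF \<gamma> that] eq[OF that] by simp
  fix t g assume t: "t \<in> J" and g: "smooth_at A (\<gamma>' t) g"
  have "((\<lambda>s. g (\<gamma> s)) has_real_derivative X (\<gamma>' t) g) (at t)"
    using integral_curve_has_derivative[OF \<gamma> t, of g] g unfolding eq[OF t] by blast
  then show "((\<lambda>s. g (\<gamma>' s)) has_real_derivative X (\<gamma>' t) g) (at t)"
    by (rule has_field_derivative_transform_within_open[OF _ J t]) (simp add: eq)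
qed

lemma integral_curve_glue:
  assumes 1: "integral_curve A W X J \<gamma>" and 2: "integral_curve A W X J' \<gamma>"
    and "J \<inter> J' \<noteq> {}"
  shows "integral_curve A W X (J \<union> J') \<gamma>"
proof (rule integral_curveI)
  note d1 = integral_curveD[OF 1] and d2 = integral_curveD[OF 2]
  show "open (J \<union> J')" using d1(1) d2(1) by auto
  show "is_interval (J \<union> J')"
    using connected_Un[of J J'] d1(2) d2(2) assms(3) by (simp add: is_interval_connected_1)
  show "continuous_on (J \<union> J') \<gamma>"
    by (rule continuous_on_open_Un[OF d1(1) d2(1) d1(3) d2(3)])
  show "\<gamma> t \<in> W" if "t \<in> J \<union> J'" for t using that d1(5) d2(5) by blast
  show "((\<lambda>s. g (\<gamma> s)) has_real_derivative X (\<gamma> t) g) (at t)" if "t \<in> J \<union> J'" "smooth_at A (\<gamma> t) g" for t g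
    using that integral_curve_has_derivative[OF 1] integral_curve_has_derivative[OF 2] by blast
qed

text \<open>Holds because \<open>X\<close> does not depend on time; this is the source of the flow
  law.\<close>

lemma integral_curve_shift:
  assumes \<gamma>: "integral_curve A W X J \<gamma>"
  shows "integral_curve A W X {s. s + t \<in> J} (\<lambda>s. \<gamma> (s + t))"
proof (rule integral_curveI)
  note d = integral_curveD[OF \<gamma>]
  have c: "continuous_on UNIV (\<lambda>s::real. s + t)" by (intro continuous_intros)
  show "open {s. s + t \<in> J}" using open_vimage[OF d(1) c] by (simp add: vimage_def)
  have "y + t \<in> J" if "a + t \<in> J" "b + t \<in> J" "a \<le> y" "y \<le> b" for a b y
    using mem_is_interval_1_I[OF d(2) that(1,2), of "y + t"] that by simp
  then show "is_interval {s. s + t \<in> J}" unfolding is_interval_1 by blast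
  show "continuous_on {s. s + t \<in> J} (\<lambda>s. \<gamma> (s + t))"
    by (rule continuous_on_compose2[OF d(3) continuous_on_subset[OF c]]) auto
  show "\<gamma> (s + t) \<in> W" if "s \<in> {s. s + t \<in> J}" for s using d(5) that by simp
  fix s g assume "s \<in> {s. s + t \<in> J}" "smooth_at A (\<gamma> (s + t)) g"
  then show "((\<lambda>s. g (\<gamma> (s + t))) has_real_derivative X (\<gamma> (s + t)) g) (at s)"
    using integral_curve_has_derivative[OF \<gamma>, of "s + t" g] DERIV_shift[of "\<lambda>s. g (\<gamma> s)" "X (\<gamma> (s + t)) g" s t] by simp
qed

context smooth_chart
begin

lemma integral_curve_coord:
  assumes \<gamma>: "integral_curve A W X J \<gamma>" and t: "t \<in> J" "\<gamma> t \<in> U"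
  shows "((\<lambda>s. x (\<gamma> s)) has_vector_derivative vcoord (X (\<gamma> t))) (at t)"
  unfolding has_vector_derivative_def
proof (rule iffD2[OF has_derivative_componentwise_within], rule ballI)
  fix b :: 'e assume b: "b \<in> Basis"
  have "((\<lambda>s. x (\<gamma> s) \<bullet> b) has_real_derivative X (\<gamma> t) (\<lambda>q. x q \<bullet> b)) (at t)"
    by (rule integral_curve_has_derivative[OF \<gamma> t(1) smooth_at_coord[OF t(2)]])
  then show "((\<lambda>s. x (\<gamma> s) \<bullet> b) has_derivative (\<lambda>h. (h *\<^sub>R vcoord (X (\<gamma> t))) \<bullet> b)) (at t)"
    by (simp add: vcoord_inner[OF b] has_field_derivative_def mult.commute[of _ "X (\<gamma> t) _"])
qed

text \<open>Converse of \<open>integral_curve_coord\<close>: the chain rule and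
  \<open>tangent_apply\<close> recover the derivative of every smooth \<open>g\<close> along the
  curve from the derivative of the coordinates.\<close>

lemma integral_curve_chartI:
  assumes X: "vector_field A W X" and J: "open J" "is_interval J"
    and c: "\<And>t. t \<in> J \<Longrightarrow> c t \<in> x ` (U \<inter> W)"
    and c': "\<And>t. t \<in> J \<Longrightarrow> (c has_vector_derivative vcoord (X (xi (c t)))) (at t)"
  shows "integral_curve A W X J (\<lambda>t. xi (c t))"
proof (rule integral_curveI[OF J])
  have "continuous_on J c"
    using c' has_vector_derivative_continuous continuous_at_imp_continuous_on by blast
  then show "continuous_on J (\<lambda>t. xi (c t))"
    using c by (intro continuous_on_compose2[OF continuous_xi]) auto
  show "xi (c t) \<in> W" if "t \<in> J" for t using c[OF that] by auto
  fix t g assume t: "t \<in> J" and g: "smooth_at A (xi (c t)) g"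
  have cU: "xi (c t) \<in> U" "xi (c t) \<in> W" "x (xi (c t)) = c t" using c[OF t] by auto
  have "((\<lambda>z. g (xi z)) has_derivative fderiv (\<lambda>z. g (xi z)) (c t)) (at (c t))"
    using smooth_at_has_derivative[OF g cU(1)] by (simp add: cU(3))
  from has_derivative_compose[OF c'[OF t, unfolded has_vector_derivative_def] this]
  have "((\<lambda>s. g (xi (c s))) has_derivative (\<lambda>h. fderiv (\<lambda>z. g (xi z)) (c t) (h *\<^sub>R vcoord (X (xi (c t)))))) (at t)" .
  moreover have "fderiv (\<lambda>z. g (xi z)) (c t) (h *\<^sub>R vcoord (X (xi (c t)))) = X (xi (c t)) g * h" for h
  proof -
    interpret bounded_linear "fderiv (\<lambda>z. g (xi z)) (x (xi (c t)))"
      by (rule has_derivative_bounded_linear[OF smooth_at_has_derivative[OF g cU(1)]])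
    show ?thesis
      using tangent_apply[OF cU(1) vector_field_tangent[OF X cU(2)] g] scaleR[of h "vcoord (X (xi (c t)))"]
      by (simp add: cU(3))
  qed
  ultimately show "((\<lambda>s. g (xi (c s))) has_real_derivative X (xi (c t)) g) (at t)"
    by (simp add: has_field_derivative_def)
qed

end

text \<open>Near a time at which the curves differ, the Hausdorff property keeps them apart. Near a
  time at which they agree, both run in one chart, where the field is Lipschitz and Gronwall applies
  to the difference of the coordinates.\<close>

lemma integral_curve_unique:
  fixes A :: "('m::{t2_space,second_countable_topology}, 'e::euclidean_space) chart set"
  assumes atlas: "smooth_atlas A" and W: "open W" and X: "vector_field A W X"
    and 1: "integral_curve A W X J \<gamma>" and 2: "integral_curve A W X J' \<gamma>'"
    and s: "s \<in> J" "s \<in> J'" "\<gamma> s = \<gamma>' s" and t: "t \<in> J" "t \<in> J'"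
  shows "\<gamma> t = \<gamma>' t"
proof (rule open_interval_induction[of "J \<inter> J'" s t "\<lambda>t. \<gamma> t = \<gamma>' t"])
  note d1 = integral_curveD[OF 1] and d2 = integral_curveD[OF 2]
  show "open (J \<inter> J')" using d1(1) d2(1) by auto
  show "is_interval (J \<inter> J')" using d1(2) d2(2) by (rule is_interval_Int)
  fix a assume a: "a \<in> J \<inter> J'"
  show "\<exists>e>0. \<forall>u\<in>J \<inter> J' \<inter> ball a e. \<forall>u'\<in>J \<inter> J' \<inter> ball a e. \<gamma> u = \<gamma>' u \<longrightarrow> \<gamma> u' = \<gamma>' u'"
  proof (cases "\<gamma> a = \<gamma>' a")
    case False
    then obtain V V' where V: "open V" "open V'" "\<gamma> a \<in> V" "\<gamma>' a \<in> V'" "V \<inter> V' = {}"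
      using hausdorff by metis
    have "open ({s \<in> J. \<gamma> s \<in> V} \<inter> {s \<in> J'. \<gamma>' s \<in> V'})"
      by (intro open_Int integral_curve_open_preimage[OF 1] integral_curve_open_preimage[OF 2] V)
    moreover have "a \<in> {s \<in> J. \<gamma> s \<in> V} \<inter> {s \<in> J'. \<gamma>' s \<in> V'}" using a V by auto
    ultimately obtain e where e: "e > 0" "ball a e \<subseteq> {s \<in> J. \<gamma> s \<in> V} \<inter> {s \<in> J'. \<gamma>' s \<in> V'}"
      by (rule open_contains_ballE)
    have "\<gamma> u \<noteq> \<gamma>' u" if "u \<in> ball a e" for u
    proof -
      have "\<gamma> u \<in> V" "\<gamma>' u \<in> V'" using e(2) that by auto
      then show ?thesis using V(5) by auto
    qed
    then show ?thesis using e(1) by (intro exI[of _ e]) simp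
  next
    case True
    obtain U x where c: "(U, x) \<in> A" "\<gamma> a \<in> U" using smooth_atlas_cover[OF atlas] by blast
    interpret smooth_chart A U x by (rule smooth_chartI[OF atlas c(1)])
    have W': "open (U \<inter> W)" "U \<inter> W \<subseteq> U" using open_U W by auto
    define F where "F z = vcoord (X (xi z))" for z
    have F: "smooth_on (x ` (U \<inter> W)) F"
      unfolding F_def by (rule vector_field_coord_smooth[OF vector_field_subset[OF X] W']) auto
    have aW: "\<gamma> a \<in> U \<inter> W" using a c(2) d1(5) by auto
    obtain r L where r: "r > 0" "L > 0" "cball (x (\<gamma> a)) r \<subseteq> x ` (U \<inter> W)"
      and lip: "\<And>z z'. z \<in> cball (x (\<gamma> a)) r \<Longrightarrow> z' \<in> cball (x (\<gamma> a)) r \<Longrightarrow> norm (F z - F z') \<le> L * norm (z - z')"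
      using smooth_on_locally_lipschitz[OF F open_image[OF W'], of "x (\<gamma> a)"] aW by blast
    define V where "V = {q \<in> U. x q \<in> ball (x (\<gamma> a)) r}"
    have V: "open V" "\<gamma> a \<in> V" "\<gamma>' a \<in> V" unfolding V_def using open_preimage[OF open_ball] c(2) r(1) True by auto
    have "open ({s \<in> J. \<gamma> s \<in> V} \<inter> {s \<in> J'. \<gamma>' s \<in> V})"
      by (intro open_Int integral_curve_open_preimage[OF 1] integral_curve_open_preimage[OF 2] V)
    moreover have "a \<in> {s \<in> J. \<gamma> s \<in> V} \<inter> {s \<in> J'. \<gamma>' s \<in> V}" using a V by auto
    ultimately obtain e where e: "e > 0" "ball a e \<subseteq> {s \<in> J. \<gamma> s \<in> V} \<inter> {s \<in> J'. \<gamma>' s \<in> V}"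
      by (rule open_contains_ballE)
    have key: "\<gamma> u' = \<gamma>' u'" if u: "u \<in> ball a e" "u' \<in> ball a e" "\<gamma> u = \<gamma>' u" for u u'
    proof -
      have b: "ball a e = {a - e<..<a + e}" by (auto simp: dist_real_def)
      have "x (\<gamma> u') - x (\<gamma>' u') = 0"
      proof (rule gronwall_zero[of "a - e" "a + e" "\<lambda>u. x (\<gamma> u) - x (\<gamma>' u)" "\<lambda>u. vcoord (X (\<gamma> u)) - vcoord (X (\<gamma>' u))" L u u'])
        fix v assume "v \<in> {a - e<..<a + e}"
        then have v: "v \<in> J" "\<gamma> v \<in> V" "v \<in> J'" "\<gamma>' v \<in> V" using e(2) b by auto
        then have vU: "\<gamma> v \<in> U" "\<gamma>' v \<in> U" by (auto simp: V_def)
        show "((\<lambda>u. x (\<gamma> u) - x (\<gamma>' u)) has_vector_derivative vcoord (X (\<gamma> v)) - vcoord (X (\<gamma>' v))) (at v)"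
          by (intro has_vector_derivative_diff integral_curve_coord[OF 1] integral_curve_coord[OF 2] v vU)
        show "norm (vcoord (X (\<gamma> v)) - vcoord (X (\<gamma>' v))) \<le> L * norm (x (\<gamma> v) - x (\<gamma>' v))"
          using lip[of "x (\<gamma> v)" "x (\<gamma>' v)"] v vU by (simp add: F_def V_def)
      qed (use u b in auto)
      moreover have "\<gamma> u' \<in> U" "\<gamma>' u' \<in> U" using u e by (auto simp: V_def)
      ultimately show ?thesis by (metis eq_iff_diff_eq_0 xi_x)
    qed
    show ?thesis
    proof (intro exI[of _ e] conjI ballI impI e(1))
      fix u u' assume "u \<in> J \<inter> J' \<inter> ball a e" "u' \<in> J \<inter> J' \<inter> ball a e" and "\<gamma> u = \<gamma>' u"
      then show "\<gamma> u' = \<gamma>' u'" by (intro key[of u u']) blast+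
    qed
  qed
qed (use s t in auto)

section \<open>The flow: group law and smoothness\<close>

locale flow =
  fixes A :: "('m::{t2_space,second_countable_topology}, 'e::euclidean_space) chart set"
    and W :: "'m set" and X :: "'m \<Rightarrow> 'm vec" and J :: "'m \<Rightarrow> real set" and \<phi> :: "real \<Rightarrow> 'm \<Rightarrow> 'm"
  assumes atlas: "smooth_atlas A" and W: "open W" and X: "vector_field A W X"
    and is_flow: "is_flow A W X J \<phi>"
begin

lemma zero_in: "p \<in> W \<Longrightarrow> 0 \<in> J p"
  and flow_zero: "p \<in> W \<Longrightarrow> \<phi> 0 p = p"
  and flow_curve: "p \<in> W \<Longrightarrow> integral_curve A W X (J p) (\<lambda>t. \<phi> t p)"
  using is_flow by (auto simp: is_flow_def)

lemma flow_maximal: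
  "p \<in> W \<Longrightarrow> integral_curve A W X J' \<gamma> \<Longrightarrow> J p \<subseteq> J' \<Longrightarrow> (\<And>t. t \<in> J p \<Longrightarrow> \<gamma> t = \<phi> t p) \<Longrightarrow> J' = J p"
  using is_flow unfolding is_flow_def by metis

lemma flow_in: "p \<in> W \<Longrightarrow> t \<in> J p \<Longrightarrow> \<phi> t p \<in> W"
  using integral_curveD(5)[OF flow_curve] .

text \<open>An integral curve through \<open>p\<close> agrees with the flow line by uniqueness and
  can be glued to it; maximality of the flow line then forces its interval into
  \<open>J p\<close>.\<close>

lemma flow_extends:
  assumes p: "p \<in> W" and \<gamma>: "integral_curve A W X J' \<gamma>" and s: "0 \<in> J'" "\<gamma> 0 = p"
  shows "t \<in> J' \<Longrightarrow> t \<in> J p" and "t \<in> J' \<Longrightarrow> \<phi> t p = \<gamma> t"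
proof -
  have eq: "\<phi> t p = \<gamma> t" if "t \<in> J p" "t \<in> J'" for t
    using integral_curve_unique[OF atlas W X flow_curve[OF p] \<gamma> zero_in[OF p] s(1) _ that] s(2) flow_zero[OF p] by simp
  define \<gamma>' where "\<gamma>' t = (if t \<in> J p then \<phi> t p else \<gamma> t)" for t
  have "integral_curve A W X (J p) \<gamma>'"
    by (rule integral_curve_cong[OF flow_curve[OF p]]) (simp add: \<gamma>'_def)
  moreover have "integral_curve A W X J' \<gamma>'"
    by (rule integral_curve_cong[OF \<gamma>]) (simp add: \<gamma>'_def eq)
  ultimately have "integral_curve A W X (J p \<union> J') \<gamma>'"
    using zero_in[OF p] s(1) by (intro integral_curve_glue) auto
  from flow_maximal[OF p this] have "J p \<union> J' = J p" by (simp add: \<gamma>'_def)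
  then show "t \<in> J' \<Longrightarrow> t \<in> J p" by blast
  then show "t \<in> J' \<Longrightarrow> \<phi> t p = \<gamma> t" using eq by blast
qed

text \<open>The shifted flow line is an integral curve through \<open>\<phi> t p\<close>, so
  \<open>flow_extends\<close> identifies it with the flow line of that point.\<close>

lemma flow_shift:
  assumes p: "p \<in> W" and t: "t \<in> J p" and st: "s + t \<in> J p"
  shows "s \<in> J (\<phi> t p)" and "\<phi> s (\<phi> t p) = \<phi> (s + t) p"
  using flow_extends[OF flow_in[OF p t] integral_curve_shift[OF flow_curve[OF p], of t], of s] t st by auto

lemma flow_inverse:
  assumes p: "p \<in> W" and t: "t \<in> J p"
  shows "- t \<in> J (\<phi> t p)" and "\<phi> (- t) (\<phi> t p) = p"
  using flow_shift[OF p t, of "- t"] zero_in[OF p] flow_zero[OF p] by auto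

text \<open>\<open>flow_shift\<close> used backwards: from \<open>\<phi> t p\<close> with the shift
  \<open>- t\<close>, which leads back to \<open>p\<close>.\<close>

lemma flow_add:
  assumes p: "p \<in> W" and t: "t \<in> J p" and s: "s \<in> J (\<phi> t p)"
  shows "s + t \<in> J p" and "\<phi> (s + t) p = \<phi> s (\<phi> t p)"
  using flow_shift[OF flow_in[OF p t] flow_inverse(1)[OF p t], of "s + t"] flow_inverse(2)[OF p t] s by auto

end

text \<open>Smoothness is tested on functions rather than in charts: composition is then immediate,
  and it is the property that \<open>tangent_map\<close> relies on. Continuity is listed separately
  to have open preimages.\<close>

definition smooth_map_on ::
  "('m::topological_space, 'e::euclidean_space) chart set \<Rightarrow> 'm set \<Rightarrow> ('m \<Rightarrow> 'm) \<Rightarrow> bool" where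
  "smooth_map_on A N F \<longleftrightarrow> open N \<and> continuous_on N F \<and>
     (\<forall>q\<in>N. \<forall>g. smooth_at A (F q) g \<longrightarrow> smooth_at A q (\<lambda>r. g (F r)))"

lemma smooth_map_onD:
  assumes "smooth_map_on A N F"
  shows "open N" "continuous_on N F" "q \<in> N \<Longrightarrow> smooth_at A (F q) g \<Longrightarrow> smooth_at A q (\<lambda>r. g (F r))"
  using assms by (auto simp: smooth_map_on_def)

lemma smooth_map_on_preimage: "smooth_map_on A N F \<Longrightarrow> open V \<Longrightarrow> open {q \<in> N. F q \<in> V}"
  using continuous_open_preimage[of N F V] by (simp add: smooth_map_on_def vimage_def Int_def)

lemma smooth_map_on_compose:
  assumes F: "smooth_map_on A N F" and G: "smooth_map_on A N' G"
  shows "smooth_map_on A {q \<in> N. F q \<in> N'} (\<lambda>q. G (F q))"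
  unfolding smooth_map_on_def
proof (intro conjI ballI allI impI)
  show "open {q \<in> N. F q \<in> N'}" by (rule smooth_map_on_preimage[OF F smooth_map_onD(1)[OF G]])
  show "continuous_on {q \<in> N. F q \<in> N'} (\<lambda>q. G (F q))"
    by (rule continuous_on_compose2[OF smooth_map_onD(2)[OF G] continuous_on_subset[OF smooth_map_onD(2)[OF F]]]) auto
  fix q g assume "q \<in> {q \<in> N. F q \<in> N'}" "smooth_at A (G (F q)) g"
  then show "smooth_at A q (\<lambda>r. g (G (F r)))"
    using smooth_map_onD(3)[OF F, of q "\<lambda>r. g (G r)"] smooth_map_onD(3)[OF G] by auto
qed

lemma smooth_map_on_cong:
  fixes A :: "('m::{t2_space,second_countable_topology}, 'e::euclidean_space) chart set"
  assumes atlas: "smooth_atlas A" and F: "smooth_map_on A N F" and eq: "\<And>q. q \<in> N \<Longrightarrow> F q = G q"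
  shows "smooth_map_on A N G"
  unfolding smooth_map_on_def
proof (intro conjI ballI allI impI)
  show N: "open N" by (rule smooth_map_onD(1)[OF F])
  show "continuous_on N G" using smooth_map_onD(2)[OF F] eq by (simp cong: continuous_on_cong)
  fix q g assume q: "q \<in> N" and g: "smooth_at A (G q) g"
  show "smooth_at A q (\<lambda>r. g (G r))"
    by (rule smooth_at_cong[OF atlas N q _ smooth_map_onD(3)[OF F q]]) (use eq q g in auto)
qed

text \<open>The content is that the case distinctions in \<open>tangent_map\<close> match: a
  function smooth at \<open>G (F q)\<close> has a pullback that is smooth at
  \<open>F q\<close>.\<close>

lemma tangent_map_compose:
  assumes "smooth_map_on A N' G" "F q \<in> N'"
  shows "tangent_map A (\<lambda>q. G (F q)) q v = tangent_map A G (F q) (tangent_map A F q v)"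
  using smooth_map_onD(3)[OF assms] by (auto simp: tangent_map_def o_def fun_eq_iff)

lemma tangent_map_cong:
  fixes A :: "('m::{t2_space,second_countable_topology}, 'e::euclidean_space) chart set"
  assumes atlas: "smooth_atlas A" and v: "v \<in> tangent_space A q" and V: "open V" "q \<in> V"
    and eq: "\<And>r. r \<in> V \<Longrightarrow> F r = G r"
  shows "tangent_map A F q v = tangent_map A G q v"
proof
  fix g
  have "v (g \<circ> F) = v (g \<circ> G)" by (rule tangent_cong[OF atlas v V]) (simp add: eq)
  then show "tangent_map A F q v g = tangent_map A G q v g" using eq[OF V(2)] by (simp add: tangent_map_def)
qed

lemma tangent_map_linear:
  "tangent_map A F q (\<lambda>g. a * u g + b * v g) = (\<lambda>g. a * tangent_map A F q u g + b * tangent_map A F q v g)"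
  by (simp add: tangent_map_def fun_eq_iff)

locale flow_chart = flow A W X J \<phi> + smooth_chart A U x
  for A :: "('m::{t2_space,second_countable_topology}, 'e::euclidean_space) chart set"
    and W X J \<phi> U x
begin

definition field where "field z = vcoord (X (xi z))"

lemma W_chart: "open (U \<inter> W)" "U \<inter> W \<subseteq> U"
  using open_U W by auto

lemma field_smooth: "smooth_on (x ` (U \<inter> W)) field"
  unfolding field_def by (rule vector_field_coord_smooth[OF vector_field_subset[OF X] W_chart]) auto

text \<open>A coordinate solution is an integral curve, so \<open>flow_extends\<close> puts its time
  interval into \<open>J q\<close> and identifies it with the flow line. The gain is one time
  interval for all \<open>q\<close> near \<open>q0\<close>.\<close>

lemma flow_in_chart:
  assumes q0: "q0 \<in> U \<inter> W"
  obtains \<epsilon> r \<psi> where "r > 0" "local_flow_on field (x ` (U \<inter> W)) \<epsilon> (ball (x q0) r) \<psi>"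
    "\<And>q. q \<in> U \<Longrightarrow> x q \<in> ball (x q0) r \<Longrightarrow> q \<in> W"
    "\<And>t q. t \<in> {-\<epsilon><..<\<epsilon>} \<Longrightarrow> q \<in> U \<Longrightarrow> x q \<in> ball (x q0) r \<Longrightarrow> t \<in> J q"
    "\<And>t q. t \<in> {-\<epsilon><..<\<epsilon>} \<Longrightarrow> q \<in> U \<Longrightarrow> x q \<in> ball (x q0) r \<Longrightarrow> \<phi> t q = xi (\<psi> (t, x q))"
proof -
  have xq0: "x q0 \<in> x ` (U \<inter> W)" using q0 by auto
  obtain \<epsilon> r \<psi> where r: "r > 0" and flow: "local_flow_on field (x ` (U \<inter> W)) \<epsilon> (ball (x q0) r) \<psi>"
    by (rule local_flow[OF field_smooth open_image[OF W_chart] xq0])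
  note \<psi> = local_flow_onD[OF flow]
  \<comment> \<open>Membership in \<open>W\<close> is read off at time 0: there
    \<open>\<psi>\<close> is the identity, and its values lie in the image of
    \<open>U \<inter> W\<close>.\<close>
  have qW: "q \<in> W" if "q \<in> U" "x q \<in> ball (x q0) r" for q
  proof -
    have "x q \<in> x ` (U \<inter> W)" using \<psi>(4)[of 0 "x q"] \<psi>(3)[OF that(2)] \<psi>(1) that(2) by simp
    then show ?thesis using that(1) by (metis Int_iff W_chart(2) xi_mem xi_x)
  qed
  have curve: "integral_curve A W X {-\<epsilon><..<\<epsilon>} (\<lambda>t. xi (\<psi> (t, x q)))" if "q \<in> U" "x q \<in> ball (x q0) r" for q
    using \<psi>(4)[OF _ that(2)] \<psi>(5)[OF _ that(2)] by (intro integral_curve_chartI X) (auto simp: field_def is_interval_oo)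
  show ?thesis
  proof (rule that[OF r flow qW])
    fix t q assume t: "t \<in> {-\<epsilon><..<\<epsilon>}" and q: "q \<in> U" "x q \<in> ball (x q0) r"
    show "t \<in> J q" "\<phi> t q = xi (\<psi> (t, x q))"
      using flow_extends[OF qW[OF q] curve[OF q], of t] t q \<psi>(1,3) by auto
  qed
qed

end

lemma flow_chartI: "flow A W X J \<phi> \<Longrightarrow> (U, x) \<in> A \<Longrightarrow> flow_chart A W X J \<phi> U x"
  by (simp add: flow_chart_def smooth_chart_def flow_def)

context flow
begin

lemma flow_locally_smooth:
  assumes q0: "q0 \<in> W"
  shows "\<exists>\<epsilon> N. \<epsilon> > 0 \<and> open N \<and> q0 \<in> N \<and> N \<subseteq> W \<and>
    (\<forall>t\<in>{-\<epsilon><..<\<epsilon>}. (\<forall>q\<in>N. t \<in> J q) \<and> smooth_map_on A N (\<phi> t))"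
proof -
  obtain U x where c: "(U, x) \<in> A" "q0 \<in> U" using smooth_atlas_cover[OF atlas] by blast
  interpret flow_chart A W X J \<phi> U x by (rule flow_chartI[OF flow_axioms c(1)])
  have "q0 \<in> U \<inter> W" using c q0 by auto
  then obtain \<epsilon> r \<psi> where r: "r > 0" and flow: "local_flow_on field (x ` (U \<inter> W)) \<epsilon> (ball (x q0) r) \<psi>"
    and NW': "\<And>q. q \<in> U \<Longrightarrow> x q \<in> ball (x q0) r \<Longrightarrow> q \<in> W"
    and NJ: "\<And>t q. t \<in> {-\<epsilon><..<\<epsilon>} \<Longrightarrow> q \<in> U \<Longrightarrow> x q \<in> ball (x q0) r \<Longrightarrow> t \<in> J q"
    and \<phi>\<psi>: "\<And>t q. t \<in> {-\<epsilon><..<\<epsilon>} \<Longrightarrow> q \<in> U \<Longrightarrow> x q \<in> ball (x q0) r \<Longrightarrow> \<phi> t q = xi (\<psi> (t, x q))"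
    by (rule flow_in_chart) blast
  note \<psi> = local_flow_onD[OF flow]
  define N where "N = {q \<in> U. x q \<in> ball (x q0) r}"
  have N: "open N" "q0 \<in> N" using open_preimage[OF open_ball] c r by (auto simp: N_def)
  have NW: "N \<subseteq> W" using NW' by (auto simp: N_def)
  have "smooth_map_on A N (\<phi> t)" if t: "t \<in> {-\<epsilon><..<\<epsilon>}" for t
  proof (rule smooth_map_on_cong[OF atlas])
    have \<psi>t: "smooth_on (ball (x q0) r) (\<lambda>y. \<psi> (t, y))"
      by (rule smooth_on_compose[OF open_ball \<psi>(2)
            smooth_on_Pair[OF open_ball smooth_on_const smooth_on_bounded_linear[OF bounded_linear_ident]]])
         (use t in auto)
    have \<psi>U: "\<psi> (t, x q) \<in> x ` U" if "q \<in> N" for q using \<psi>(4)[OF t, of "x q"] that by (auto simp: N_def)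
    show "smooth_map_on A N (\<lambda>q. xi (\<psi> (t, x q)))"
      unfolding smooth_map_on_def
    proof (intro conjI ballI allI impI N)
      show "continuous_on N (\<lambda>q. xi (\<psi> (t, x q)))"
        using \<psi>U
        by (intro continuous_on_compose2[OF continuous_xi] continuous_on_compose2[OF smooth_on_continuous_on[OF \<psi>t]]
            continuous_on_subset[OF continuous_x]) (auto simp: N_def)
      fix q g assume q: "q \<in> N" and g: "smooth_at A (xi (\<psi> (t, x q))) g"
      obtain T where T: "open T" "\<psi> (t, x q) \<in> T" "smooth_on T (\<lambda>z. g (xi z))"
        using g \<psi>U[OF q] xi_in[OF \<psi>U[OF q]] by (auto simp: smooth_at_iff)
      define T' where "T' = {z \<in> ball (x q0) r. \<psi> (t, z) \<in> T}"
      have T': "open T'" unfolding T'_def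
        using continuous_open_preimage[OF smooth_on_continuous_on[OF \<psi>t] open_ball T(1)] by (simp add: vimage_def Int_def)
      have "smooth_on T' (\<lambda>z. g (xi (\<psi> (t, z))))"
        by (rule smooth_on_compose[OF T' T(3) smooth_on_subset[OF \<psi>t]]) (auto simp: T'_def)
      then show "smooth_at A q (\<lambda>r. g (xi (\<psi> (t, x r))))"
        by (intro smooth_at_comp_chart[OF _ T']) (use q T in \<open>auto simp: T'_def N_def\<close>)
    qed
  qed (use \<phi>\<psi>[OF t] in \<open>auto simp: N_def\<close>)
  moreover have "t \<in> J q" if "t \<in> {-\<epsilon><..<\<epsilon>}" "q \<in> N" for t q using NJ that by (auto simp: N_def)
  ultimately show ?thesis using \<psi>(1) N NW by blast
qed

text \<open>Smoothness for short times near \<open>\<phi> a p\<close> is transported by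
  \<open>\<phi> u' = \<phi> (u' - u) \<circ> \<phi> u\<close>, which holds on a whole neighbourhood
  of \<open>p\<close>.\<close>

lemma flow_smooth:
  assumes p: "p \<in> W" and t: "t \<in> J p"
  obtains N where "open N" "p \<in> N" "N \<subseteq> W" "\<And>q. q \<in> N \<Longrightarrow> t \<in> J q" "smooth_map_on A N (\<phi> t)"
proof -
  define P where "P t \<longleftrightarrow> (\<exists>N. open N \<and> p \<in> N \<and> N \<subseteq> W \<and> (\<forall>q\<in>N. t \<in> J q) \<and> smooth_map_on A N (\<phi> t))" for t
  have "P t"
  proof (rule open_interval_induction[of "J p" 0 t])
    show "open (J p)" "is_interval (J p)" using integral_curveD[OF flow_curve[OF p]] by blast+
    show "0 \<in> J p" by (rule zero_in[OF p])
    show "t \<in> J p" by (rule t)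
    obtain \<epsilon> N where "\<epsilon> > 0" "open N" "p \<in> N" "N \<subseteq> W"
      "\<forall>t\<in>{-\<epsilon><..<\<epsilon>}. (\<forall>q\<in>N. t \<in> J q) \<and> smooth_map_on A N (\<phi> t)"
      using flow_locally_smooth[OF p] by blast
    then show "P 0" unfolding P_def by (intro exI[of _ N]) auto
    fix a assume a: "a \<in> J p"
    obtain \<epsilon> N where N: "\<epsilon> > 0" "open N" "\<phi> a p \<in> N" "N \<subseteq> W"
      and loc: "\<And>t q. t \<in> {-\<epsilon><..<\<epsilon>} \<Longrightarrow> q \<in> N \<Longrightarrow> t \<in> J q" "\<And>t. t \<in> {-\<epsilon><..<\<epsilon>} \<Longrightarrow> smooth_map_on A N (\<phi> t)"
      using flow_locally_smooth[OF flow_in[OF p a]] by blast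
    have "open {s \<in> J p. \<phi> s p \<in> N}" by (rule integral_curve_open_preimage[OF flow_curve[OF p] N(2)])
    moreover have "a \<in> {s \<in> J p. \<phi> s p \<in> N}" using a N by auto
    ultimately obtain e where e: "e > 0" "ball a e \<subseteq> {s \<in> J p. \<phi> s p \<in> N}"
      by (rule open_contains_ballE)
    \<comment> \<open>Half of \<open>\<epsilon>\<close>, since \<open>u\<close> and
      \<open>u'\<close> may lie on opposite sides of \<open>a\<close>.\<close>
    define e' where "e' = min e (\<epsilon> / 2)"
    have "P u'" if u: "u \<in> ball a e'" "u' \<in> ball a e'" and Pu: "P u" for u u'
    proof -
      have h: "u' - u \<in> {-\<epsilon><..<\<epsilon>}" using u by (auto simp: e'_def dist_real_def abs_if split: if_splits)
      obtain M where M: "open M" "p \<in> M" "M \<subseteq> W" "\<And>q. q \<in> M \<Longrightarrow> u \<in> J q" "smooth_map_on A M (\<phi> u)"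
        using Pu unfolding P_def by blast
      define M' where "M' = {q \<in> M. \<phi> u q \<in> N}"
      have "\<phi> u p \<in> N" using u e by (auto simp: e'_def)
      moreover have "open M'" unfolding M'_def by (rule smooth_map_on_preimage[OF M(5) N(2)])
      moreover have M'J: "u' \<in> J q" "\<phi> (u' - u) (\<phi> u q) = \<phi> u' q" if "q \<in> M'" for q
        using flow_add[of q u "u' - u"] that M(3,4) loc(1)[OF h] by (auto simp: M'_def)
      moreover have "smooth_map_on A M' (\<phi> u')"
        unfolding M'_def
        by (rule smooth_map_on_cong[OF atlas smooth_map_on_compose[OF M(5) loc(2)[OF h]]])
           (use M'J(2) in \<open>auto simp: M'_def\<close>)
      ultimately show ?thesis unfolding P_def using M by (intro exI[of _ M']) (auto simp: M'_def)
    qed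
    moreover have "e' > 0" using e N by (simp add: e'_def)
    ultimately show "\<exists>e>0. \<forall>u\<in>J p \<inter> ball a e. \<forall>u'\<in>J p \<inter> ball a e. P u \<longrightarrow> P u'" by blast
  qed
  then show ?thesis using that unfolding P_def by blast
qed

end

subsection \<open>Invariance of the Dirac structure\<close>

text \<open>With functionals \<open>l i\<close> dual to the vectors at \<open>z0\<close>, each
  \<open>c i\<close> equals \<open>l i v\<close> up to an error; the errors add up to at most
  \<open>m z\<close> times the sum of all \<open>\<bar>c j\<bar>\<close>. Where
  \<open>m z < 1/2\<close> they are absorbed into the left-hand side, whence the 2 in
  \<open>K\<close>.\<close>

lemma bounded_frame_coefficients:
  fixes \<kappa> :: "nat \<Rightarrow> 'z::metric_space \<Rightarrow> 'a::euclidean_space"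
  assumes cont: "\<And>j. j < r \<Longrightarrow> isCont (\<kappa> j) z0"
    and ind: "\<And>c. (\<Sum>j<r. c j *\<^sub>R \<kappa> j z0) = 0 \<Longrightarrow> \<forall>j<r. c j = 0"
  obtains T K where "open T" "z0 \<in> T" "K \<ge> 0"
    "\<And>z c. z \<in> T \<Longrightarrow> (\<Sum>j<r. \<bar>c j\<bar>) \<le> K * norm (\<Sum>j<r. c j *\<^sub>R \<kappa> j z)"
proof -
  have inj: "inj_on (\<lambda>j. \<kappa> j z0) {..<r}"
  proof (rule inj_onI, rule ccontr)
    fix i j assume ij: "i \<in> {..<r}" "j \<in> {..<r}" "\<kappa> i z0 = \<kappa> j z0" "i \<noteq> j"
    \<comment> \<open>The coefficients of the relation
      \<open>\<kappa> i z0 - \<kappa> j z0 = 0\<close>, which is nontrivial because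
      \<open>i \<noteq> j\<close>.\<close>
    define c where "c k = (if k = i then 1 else 0) - (if k = j then 1 else (0::real))" for k
    have "(\<Sum>k<r. c k *\<^sub>R \<kappa> k z0) = (\<Sum>k<r. if k = i then \<kappa> k z0 else 0) - (\<Sum>k<r. if k = j then \<kappa> k z0 else 0)"
      unfolding sum_subtractf[symmetric] by (rule sum.cong) (auto simp: c_def)
    also have "\<dots> = 0" using ij by (simp add: sum.delta)
    finally have "c i = 0" using ind ij(1) by blast
    then show False using ij(4) by (simp add: c_def)
  qed
  have "independent ((\<lambda>j. \<kappa> j z0) ` {..<r})"
  proof (rule independent_if_scalars_zero)
    fix g v assume "(\<Sum>v\<in>(\<lambda>j. \<kappa> j z0) ` {..<r}. g v *\<^sub>R v) = 0" and v: "v \<in> (\<lambda>j. \<kappa> j z0) ` {..<r}"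
    then have "(\<Sum>j<r. g (\<kappa> j z0) *\<^sub>R \<kappa> j z0) = 0" by (simp add: sum.reindex[OF inj])
    from ind[OF this] show "g v = 0" using v by auto
  qed simp
  then have "\<exists>l. linear l \<and> (\<forall>v\<in>(\<lambda>j. \<kappa> j z0) ` {..<r}. l v = (if v = \<kappa> i z0 then 1 else (0::real)))" for i
    by (rule linear_independent_extend)
  then obtain l where l: "\<And>i. linear (l i)"
    and l': "\<And>i j. j < r \<Longrightarrow> l i (\<kappa> j z0) = (if \<kappa> j z0 = \<kappa> i z0 then 1 else (0::real))"
    by (metis imageI lessThan_iff)
  have lij: "l i (\<kappa> j z0) = (if j = i then 1 else 0)" if "i < r" "j < r" for i j
    using l'[OF that(2), of i] inj_onD[OF inj, of j i] that by auto
  have bl: "bounded_linear (l i)" for i using l by (simp add: linear_conv_bounded_linear)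
  define m where "m z = (\<Sum>i<r. \<Sum>j<r. \<bar>l i (\<kappa> j z - \<kappa> j z0)\<bar>)" for z
  have "isCont m z0"
    unfolding m_def by (intro continuous_intros bounded_linear.continuous[OF bl] cont) auto
  moreover have "m z0 \<in> {..<1/2}" using l by (simp add: m_def linear_0)
  ultimately obtain T where T: "open T" "z0 \<in> T" "\<And>z. z \<in> T \<Longrightarrow> m z < 1/2"
    unfolding continuous_at_open by (metis lessThan_iff open_lessThan)
  define K where "K = 2 * (\<Sum>i<r. onorm (l i))"
  have K: "K \<ge> 0" unfolding K_def by (intro mult_nonneg_nonneg sum_nonneg onorm_pos_le bl) simp
  show ?thesis
  proof (rule that[OF T(1,2) K])
    fix z and c :: "nat \<Rightarrow> real" assume z: "z \<in> T"
    define v where "v = (\<Sum>j<r. c j *\<^sub>R \<kappa> j z)"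
    define s where "s = (\<Sum>j<r. \<bar>c j\<bar>)"
    have cs: "\<bar>c j\<bar> \<le> s" if "j < r" for j
      unfolding s_def using that by (intro member_le_sum) auto
    have s0: "s \<ge> 0" by (simp add: s_def sum_nonneg)
    have one: "\<bar>c i\<bar> \<le> onorm (l i) * norm v + (\<Sum>j<r. s * \<bar>l i (\<kappa> j z - \<kappa> j z0)\<bar>)" if i: "i < r" for i
    proof -
      interpret linear "l i" by (rule l)
      have "l i v = (\<Sum>j<r. c j * l i (\<kappa> j z))" by (simp add: v_def sum scale)
      also have "\<dots> = (\<Sum>j<r. (if j = i then c j else 0) + c j * l i (\<kappa> j z - \<kappa> j z0))"
        using i by (intro sum.cong) (auto simp: diff lij algebra_simps)
      also have "\<dots> = c i + (\<Sum>j<r. c j * l i (\<kappa> j z - \<kappa> j z0))"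
        using i by (simp add: sum.distrib sum.delta)
      finally have "c i = l i v - (\<Sum>j<r. c j * l i (\<kappa> j z - \<kappa> j z0))" by simp
      then have "\<bar>c i\<bar> \<le> \<bar>l i v\<bar> + \<bar>\<Sum>j<r. c j * l i (\<kappa> j z - \<kappa> j z0)\<bar>" by simp
      also have "\<bar>l i v\<bar> \<le> onorm (l i) * norm v" using onorm[OF bl, of i v] by simp
      also have "\<bar>\<Sum>j<r. c j * l i (\<kappa> j z - \<kappa> j z0)\<bar> \<le> (\<Sum>j<r. s * \<bar>l i (\<kappa> j z - \<kappa> j z0)\<bar>)"
        using cs by (intro order_trans[OF sum_abs] sum_mono) (auto simp: abs_mult intro!: mult_right_mono)
      finally show ?thesis by simp
    qed
    have "s \<le> (\<Sum>i<r. onorm (l i) * norm v + (\<Sum>j<r. s * \<bar>l i (\<kappa> j z - \<kappa> j z0)\<bar>))"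
      unfolding s_def[of] using one by (intro sum_mono) (auto simp: s_def)
    also have "\<dots> = (\<Sum>i<r. onorm (l i)) * norm v + s * m z"
      by (simp add: sum.distrib sum_distrib_right sum_distrib_left m_def)
    also have "s * m z \<le> s * (1/2)" using T(3)[OF z] s0 by (intro mult_left_mono) auto
    finally have "s \<le> (\<Sum>i<r. onorm (l i)) * norm v + s * (1/2)" by simp
    then show "(\<Sum>j<r. \<bar>c j\<bar>) \<le> K * norm (\<Sum>j<r. c j *\<^sub>R \<kappa> j z)"
      by (simp add: K_def flip: s_def v_def)
  qed
qed

text \<open>The left-hand sides are the coordinates of the Lie bracket \<open>[F, Y i]\<close> and of the Lie derivative \<open>\<pounds>\<^sub>F (B i)\<close>.\<close>

definition bracket_coefficients ::
  "real \<Rightarrow> nat \<Rightarrow> ('e::euclidean_space \<Rightarrow> 'e) \<Rightarrow> (nat \<Rightarrow> 'e \<Rightarrow> 'e) \<Rightarrow> (nat \<Rightarrow> 'e \<Rightarrow> 'e) \<Rightarrow> nat \<Rightarrow> 'e \<Rightarrow> bool" where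
  "bracket_coefficients C r F Y B i z \<longleftrightarrow> (\<exists>c. (\<forall>j<r. \<bar>c j\<bar> \<le> C) \<and>
     fderiv (Y i) z (F z) - fderiv F z (Y i z) = (\<Sum>j<r. c j *\<^sub>R Y j z) \<and>
     (\<forall>w. fderiv (B i) z (F z) \<bullet> w + B i z \<bullet> fderiv F z w
       = (\<Sum>j<r. c j * (B j z \<bullet> w))))"

text \<open>In coordinates: with \<open>M t\<close> the derivative of the flow and \<open>P t\<close> its inverse, the pairings of the pulled back
  frame with a fixed pair \<open>(v, \<eta>)\<close> solve a linear system, since brackets of the flow field with the frame are
  combinations of the frame.\<close>

lemma pairing_along_flow:
  fixes \<psi> :: "real \<times> 'e::euclidean_space \<Rightarrow> 'e" and F :: "'e \<Rightarrow> 'e" and Y B :: "nat \<Rightarrow> 'e \<Rightarrow> 'e" and v \<eta> :: 'e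
  assumes flow: "local_flow_on F S \<epsilon> O1 \<psi>" and O1: "open O1" "y \<in> O1" and \<delta>: "0 < \<delta>" "\<delta> \<le> \<epsilon>"
    and O2: "open O2" "O2 \<subseteq> O1" "\<And>t. t \<in> {-\<delta><..<\<delta>} \<Longrightarrow> \<psi> (t, y) \<in> O2"
    and inv: "\<And>t. t \<in> {-\<delta><..<\<delta>} \<Longrightarrow> \<exists>N. open N \<and> y \<in> N \<and> N \<subseteq> O1 \<and> (\<forall>y'\<in>N. \<psi> (- t, \<psi> (t, y')) = y')"
    and F: "smooth_on O2 F" and Y: "\<And>i. i < r \<Longrightarrow> smooth_on O2 (Y i)" and B: "\<And>i. i < r \<Longrightarrow> smooth_on O2 (B i)"
    and C: "C \<ge> 0" and coef: "\<And>z i. z \<in> O2 \<Longrightarrow> i < r \<Longrightarrow> bracket_coefficients C r F Y B i z"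
    and zero: "\<And>i. i < r \<Longrightarrow> \<eta> \<bullet> Y i y + B i y \<bullet> v = 0"
    and t: "t \<in> {-\<delta><..<\<delta>}" and i: "i < r"
  shows "\<eta> \<bullet> fderiv \<psi> (- t, \<psi> (t, y)) (0, Y i (\<psi> (t, y)))
    + B i (\<psi> (t, y)) \<bullet> fderiv \<psi> (t, y) (0, v) = 0"
proof -
  note \<psi> = local_flow_onD(2)[OF flow] and init = local_flow_onD(3)[OF flow]
  define I where "I = {-\<delta><..<\<delta>}"
  define c where "c t = \<psi> (t, y)" for t
  define M where "M t u = fderiv \<psi> (t, y) (0, u)" for t u
  define P where "P t u = fderiv \<psi> (- t, c t) (0, u)" for t u
  have \<psi>': "(\<psi> has_derivative fderiv \<psi> (s, z)) (at (s, z))" if "s \<in> {-\<epsilon><..<\<epsilon>}" "z \<in> O1" for s z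
    using that by (intro smooth_on_has_derivative[OF \<psi>]) auto
  have sp: "((\<lambda>z. \<psi> (s, z)) has_derivative (\<lambda>u. fderiv \<psi> (s, z) (0, u))) (at z)"
    if "s \<in> {-\<epsilon><..<\<epsilon>}" "z \<in> O1" for s z
    by (rule has_derivative_compose[of "\<lambda>z. (s, z)" "\<lambda>u. (0, u)" z UNIV \<psi>])
       (use \<psi>'[OF that] in \<open>auto intro!: derivative_intros\<close>)
  have I\<epsilon>: "t \<in> {-\<epsilon><..<\<epsilon>}" "- t \<in> {-\<epsilon><..<\<epsilon>}" if "t \<in> I" for t using that \<delta> by (auto simp: I_def)
  have cO: "c t \<in> O2" "c t \<in> O1" if "t \<in> I" for t using O2(2) O2(3)[of t] that by (auto simp: c_def I_def)
  have Mlin: "bounded_linear (M t)" if "t \<in> I" for t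
    unfolding M_def by (rule has_derivative_bounded_linear[OF sp[OF I\<epsilon>(1)[OF that] O1(2)]])
  have Plin: "bounded_linear (P t)" if "t \<in> I" for t
    unfolding P_def by (rule has_derivative_bounded_linear[OF sp[OF I\<epsilon>(2)[OF that] cO(2)[OF that]]])
  \<comment> \<open>Differentiate \<open>\<psi> (- t, \<psi> (t, y')) = y'\<close> at
    \<open>y\<close>; this needs the identity on a neighbourhood, which is what \<open>inv\<close>
    provides.\<close>
  have PM: "P t (M t u) = u" if t: "t \<in> I" for t u
  proof -
    obtain N where N: "open N" "y \<in> N" "\<And>y'. y' \<in> N \<Longrightarrow> \<psi> (- t, \<psi> (t, y')) = y'"
      using inv[of t] t unfolding I_def by blast
    have "((\<lambda>y'. \<psi> (- t, \<psi> (t, y'))) has_derivative (\<lambda>u. P t (M t u))) (at y)"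
      unfolding P_def M_def c_def
      by (rule has_derivative_compose[OF sp[OF I\<epsilon>(1)[OF t] O1(2)] sp[OF I\<epsilon>(2)[OF t] cO(2)[OF t, unfolded c_def]]])
    then have "((\<lambda>y'. y') has_derivative (\<lambda>u. P t (M t u))) (at y)"
      by (rule has_derivative_transform_within_open[OF _ N(1,2)]) (rule N(3))
    from fun_cong[OF has_derivative_unique[OF this has_derivative_ident]] show ?thesis .
  qed
  \<comment> \<open>In finite dimension a left inverse is also a right inverse.\<close>
  have MP: "M t (P t u) = u" if t: "t \<in> I" for t u
  proof -
    have "linear (M t)" "linear (P t)" using Mlin[OF t] Plin[OF t] by (simp_all add: bounded_linear.linear)
    moreover have "P t \<circ> M t = id" using PM[OF t] by auto
    ultimately have "M t \<circ> P t = id" using linear_inverse_left by blast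
    then show ?thesis by (metis comp_apply id_apply)
  qed
  have Iop: "open I" by (simp add: I_def)
  have cs: "smooth_on I c"
    unfolding c_def
    by (rule smooth_on_compose[OF Iop \<psi> smooth_on_Pair[OF Iop smooth_on_bounded_linear[OF bounded_linear_ident] smooth_on_const]])
       (use I\<epsilon> O1 in auto)
  have c': "(c has_vector_derivative F (c t)) (at t)" if "t \<in> I" for t
    using local_flow_onD(5)[OF flow I\<epsilon>(1)[OF that] O1(2)] by (simp add: c_def[abs_def])
  have chain: "((\<lambda>t. G (c t)) has_vector_derivative fderiv G (c t) (F (c t))) (at t)"
    if G: "smooth_on O2 G" and t: "t \<in> I" for G :: "'e \<Rightarrow> 'e" and t
  proof -
    have G': "(G has_derivative fderiv G (c t)) (at (c t))"
      by (rule smooth_on_has_derivative[OF G cO(1)[OF t]])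
    interpret bounded_linear "fderiv G (c t)" by (rule has_derivative_bounded_linear[OF G'])
    show ?thesis
      using has_derivative_compose[OF c'[OF t, unfolded has_vector_derivative_def] G']
      by (simp add: has_vector_derivative_def scaleR)
  qed
  define DF where "DF t = fderiv F (c t)" for t
  have DFlin: "bounded_linear (DF t)" if "t \<in> I" for t
    unfolding DF_def by (rule has_derivative_bounded_linear[OF smooth_on_has_derivative[OF F cO(1)[OF that]]])
  have M': "((\<lambda>t. M t u) has_vector_derivative DF t (M t u)) (at t)" if "t \<in> I" for t u
    using local_flow_onD(6)[OF flow I\<epsilon>(1)[OF that] O1(2)] by (simp add: M_def DF_def c_def)
  define Z where "Z i t = P t (Y i (c t))" for i t
  define LB where "LB i t = fderiv (Y i) (c t) (F (c t)) - DF t (Y i (c t))" for i t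
  \<comment> \<open>The variational equation is known for \<open>M\<close>, not for its inverse
    \<open>P\<close>. So \<open>Z i\<close> is first shown to be differentiable, and its derivative
    is then solved from the time derivative of \<open>M t (Z i t) = Y i (c t)\<close>.\<close>
  have Z': "(Z i has_vector_derivative P t (LB i t)) (at t)" if t: "t \<in> I" and i: "i < r" for i t
  proof -
    have "smooth_on I (Z i)"
      unfolding Z_def P_def
      by (rule smooth_on_frechet_derivative[OF Iop \<psi>
          smooth_on_Pair[OF Iop smooth_on_bounded_linear[OF bounded_linear_minus[OF bounded_linear_ident]] cs]
          smooth_on_Pair[OF Iop smooth_on_const smooth_on_compose[OF Iop Y[OF i] cs]]])
         (use I\<epsilon> cO in auto)
    then have "Z i differentiable (at t)" using t by (rule smooth_on_differentiable)
    then obtain z' where z': "(Z i has_vector_derivative z') (at t)" using vector_derivative_works by blast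
    \<comment> \<open>\<open>M'\<close> covers a fixed argument \<open>u\<close> only; the expansion
      over \<open>Basis\<close> handles the moving argument \<open>Z i t\<close>.\<close>
    have "((\<lambda>t. \<Sum>b\<in>Basis. (Z i t \<bullet> b) *\<^sub>R M t b) has_vector_derivative
        (\<Sum>b\<in>Basis. (Z i t \<bullet> b) *\<^sub>R DF t (M t b) + (z' \<bullet> b) *\<^sub>R M t b)) (at t)"
      by (intro has_vector_derivative_sum bounded_bilinear.has_vector_derivative[OF bounded_bilinear_scaleR] M' t
          bounded_linear.has_vector_derivative[OF bounded_linear_inner_left z'])
    moreover have expand: "M s u = (\<Sum>b\<in>Basis. (u \<bullet> b) *\<^sub>R M s b)" if "s \<in> I" for s u
    proof -
      interpret bounded_linear "M s" by (rule Mlin[OF that])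
      have "M s (\<Sum>b\<in>Basis. (u \<bullet> b) *\<^sub>R b) = (\<Sum>b\<in>Basis. (u \<bullet> b) *\<^sub>R M s b)" by (simp add: sum scaleR)
      then show ?thesis by (simp add: euclidean_representation)
    qed
    moreover have "(\<Sum>b\<in>Basis. (Z i t \<bullet> b) *\<^sub>R DF t (M t b) + (z' \<bullet> b) *\<^sub>R M t b) = DF t (M t (Z i t)) + M t z'"
    proof -
      interpret bounded_linear "DF t" by (rule DFlin[OF t])
      show ?thesis by (subst (2 3) expand[OF t]) (simp add: sum.distrib sum scaleR)
    qed
    ultimately have "((\<lambda>t. \<Sum>b\<in>Basis. (Z i t \<bullet> b) *\<^sub>R M t b) has_vector_derivative DF t (M t (Z i t)) + M t z') (at t)"
      by simp
    then have "((\<lambda>t. Y i (c t)) has_vector_derivative DF t (M t (Z i t)) + M t z') (at t)"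
      by (rule has_vector_derivative_transform_within_open[OF _ Iop t]) (simp add: expand[symmetric] Z_def MP)
    from vector_derivative_unique_at[OF this chain[OF Y[OF i] t]]
    have "DF t (M t (Z i t)) + M t z' = fderiv (Y i) (c t) (F (c t))" .
    then have "M t z' = LB i t" by (simp add: LB_def Z_def MP[OF t] algebra_simps)
    then have "z' = P t (LB i t)" using PM[OF t, of z'] by simp
    then show ?thesis using z' by simp
  qed
  define a where "a i t = \<eta> \<bullet> Z i t + B i (c t) \<bullet> M t v" for i t
  \<comment> \<open>The vector part and the covector part share the same coefficients, so the
    derivative is a combination of the \<open>a j t\<close>; of the coefficients only the bound
    \<open>C\<close> is retained.\<close>
  have a': "\<exists>a'. (a i has_real_derivative a') (at t) \<and> \<bar>a'\<bar> \<le> C * (\<Sum>j<r. \<bar>a j t\<bar>)" if t: "t \<in> I" and i: "i < r" for i t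
  proof -
    have a1: "(a i has_vector_derivative \<eta> \<bullet> P t (LB i t) + (B i (c t) \<bullet> DF t (M t v) + fderiv (B i) (c t) (F (c t)) \<bullet> M t v)) (at t)"
      unfolding a_def
      by (intro has_vector_derivative_add bounded_linear.has_vector_derivative[OF bounded_linear_inner_right Z'[OF t i]]
          bounded_bilinear.has_vector_derivative[OF bounded_bilinear_inner chain[OF B[OF i] t] M'[OF t]])
    obtain d where d: "\<forall>j<r. \<bar>d j\<bar> \<le> C" "LB i t = (\<Sum>j<r. d j *\<^sub>R Y j (c t))"
      "\<And>w. fderiv (B i) (c t) (F (c t)) \<bullet> w + B i (c t) \<bullet> DF t w = (\<Sum>j<r. d j * (B j (c t) \<bullet> w))"
      using coef[OF cO(1)[OF t] i] unfolding bracket_coefficients_def LB_def DF_def by blast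
    have "\<eta> \<bullet> P t (LB i t) = (\<Sum>j<r. d j * (\<eta> \<bullet> Z j t))"
    proof -
      interpret bounded_linear "P t" by (rule Plin[OF t])
      show ?thesis by (simp add: d(2) sum scaleR Z_def inner_sum_right)
    qed
    then have "\<eta> \<bullet> P t (LB i t) + (B i (c t) \<bullet> DF t (M t v) + fderiv (B i) (c t) (F (c t)) \<bullet> M t v)
        = (\<Sum>j<r. d j * a j t)"
      using d(3)[of "M t v"] by (simp add: a_def distrib_left sum.distrib)
    then have "(a i has_real_derivative (\<Sum>j<r. d j * a j t)) (at t)"
      using a1 by (simp add: has_real_derivative_iff_has_vector_derivative)
    moreover have "\<bar>\<Sum>j<r. d j * a j t\<bar> \<le> C * (\<Sum>j<r. \<bar>a j t\<bar>)"
      unfolding sum_distrib_left using d(1)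
      by (intro order_trans[OF sum_abs] sum_mono) (auto simp: abs_mult intro!: mult_right_mono)
    ultimately show ?thesis by blast
  qed
  then have "\<forall>i t. \<exists>d. t \<in> I \<and> i < r \<longrightarrow> (a i has_real_derivative d) (at t) \<and> \<bar>d\<bar> \<le> C * (\<Sum>j<r. \<bar>a j t\<bar>)" by blast
  then obtain d where d: "\<And>t i. t \<in> I \<Longrightarrow> i < r \<Longrightarrow> (a i has_real_derivative d i t) (at t)"
    "\<And>t i. t \<in> I \<Longrightarrow> i < r \<Longrightarrow> \<bar>d i t\<bar> \<le> C * (\<Sum>j<r. \<bar>a j t\<bar>)"
    by metis
  have 0: "0 \<in> I" using \<delta> by (simp add: I_def)
  \<comment> \<open>At time 0 both \<open>M\<close> and \<open>P\<close> are the identity, and the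
    claim is the hypothesis \<open>zero\<close>.\<close>
  have a0: "a i 0 = 0" if "i < r" for i
  proof -
    have "((\<lambda>z. z) has_derivative M 0) (at y)"
      using has_derivative_transform_within_open[OF sp[OF I\<epsilon>(1)[OF 0] O1(2)] O1, of "\<lambda>z. z"] init by (simp add: M_def[abs_def])
    then have M0: "M 0 u = u" for u using has_derivative_unique[OF _ has_derivative_ident] by metis
    then have "P 0 u = u" for u using PM[OF 0, of u] by simp
    then show ?thesis using zero[OF that] init[OF O1(2)] by (simp add: a_def Z_def M0 c_def)
  qed
  \<comment> \<open>Squares instead of absolute values keep the sum differentiable. The factor
    \<open>r\<close> in the constant comes from Cauchy-Schwarz,
    \<open>s\<^sup>2 \<le> r * (\<Sum>i<r. (a i t)\<^sup>2)\<close>.\<close>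
  have "(\<Sum>i<r. (a i t)\<^sup>2) = 0"
  proof (rule gronwall_zero[of "-\<delta>" \<delta> "\<lambda>t. \<Sum>i<r. (a i t)\<^sup>2" "\<lambda>t. \<Sum>i<r. 2 * a i t * d i t" "2 * C * r" 0 t])
    fix t assume "t \<in> {-\<delta><..<\<delta>}"
    then have t: "t \<in> I" by (simp add: I_def)
    show "((\<lambda>t. \<Sum>i<r. (a i t)\<^sup>2) has_vector_derivative (\<Sum>i<r. 2 * a i t * d i t)) (at t)"
      unfolding has_real_derivative_iff_has_vector_derivative[symmetric]
      by (intro DERIV_sum) (use d(1)[OF t] in \<open>auto intro!: derivative_eq_intros\<close>)
    define s where "s = (\<Sum>j<r. \<bar>a j t\<bar>)"
    have "norm (\<Sum>i<r. 2 * a i t * d i t) \<le> (\<Sum>i<r. 2 * \<bar>a i t\<bar> * (C * s))"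
      using d(2)[OF t] unfolding real_norm_def s_def
      by (intro order_trans[OF sum_abs] sum_mono) (auto simp: abs_mult intro!: mult_left_mono)
    also have "\<dots> = 2 * C * s\<^sup>2"
      by (simp add: s_def power2_eq_square mult_ac flip: sum_distrib_left sum_distrib_right)
    also have "s\<^sup>2 \<le> r * (\<Sum>i<r. (a i t)\<^sup>2)"
      using sum_squared_le_sum_of_squares[of "\<lambda>i. \<bar>a i t\<bar>" "{..<r}"] by (simp add: s_def mult.commute)
    finally show "norm (\<Sum>i<r. 2 * a i t * d i t) \<le> 2 * C * r * norm (\<Sum>i<r. (a i t)\<^sup>2)"
      using C by (simp add: sum_nonneg mult_left_mono mult.assoc)
  qed (use \<delta> t a0 in auto)
  then have "a i t = 0" using i by (simp add: sum_nonneg_eq_0_iff)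
  then show ?thesis by (simp add: a_def Z_def P_def M_def c_def)
qed

section \<open>Transport of vectors, covectors and sections by the flow\<close>

context
  fixes A :: "('m::{t2_space,second_countable_topology}, 'e::euclidean_space) chart set"
  assumes atlas: "smooth_atlas A"
begin

lemma tangent_map_tangent:
  assumes F: "smooth_map_on A N F" and q: "q \<in> N" and v: "v \<in> tangent_space A q"
  shows "tangent_map A F q v \<in> tangent_space A (F q)"
  using smooth_map_onD(3)[OF F q] tangent_add[OF v] tangent_mult[OF v] tangent_cmult[OF v]
  by (intro tangent_spaceI) (simp_all add: tangent_map_def o_def smooth_at_add[OF atlas] smooth_at_mult[OF atlas] smooth_at_cmult[OF atlas])

lemma tangent_lincomb:
  assumes u: "u \<in> tangent_space A p" and v: "v \<in> tangent_space A p"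
  shows "(\<lambda>g. a * u g + b * v g) \<in> tangent_space A p"
  using tangent_add[OF u] tangent_mult[OF u] tangent_cmult[OF u] tangent_nonsmooth[OF u]
    tangent_add[OF v] tangent_mult[OF v] tangent_cmult[OF v] tangent_nonsmooth[OF v]
  by (intro tangent_spaceI) (simp_all add: algebra_simps)

lemma tangent_zero: "(\<lambda>g. 0) \<in> tangent_space A p"
  by (intro tangent_spaceI) simp_all

lemma pullback_cotangent:
  assumes F: "smooth_map_on A N F" and q: "q \<in> N" and \<alpha>: "\<alpha> \<in> cotangent_space A (F q)"
  shows "(\<lambda>w. if w \<in> tangent_space A q then \<alpha> (tangent_map A F q w) else 0) \<in> cotangent_space A q"
  unfolding cotangent_space_def
  using tangent_lincomb cotangent_linear[OF \<alpha> tangent_map_tangent[OF F q] tangent_map_tangent[OF F q]]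
  by (simp add: tangent_map_linear)

end

context smooth_chart
begin

lemma vcoord_sum: "vcoord (\<lambda>g. \<Sum>i<r. a i * u i g) = (\<Sum>i<r. a i *\<^sub>R vcoord (u i))"
  by (rule euclidean_eqI) (simp add: vcoord_inner inner_sum_left)

lemma ccoord_sum: "ccoord p (\<lambda>v. \<Sum>i<r. a i * \<alpha> i v) = (\<Sum>i<r. a i *\<^sub>R ccoord p (\<alpha> i))"
  by (rule euclidean_eqI) (simp add: ccoord_inner inner_sum_left)

lemma vcoord_zero: "vcoord (\<lambda>g. 0) = 0"
  by (simp add: vcoord_def)

text \<open>Coordinates are values on the coordinate functions, and near \<open>q\<close> these pull
  back under \<open>F\<close> to the components of \<open>\<psi>\<close>.\<close>

lemma tangent_map_coord:
  assumes q: "q \<in> U" "x q \<in> S" and S: "open S" and \<psi>: "smooth_on S \<psi>"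
    and \<psi>U: "\<And>y. y \<in> S \<Longrightarrow> \<psi> y \<in> x ` U" and F: "\<And>r. r \<in> U \<Longrightarrow> x r \<in> S \<Longrightarrow> F r = xi (\<psi> (x r))"
    and v: "v \<in> tangent_space A q"
  shows "vcoord (tangent_map A F q v) = fderiv \<psi> (x q) (vcoord v)"
proof (rule euclidean_eqI)
  fix b :: 'e assume b: "b \<in> Basis"
  have FU: "F q \<in> U" using F[OF q] xi_in[OF \<psi>U[OF q(2)]] by simp
  have V: "open {r \<in> U. x r \<in> S}" "q \<in> {r \<in> U. x r \<in> S}" using q open_preimage[OF S] by auto
  have "vcoord (tangent_map A F q v) \<bullet> b = v ((\<lambda>r. x r \<bullet> b) \<circ> F)"
    using smooth_at_coord[OF FU, of b] by (simp add: vcoord_inner[OF b] tangent_map_def)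
  also have "\<dots> = v (\<lambda>r. \<psi> (x r) \<bullet> b)"
    by (rule tangent_cong[OF atlas v V]) (simp add: F x_xi[OF \<psi>U])
  also have "\<dots> = fderiv (\<lambda>y. \<psi> y \<bullet> b) (x q) (vcoord v)"
    by (rule tangent_apply_comp[OF q(1) v S q(2) smooth_on_linear_comp[OF bounded_linear_inner_left S \<psi>]])
  also have "\<dots> = fderiv \<psi> (x q) (vcoord v) \<bullet> b"
    using frechet_derivative_at[OF bounded_linear.has_derivative[OF bounded_linear_inner_left[of b] smooth_on_has_derivative[OF \<psi> q(2)]], symmetric]
    by simp
  finally show "vcoord (tangent_map A F q v) \<bullet> b = fderiv \<psi> (x q) (vcoord v) \<bullet> b" .
qed

end

context flow
begin

lemma tangent_map_flow:
  assumes "p \<in> W" "t \<in> J p" "v \<in> tangent_space A p"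
  shows "tangent_map A (\<phi> t) p v \<in> tangent_space A (\<phi> t p)"
  by (rule flow_smooth[OF assms(1,2)]) (rule tangent_map_tangent[OF atlas _ _ assms(3)])

lemma tangent_map_flow_add:
  assumes p: "p \<in> W" "t \<in> J p" "s \<in> J (\<phi> t p)" and v: "v \<in> tangent_space A p"
  shows "tangent_map A (\<phi> (s + t)) p v = tangent_map A (\<phi> s) (\<phi> t p) (tangent_map A (\<phi> t) p v)"
proof -
  obtain N where N: "open N" "p \<in> N" "N \<subseteq> W" "\<And>q. q \<in> N \<Longrightarrow> t \<in> J q" "smooth_map_on A N (\<phi> t)"
    by (rule flow_smooth[OF p(1,2)]) blast
  obtain N' where N': "open N'" "\<phi> t p \<in> N'" "\<And>q. q \<in> N' \<Longrightarrow> s \<in> J q" "smooth_map_on A N' (\<phi> s)"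
    by (rule flow_smooth[OF flow_in[OF p(1,2)] p(3)]) blast
  have "tangent_map A (\<phi> (s + t)) p v = tangent_map A (\<lambda>q. \<phi> s (\<phi> t q)) p v"
  proof (rule tangent_map_cong[OF atlas v smooth_map_on_preimage[OF N(5) N'(1)]])
    show "p \<in> {q \<in> N. \<phi> t q \<in> N'}" using N N' by auto
    fix q assume "q \<in> {q \<in> N. \<phi> t q \<in> N'}"
    then show "\<phi> (s + t) q = \<phi> s (\<phi> t q)" using N(3,4) N'(3) by (intro flow_add(2)) auto
  qed
  also have "\<dots> = tangent_map A (\<phi> s) (\<phi> t p) (tangent_map A (\<phi> t) p v)"
    by (rule tangent_map_compose[of A N' "\<phi> s" "\<phi> t" p v, OF N'(4,2)])
  finally show ?thesis .
qed

text \<open>Pullback of a single fibre element, with \<open>p\<close> the point where the result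
  lives: invariance is propagated pointwise, before any section is involved.\<close>

definition pull :: "real \<Rightarrow> 'm \<Rightarrow> 'm vec \<times> 'm covec \<Rightarrow> 'm vec \<times> 'm covec" where
  "pull t p \<sigma> = (tangent_map A (\<phi> (- t)) (\<phi> t p) (fst \<sigma>),
     \<lambda>w. if w \<in> tangent_space A p then snd \<sigma> (tangent_map A (\<phi> t) p w) else 0)"

lemma pull_mem:
  assumes p: "p \<in> W" "t \<in> J p" and \<sigma>: "\<sigma> \<in> tangent_space A (\<phi> t p) \<times> cotangent_space A (\<phi> t p)"
  shows "pull t p \<sigma> \<in> tangent_space A p \<times> cotangent_space A p"
proof -
  have "tangent_map A (\<phi> (- t)) (\<phi> t p) (fst \<sigma>) \<in> tangent_space A p"
    using tangent_map_flow[OF flow_in[OF p] flow_inverse(1)[OF p], of "fst \<sigma>"] flow_inverse(2)[OF p] \<sigma> by auto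
  moreover have "snd (pull t p \<sigma>) \<in> cotangent_space A p"
    unfolding pull_def snd_conv
    by (rule flow_smooth[OF p]) (rule pullback_cotangent[OF atlas], use \<sigma> in auto)
  ultimately show ?thesis by (simp add: pull_def)
qed

text \<open>Pullbacks compose contravariantly; in the vector part the inverse flows are composed,
  hence the time \<open>- t + - s\<close>.\<close>

lemma pull_add:
  assumes p: "p \<in> W" "t \<in> J p" "s \<in> J (\<phi> t p)" and \<sigma>: "fst \<sigma> \<in> tangent_space A (\<phi> (s + t) p)"
  shows "pull (s + t) p \<sigma> = pull t p (pull s (\<phi> t p) \<sigma>)"
proof -
  have q: "\<phi> t p \<in> W" by (rule flow_in[OF p(1,2)])
  note st = flow_add[OF p]
  have "tangent_map A (\<phi> (- t + - s)) (\<phi> (s + t) p) (fst \<sigma>) =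
      tangent_map A (\<phi> (- t)) (\<phi> (- s) (\<phi> (s + t) p)) (tangent_map A (\<phi> (- s)) (\<phi> (s + t) p) (fst \<sigma>))"
  proof (rule tangent_map_flow_add[OF _ _ _ \<sigma>])
    show "\<phi> (s + t) p \<in> W" by (rule flow_in[OF p(1) st(1)])
    show "- s \<in> J (\<phi> (s + t) p)" unfolding st(2) by (rule flow_inverse(1)[OF q p(3)])
    show "- t \<in> J (\<phi> (- s) (\<phi> (s + t) p))"
      unfolding st(2) flow_inverse(2)[OF q p(3)] by (rule flow_inverse(1)[OF p(1,2)])
  qed
  then have 1: "tangent_map A (\<phi> (- (s + t))) (\<phi> (s + t) p) (fst \<sigma>) =
      tangent_map A (\<phi> (- t)) (\<phi> t p) (tangent_map A (\<phi> (- s)) (\<phi> s (\<phi> t p)) (fst \<sigma>))"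
    by (simp add: st(2) flow_inverse(2)[OF q p(3)] add.commute)
  show ?thesis
    unfolding pull_def fst_conv snd_conv 1
    by (simp add: fun_eq_iff tangent_map_flow_add[OF p] tangent_map_flow[OF p(1,2)])
qed

text \<open>Openness does not come with \<open>is_flow\<close>; it follows from
  \<open>flow_smooth\<close>, which makes time \<open>t\<close> available on a neighbourhood of each
  point of the domain.\<close>

lemma flow_domain_open:
  assumes V: "open V"
  shows "open {p \<in> W. t \<in> J p \<and> \<phi> t p \<in> V}"
proof (rule Topological_Spaces.openI)
  fix p assume p: "p \<in> {p \<in> W. t \<in> J p \<and> \<phi> t p \<in> V}"
  then obtain N where N: "open N" "p \<in> N" "N \<subseteq> W" "\<And>q. q \<in> N \<Longrightarrow> t \<in> J q" "smooth_map_on A N (\<phi> t)"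
    by (auto elim: flow_smooth[of p t])
  show "\<exists>T. open T \<and> p \<in> T \<and> T \<subseteq> {p \<in> W. t \<in> J p \<and> \<phi> t p \<in> V}"
    by (rule exI[of _ "{q \<in> N. \<phi> t q \<in> V}"]) (use N p smooth_map_on_preimage[OF N(5) V] in auto)
qed

lemma flow_pullback_vec_tangent:
  assumes p: "p \<in> W" "t \<in> J p" and v: "Y (\<phi> t p) \<in> tangent_space A (\<phi> t p)"
  shows "flow_pullback_vec A \<phi> t Y p \<in> tangent_space A p"
  using tangent_map_flow[OF flow_in[OF p] flow_inverse(1)[OF p] v] flow_inverse(2)[OF p] by (simp add: flow_pullback_vec_def)

text \<open>Applied to \<open>g\<close>, the pulled-back field is \<open>Y\<close> applied to
  \<open>g \<circ> \<phi> (- t)\<close> and then composed with \<open>\<phi> t\<close>; each of the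
  three operations preserves smoothness.\<close>

lemma flow_pullback_vector_field:
  assumes V: "open V" and Y: "vector_field A V Y"
  shows "vector_field A {p \<in> W. t \<in> J p \<and> \<phi> t p \<in> V} (flow_pullback_vec A \<phi> t Y)"
  unfolding vector_field_def
proof (intro conjI ballI allI impI; (elim conjE)?)
  fix p assume "p \<in> {p \<in> W. t \<in> J p \<and> \<phi> t p \<in> V}"
  then show "flow_pullback_vec A \<phi> t Y p \<in> tangent_space A p"
    using vector_field_tangent[OF Y] by (intro flow_pullback_vec_tangent) auto
next
  fix O' g assume O': "open O'" "O' \<subseteq> {p \<in> W. t \<in> J p \<and> \<phi> t p \<in> V}" and g: "smooth_fun A O' g"
  show "smooth_fun A O' (\<lambda>p. flow_pullback_vec A \<phi> t Y p g)"
    unfolding smooth_fun_iff_at[OF atlas O'(1)]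
  proof
    fix p assume "p \<in> O'"
    then have p: "p \<in> O'" "p \<in> W" "t \<in> J p" "\<phi> t p \<in> V" using O' by auto
    obtain N where N: "open N" "p \<in> N" "smooth_map_on A N (\<phi> t)"
      by (rule flow_smooth[OF p(2,3)]) blast
    obtain N' where N': "open N'" "\<phi> t p \<in> N'" "smooth_map_on A N' (\<phi> (- t))"
      by (rule flow_smooth[OF flow_in[OF p(2,3)] flow_inverse(1)[OF p(2,3)]]) blast
    have "smooth_at A (\<phi> (- t) (\<phi> t p)) g"
      using smooth_fun_imp_at[OF g O'(1) p(1)] flow_inverse(2)[OF p(2,3)] by simp
    from smooth_map_onD(3)[OF N'(3,2) this]
    have "smooth_at A (\<phi> t p) (\<lambda>r. Y r (\<lambda>r. g (\<phi> (- t) r)))"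
      by (rule vector_field_smooth_at[OF Y V p(4)])
    from smooth_map_onD(3)[OF N(3,2) this]
    have "smooth_at A p (\<lambda>q. Y (\<phi> t q) (\<lambda>r. g (\<phi> (- t) r)))" .
    then show "smooth_at A p (\<lambda>q. flow_pullback_vec A \<phi> t Y q g)"
    proof (rule smooth_at_cong[OF atlas O'(1) p(1), rotated])
      fix q assume q: "q \<in> O'"
      then have "q \<in> W" "t \<in> J q" using O' by auto
      then show "Y (\<phi> t q) (\<lambda>r. g (\<phi> (- t) r)) = flow_pullback_vec A \<phi> t Y q g"
        using smooth_fun_imp_at[OF g O'(1) q] flow_inverse(2)[of q t]
        by (simp add: flow_pullback_vec_def tangent_map_def o_def)
    qed
  qed
qed

text \<open>A test field \<open>Y\<close> is pushed forward to \<open>Z\<close>, its pullback by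
  \<open>- t\<close>; the function to be examined is then the smooth function
  \<open>\<lambda>r. \<alpha> r (Z r)\<close> composed with \<open>\<phi> t\<close>.\<close>

lemma flow_pullback_one_form:
  assumes V: "open V" and \<alpha>: "one_form A V \<alpha>"
  shows "one_form A {p \<in> W. t \<in> J p \<and> \<phi> t p \<in> V} (flow_pullback_form A \<phi> t \<alpha>)"
  unfolding one_form_def
proof (intro conjI ballI allI impI; (elim conjE)?)
  fix p assume p: "p \<in> {p \<in> W. t \<in> J p \<and> \<phi> t p \<in> V}"
  then have "\<alpha> (\<phi> t p) \<in> cotangent_space A (\<phi> t p)" using one_form_cotangent[OF \<alpha>] by auto
  moreover obtain N where "smooth_map_on A N (\<phi> t)" "p \<in> N" using p by (auto elim: flow_smooth[of p t])
  ultimately show "flow_pullback_form A \<phi> t \<alpha> p \<in> cotangent_space A p"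
    unfolding flow_pullback_form_def[abs_def] by (intro pullback_cotangent[OF atlas])
next
  fix O' Y assume O': "open O'" "O' \<subseteq> {p \<in> W. t \<in> J p \<and> \<phi> t p \<in> V}" and Y: "vector_field A O' Y"
  define Z where "Z = flow_pullback_vec A \<phi> (- t) Y"
  define V' where "V' = V \<inter> {r \<in> W. - t \<in> J r \<and> \<phi> (- t) r \<in> O'}"
  have V': "open V'" unfolding V'_def using V flow_domain_open[OF O'(1)] by auto
  have "vector_field A V' Z"
    unfolding Z_def V'_def by (rule vector_field_subset[OF flow_pullback_vector_field[OF O'(1) Y]]) auto
  then have s: "smooth_fun A V' (\<lambda>r. \<alpha> r (Z r))"
    by (intro one_form_smooth_fun[OF \<alpha> V']) (auto simp: V'_def)
  show "smooth_fun A O' (\<lambda>p. flow_pullback_form A \<phi> t \<alpha> p (Y p))"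
    unfolding smooth_fun_iff_at[OF atlas O'(1)]
  proof
    fix p assume "p \<in> O'"
    then have p: "p \<in> O'" "p \<in> W" "t \<in> J p" "\<phi> t p \<in> V" using O' by auto
    obtain N where N: "open N" "p \<in> N" "smooth_map_on A N (\<phi> t)"
      by (rule flow_smooth[OF p(2,3)]) blast
    have "\<phi> t p \<in> V'" using p flow_in[OF p(2,3)] flow_inverse[OF p(2,3)] by (simp add: V'_def)
    from smooth_fun_imp_at[OF s V' this]
    have "smooth_at A p (\<lambda>q. \<alpha> (\<phi> t q) (Z (\<phi> t q)))"
      by (rule smooth_map_onD(3)[OF N(3,2), of "\<lambda>r. \<alpha> r (Z r)"])
    then show "smooth_at A p (\<lambda>q. flow_pullback_form A \<phi> t \<alpha> q (Y q))"
    proof (rule smooth_at_cong[OF atlas O'(1) p(1), rotated])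
      fix q assume q: "q \<in> O'"
      then have "q \<in> W" "t \<in> J q" using O' by auto
      then show "\<alpha> (\<phi> t q) (Z (\<phi> t q)) = flow_pullback_form A \<phi> t \<alpha> q (Y q)"
        using flow_inverse(2)[of q t] vector_field_tangent[OF Y q]
        by (simp add: Z_def flow_pullback_vec_def flow_pullback_form_def)
    qed
  qed
qed

end

section \<open>Hamiltonian flows and brackets with a frame of \<open>D\<close>\<close>

lemma sections_subset: "(X, \<alpha>) \<in> sections A D V \<Longrightarrow> open V' \<Longrightarrow> V' \<subseteq> V \<Longrightarrow> (X, \<alpha>) \<in> sections A D V'"
  unfolding sections_def by (auto intro: vector_field_subset one_form_subset)

lemma lin_comb_unit:
  assumes "i < r"
  shows "lin_comb r (\<lambda>j. if j = i then 1 else 0) s = s i"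
  using assms by (simp add: lin_comb_def if_distrib[of "\<lambda>a. a * _"] sum.delta cong: if_cong)

locale hamiltonian_flow = flow A W X J \<phi>
  for A :: "('m::{t2_space,second_countable_topology}, 'e::euclidean_space) chart set"
    and W X J \<phi> +
  fixes D :: "'m \<Rightarrow> ('m vec \<times> 'm covec) set" and f :: "'m \<Rightarrow> real"
  assumes closed: "closed_dirac_structure A D" and f: "smooth_fun A W f"
    and hamiltonian: "(X, differential A f) \<in> sections A D W"
begin

lemma dirac_fiber:
  "D p = {\<sigma> \<in> tangent_space A p \<times> cotangent_space A p. \<forall>\<tau>\<in>D p. pairing \<sigma> \<tau> = 0}"
  using closed unfolding closed_dirac_structure_def dirac_structure_def by blast

lemma dirac_space: "\<sigma> \<in> D p \<Longrightarrow> fst \<sigma> \<in> tangent_space A p \<and> snd \<sigma> \<in> cotangent_space A p"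
  by (subst (asm) dirac_fiber) auto

lemma dirac_isotropic: "\<sigma> \<in> D p \<Longrightarrow> \<tau> \<in> D p \<Longrightarrow> pairing \<sigma> \<tau> = 0"
  using dirac_fiber[of p] by blast

lemma dirac_memI: "\<sigma> \<in> tangent_space A p \<times> cotangent_space A p \<Longrightarrow> (\<And>\<tau>. \<tau> \<in> D p \<Longrightarrow> pairing \<sigma> \<tau> = 0) \<Longrightarrow> \<sigma> \<in> D p"
  using dirac_fiber[of p] by blast

lemma dirac_frame:
  obtains V r Y \<alpha> where "open V" "p \<in> V" "\<And>i. i < r \<Longrightarrow> vector_field A V (Y i)" "\<And>i. i < r \<Longrightarrow> one_form A V (\<alpha> i)"
    "\<And>q. q \<in> V \<Longrightarrow> D q = {lin_comb r a (\<lambda>i. (Y i q, \<alpha> i q)) | a. True}"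
    "\<And>q a. q \<in> V \<Longrightarrow> lin_comb r a (\<lambda>i. (Y i q, \<alpha> i q)) = (\<lambda>g. 0, \<lambda>v. 0) \<Longrightarrow> \<forall>i<r. a i = 0"
proof -
  have "subbundle A D" using closed unfolding closed_dirac_structure_def dirac_structure_def by blast
  then have "\<exists>V r Y \<alpha>. open V \<and> p \<in> V \<and>
        (\<forall>i<r::nat. vector_field A V (Y i) \<and> one_form A V (\<alpha> i)) \<and>
        (\<forall>q\<in>V. D q = {lin_comb r a (\<lambda>i. (Y i q, \<alpha> i q)) | a. True} \<and>
           (\<forall>a. lin_comb r a (\<lambda>i. (Y i q, \<alpha> i q)) = (\<lambda>g. 0, \<lambda>v. 0) \<longrightarrow> (\<forall>i<r. a i = 0)))"
    unfolding subbundle_def by (elim conjE) (erule spec)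
  then obtain V r Y \<alpha> where "open V" "p \<in> V"
      "\<forall>i<r::nat. vector_field A V (Y i) \<and> one_form A V (\<alpha> i)"
      "\<forall>q\<in>V. D q = {lin_comb r a (\<lambda>i. (Y i q, \<alpha> i q)) | a. True} \<and>
           (\<forall>a. lin_comb r a (\<lambda>i. (Y i q, \<alpha> i q)) = (\<lambda>g. 0, \<lambda>v. 0) \<longrightarrow> (\<forall>i<r. a i = 0))"
    by (elim exE conjE) rule
  then show ?thesis by (intro that[of V r Y \<alpha>]) simp_all
qed

lemma bracket_section:
  assumes "(Y, \<beta>) \<in> sections A D V" "V \<subseteq> W"
  shows "(lie_bracket A X Y, \<lambda>p v. lie_derivative A X \<beta> p v -
      interior_product Y (exterior_derivative A (differential A f)) p v) \<in> sections A D V"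
proof -
  have V: "open V" using assms(1) by (simp add: sections_def)
  have "courant_bracket A (X, differential A f) (Y, \<beta>) \<in> sections A D V"
    using closed sections_subset[OF hamiltonian V assms(2)] assms(1) unfolding closed_dirac_structure_def by blast
  then show ?thesis by simp
qed

lemma exterior_derivative_hamiltonian: "p \<in> W \<Longrightarrow> exterior_derivative A (differential A f) p u v = 0"
  using exterior_derivative_differential[OF atlas smooth_fun_imp_at[OF f W]] .

end

locale hamiltonian_flow_chart = hamiltonian_flow A W X J \<phi> D f + smooth_chart A U x
  for A :: "('m::{t2_space,second_countable_topology}, 'e::euclidean_space) chart set"
    and W X J \<phi> D f U x
begin

sublocale flow_chart A W X J \<phi> U x ..

text \<open>Closure under the Courant bracket enters here: the bracket of
  \<open>(X, differential A f)\<close> with a frame section lies in \<open>D\<close>, hence in the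
  span of the frame. Its d(df) term vanishes on \<open>W\<close>, which leaves the Lie bracket and
  the Lie derivative with common coefficients.\<close>

lemma frame_bracket_coefficients:
  assumes V: "open V" "V \<subseteq> U \<inter> W" "q0 \<in> V"
    and Y: "\<And>i. i < r \<Longrightarrow> vector_field A V (Y i)" and \<alpha>: "\<And>i. i < r \<Longrightarrow> one_form A V (\<alpha> i)"
    and span: "\<And>q. q \<in> V \<Longrightarrow> D q = {lin_comb r a (\<lambda>i. (Y i q, \<alpha> i q)) | a. True}"
    and ind: "\<And>q a. q \<in> V \<Longrightarrow> lin_comb r a (\<lambda>i. (Y i q, \<alpha> i q)) = (\<lambda>g. 0, \<lambda>v. 0) \<Longrightarrow> \<forall>i<r. a i = 0"
  obtains T C where "open T" "x q0 \<in> T" "T \<subseteq> x ` V" "C \<ge> 0"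
    "\<And>z i. z \<in> T \<Longrightarrow> i < r \<Longrightarrow> bracket_coefficients C r field
      (\<lambda>i z. vcoord (Y i (xi z))) (\<lambda>i z. ccoord (xi z) (\<alpha> i (xi z))) i z"
proof -
  have VU: "V \<subseteq> U" "V \<subseteq> W" using V by auto
  have xV: "open (x ` V)" "x q0 \<in> x ` V" using open_image[OF V(1) VU(1)] V(3) by auto
  have e_sec: "(Y i, \<alpha> i) \<in> sections A D V" if i: "i < r" for i
  proof -
    have "(Y i q, \<alpha> i q) \<in> D q" if q: "q \<in> V" for q
    proof -
      have "(Y i q, \<alpha> i q) = lin_comb r (\<lambda>j. if j = i then 1 else 0) (\<lambda>i. (Y i q, \<alpha> i q))"
        using lin_comb_unit[OF i, of "\<lambda>i. (Y i q, \<alpha> i q)"] by simp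
      then show ?thesis unfolding span[OF q] by blast
    qed
    then show ?thesis using Y[OF i] \<alpha>[OF i] V(1) by (simp add: sections_def)
  qed
  define BX where "BX i = lie_bracket A X (Y i)" for i
  define BA where "BA i = (\<lambda>p v. lie_derivative A X (\<alpha> i) p v -
      interior_product (Y i) (exterior_derivative A (differential A f)) p v)" for i
  have br: "(BX i, BA i) \<in> sections A D V" if "i < r" for i
    unfolding BX_def BA_def by (rule bracket_section[OF e_sec[OF that] VU(2)])
  have BXv: "vector_field A V (BX i)" and BAv: "one_form A V (BA i)"
    and BD: "\<And>q. q \<in> V \<Longrightarrow> (BX i q, BA i q) \<in> D q" if "i < r" for i
    using br[OF that] by (simp_all add: sections_def)
  define \<kappa> where "\<kappa> j z = (vcoord (Y j (xi z)), ccoord (xi z) (\<alpha> j (xi z)))" for j z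
  define S where "S i z = (vcoord (BX i (xi z)), ccoord (xi z) (BA i (xi z)))" for i z
  have cont: "isCont (\<lambda>z. (vcoord (Z (xi z)), ccoord (xi z) (\<beta> (xi z)))) (x q0)"
    if "vector_field A V Z" "one_form A V \<beta>" for Z \<beta>
    using continuous_on_Pair[OF smooth_on_continuous_on[OF vector_field_coord_smooth[OF that(1) V(1) VU(1)]]
        smooth_on_continuous_on[OF one_form_coord_smooth[OF that(2) V(1) VU(1)]]]
    using xV continuous_on_eq_continuous_at by blast
  have q0U: "q0 \<in> U" using V VU by auto
  obtain T K where T: "open T" "x q0 \<in> T" "K \<ge> 0"
    "\<And>z c. z \<in> T \<Longrightarrow> (\<Sum>j<r. \<bar>c j\<bar>) \<le> K * norm (\<Sum>j<r. c j *\<^sub>R \<kappa> j z)"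
  proof (rule bounded_frame_coefficients[where \<kappa> = \<kappa> and r = r and ?z0.0 = "x q0"])
    show "isCont (\<kappa> j) (x q0)" if "j < r" for j
      unfolding \<kappa>_def[abs_def] by (rule cont[OF Y[OF that] \<alpha>[OF that]])
    fix c assume c: "(\<Sum>j<r. c j *\<^sub>R \<kappa> j (x q0)) = 0"
    \<comment> \<open>Coordinates lose nothing: a fibre element with zero coordinates is the zero
      vector paired with the zero covector, so independence in the fibre gives independence of the
      \<open>\<kappa> j\<close>.\<close>
    have s: "(\<Sum>j<r. c j *\<^sub>R vcoord (Y j q0)) = 0" "(\<Sum>j<r. c j *\<^sub>R ccoord q0 (\<alpha> j q0)) = 0"
      using arg_cong[OF c, of fst] arg_cong[OF c, of snd] q0U by (simp_all add: \<kappa>_def fst_sum snd_sum)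
    define \<sigma> where "\<sigma> = lin_comb r c (\<lambda>i. (Y i q0, \<alpha> i q0))"
    have "\<sigma> \<in> D q0" unfolding \<sigma>_def span[OF V(3)] by blast
    from dirac_space[OF this] have \<sigma>: "fst \<sigma> \<in> tangent_space A q0" "snd \<sigma> \<in> cotangent_space A q0" by auto
    have vc: "vcoord (fst \<sigma>) = 0" using s(1) by (simp add: \<sigma>_def lin_comb_def vcoord_sum)
    have cc: "ccoord q0 (snd \<sigma>) = 0" using s(2) by (simp add: \<sigma>_def lin_comb_def ccoord_sum)
    have "fst \<sigma> = (\<lambda>g. 0)"
      by (rule tangent_eqI[OF q0U \<sigma>(1) tangent_zero[OF atlas]]) (simp add: vc vcoord_zero)
    moreover have "snd \<sigma> v = 0" for v
      using cotangent_apply[OF q0U \<sigma>(2), of v] cotangent_outside[OF \<sigma>(2), of v] cc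
      by (cases "v \<in> tangent_space A q0") auto
    ultimately have "\<sigma> = (\<lambda>g. 0, \<lambda>v. 0)" by (simp add: prod_eq_iff fun_eq_iff)
    then show "\<forall>j<r. c j = 0" unfolding \<sigma>_def by (rule ind[OF V(3)])
  qed blast
  \<comment> \<open>A bound for the coordinates of all brackets at \<open>x q0\<close>; the 1 makes
    it strict, so that it persists nearby by continuity.\<close>
  define R where "R = (\<Sum>i<r. norm (S i (x q0))) + 1"
  have R: "R > 0" unfolding R_def by (intro add_nonneg_pos sum_nonneg) auto
  have "isCont (\<lambda>z. \<Sum>i<r. norm (S i z)) (x q0)"
    unfolding S_def by (intro continuous_intros cont BXv BAv) auto
  moreover have "(\<Sum>i<r. norm (S i (x q0))) \<in> {..<R}" by (simp add: R_def)
  ultimately obtain T' where T': "open T'" "x q0 \<in> T'" "\<And>z. z \<in> T' \<Longrightarrow> (\<Sum>i<r. norm (S i z)) < R"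
    unfolding continuous_at_open by (metis lessThan_iff open_lessThan)
  show ?thesis
  proof (rule that[of "T \<inter> T' \<inter> x ` V" "K * R"])
    show "open (T \<inter> T' \<inter> x ` V)" "x q0 \<in> T \<inter> T' \<inter> x ` V" using T T' xV by auto
    show "K * R \<ge> 0" using T(3) R by simp
    fix z i assume z: "z \<in> T \<inter> T' \<inter> x ` V" and i: "i < r"
    define q where "q = xi z"
    have q: "q \<in> V" "q \<in> U" "q \<in> W" "x q = z" using z VU xi_mem[of z V] by (auto simp: q_def)
    obtain c where c: "(BX i q, BA i q) = lin_comb r c (\<lambda>i. (Y i q, \<alpha> i q))"
      using BD[OF i q(1)] unfolding span[OF q(1)] by blast
    have cX: "BX i q = (\<lambda>g. \<Sum>j<r. c j * Y j q g)" and cA: "BA i q = (\<lambda>v. \<Sum>j<r. c j * \<alpha> j q v)"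
      using c by (simp_all add: lin_comb_def)
    have "S i z = (\<Sum>j<r. c j *\<^sub>R \<kappa> j z)"
      by (simp add: S_def \<kappa>_def prod_eq_iff fst_sum snd_sum cX cA vcoord_sum ccoord_sum flip: q_def)
    then have "(\<Sum>j<r. \<bar>c j\<bar>) \<le> K * norm (S i z)" using T(4)[of z c] z by simp
    also have "\<dots> \<le> K * R"
    proof (rule mult_left_mono[OF _ T(3)])
      have "norm (S i z) \<le> (\<Sum>i<r. norm (S i z))" using i by (intro member_le_sum) auto
      then show "norm (S i z) \<le> R" using T'(3)[of z] z by simp
    qed
    finally have sum_le: "(\<Sum>j<r. \<bar>c j\<bar>) \<le> K * R" .
    have cb: "\<bar>c j\<bar> \<le> K * R" if "j < r" for j
      using that by (intro order_trans[OF _ sum_le] member_le_sum) auto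
    have XV: "vector_field A V X" by (rule vector_field_subset[OF X VU(2)])
    have Xq: "vcoord (X q) = field z" by (simp add: field_def q_def)
    have "fderiv (vec_rep (Y i)) z (field z) - fderiv field z (vcoord (Y i q))
        = vcoord (BX i q)"
      using lie_bracket_coord[OF V(1) VU(1) q(1) XV Y[OF i]] by (simp add: BX_def q(4) Xq field_def[abs_def])
    moreover have "fderiv (form_rep (\<alpha> i)) z (field z) \<bullet> w
          + ccoord q (\<alpha> i q) \<bullet> fderiv field z w = (\<Sum>j<r. c j * (ccoord q (\<alpha> j q) \<bullet> w))" for w
    proof -
      \<comment> \<open>Each coordinate vector \<open>w\<close> belongs to a tangent vector, on
        which the Lie derivative can be evaluated.\<close>
      have w: "pd q w \<in> tangent_space A q" by (rule pd_tangent[OF q(2)])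
      have "fderiv (form_rep (\<alpha> i)) z (field z) \<bullet> w
          + ccoord q (\<alpha> i q) \<bullet> fderiv field z w = lie_derivative A X (\<alpha> i) q (pd q w)"
        using lie_derivative_coord[OF V(1) VU(1) q(1) XV \<alpha>[OF i] w] by (simp add: q(4) Xq vcoord_pd[OF q(2)] field_def[abs_def])
      also have "\<dots> = BA i q (pd q w)"
        by (simp add: BA_def interior_product_def exterior_derivative_hamiltonian[OF q(3)])
      also have "\<dots> = (\<Sum>j<r. c j * (ccoord q (\<alpha> j q) \<bullet> w))"
        unfolding cA
        by (intro sum.cong refl) (simp add: cotangent_apply[OF q(2) one_form_cotangent[OF \<alpha> q(1)] w] vcoord_pd[OF q(2)])
      finally show ?thesis .
    qed
    ultimately show "bracket_coefficients (K * R) r field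
      (\<lambda>i z. vcoord (Y i (xi z))) (\<lambda>i z. ccoord (xi z) (\<alpha> i (xi z))) i z"
      unfolding bracket_coefficients_def
      using cb by (intro exI[of _ c]) (simp add: cX vcoord_sum flip: q_def)
  qed auto
qed

end

section \<open>Invariance near a point and along integral curves\<close>

context hamiltonian_flow_chart
begin

text \<open>One \<open>\<delta>\<close> for all \<open>q\<close> in \<open>N\<close> is essential:
  the propagation along an integral curve starts the short flow at the varying points
  \<open>\<phi> u p\<close>.\<close>

lemma pull_invariant_near:
  assumes q0: "q0 \<in> U \<inter> W"
  shows "\<exists>\<delta> N. \<delta> > 0 \<and> open N \<and> q0 \<in> N \<and>
    (\<forall>q\<in>N. \<forall>t\<in>{-\<delta><..<\<delta>}. q \<in> W \<and> t \<in> J q \<and> (\<forall>\<sigma>\<in>D (\<phi> t q). pull t q \<sigma> \<in> D q))"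
proof -
  obtain \<epsilon> \<rho> \<psi> where \<rho>: "\<rho> > 0" and flow: "local_flow_on field (x ` (U \<inter> W)) \<epsilon> (ball (x q0) \<rho>) \<psi>"
    and inW: "\<And>q. q \<in> U \<Longrightarrow> x q \<in> ball (x q0) \<rho> \<Longrightarrow> q \<in> W"
    and inJ: "\<And>t q. t \<in> {-\<epsilon><..<\<epsilon>} \<Longrightarrow> q \<in> U \<Longrightarrow> x q \<in> ball (x q0) \<rho> \<Longrightarrow> t \<in> J q"
    and \<phi>\<psi>: "\<And>t q. t \<in> {-\<epsilon><..<\<epsilon>} \<Longrightarrow> q \<in> U \<Longrightarrow> x q \<in> ball (x q0) \<rho> \<Longrightarrow> \<phi> t q = xi (\<psi> (t, x q))"
    by (rule flow_in_chart[OF q0]) blast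
  note \<epsilon> = local_flow_onD(1)[OF flow] and \<psi> = local_flow_onD(2)[OF flow]
    and \<psi>0 = local_flow_onD(3)[OF flow] and \<psi>UW = local_flow_onD(4)[OF flow]
  define O1 where "O1 = ball (x q0) \<rho>"
  have O1: "open O1" "x q0 \<in> O1" using \<rho> by (auto simp: O1_def)
  obtain V0 r Y \<alpha> where V0: "open V0" "q0 \<in> V0" and Y0: "\<And>i. i < r \<Longrightarrow> vector_field A V0 (Y i)"
    and \<alpha>0: "\<And>i. i < r \<Longrightarrow> one_form A V0 (\<alpha> i)"
    and span0: "\<And>q. q \<in> V0 \<Longrightarrow> D q = {lin_comb r a (\<lambda>i. (Y i q, \<alpha> i q)) | a. True}"
    and ind0: "\<And>q a. q \<in> V0 \<Longrightarrow> lin_comb r a (\<lambda>i. (Y i q, \<alpha> i q)) = (\<lambda>g. 0, \<lambda>v. 0) \<Longrightarrow> \<forall>i<r. a i = 0"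
    by (rule dirac_frame[of q0]) blast
  define V where "V = V0 \<inter> (U \<inter> W)"
  have V: "open V" "V \<subseteq> U \<inter> W" "q0 \<in> V" and VU: "V \<subseteq> U" using V0 W_chart(1) q0 by (auto simp: V_def)
  have Y: "vector_field A V (Y i)" and \<alpha>: "one_form A V (\<alpha> i)" if "i < r" for i
    using vector_field_subset[OF Y0[OF that]] one_form_subset[OF \<alpha>0[OF that]] by (auto simp: V_def)
  have span: "D q = {lin_comb r a (\<lambda>i. (Y i q, \<alpha> i q)) | a. True}" if "q \<in> V" for q
    using that by (intro span0) (simp add: V_def)
  have ind: "\<forall>i<r. a i = 0" if "q \<in> V" "lin_comb r a (\<lambda>i. (Y i q, \<alpha> i q)) = (\<lambda>g. 0, \<lambda>v. 0)" for q a
    using that by (intro ind0[of q]) (auto simp: V_def)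
  define YC where "YC i z = vcoord (Y i (xi z))" for i z
  define AC where "AC i z = ccoord (xi z) (\<alpha> i (xi z))" for i z
  obtain T C where T: "open T" "x q0 \<in> T" "T \<subseteq> x ` V" and C: "C \<ge> 0"
    and coef: "\<And>z i. z \<in> T \<Longrightarrow> i < r \<Longrightarrow> bracket_coefficients C r field YC AC i z"
    unfolding YC_def[abs_def] AC_def[abs_def]
    by (rule frame_bracket_coefficients[of V q0 r Y \<alpha>, OF V Y \<alpha> span ind]) blast+
  define O2 where "O2 = T \<inter> O1"
  have O2: "open O2" "O2 \<subseteq> O1" "x q0 \<in> O2" "O2 \<subseteq> T" using T O1 by (auto simp: O2_def)
  have YCs: "smooth_on O2 (YC i)" and ACs: "smooth_on O2 (AC i)" if "i < r" for i
    unfolding YC_def AC_def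
    using smooth_on_subset[OF vector_field_coord_smooth[OF Y[OF that] V(1) VU]]
      smooth_on_subset[OF one_form_coord_smooth[OF \<alpha>[OF that] V(1) VU]] T(3) O2(4) by (meson order_trans)+
  have Fs: "smooth_on O2 field" by (rule smooth_on_subset[OF field_smooth]) (use T(3) O2(4) V(2) in blast)
  \<comment> \<open>The open preimage of \<open>O2\<close> contains a product neighbourhood, which
    gives one time interval for all starting points in \<open>B\<close>.\<close>
  have "open {p \<in> {-\<epsilon><..<\<epsilon>} \<times> O1. \<psi> p \<in> O2}"
    using continuous_open_preimage[OF smooth_on_continuous_on[OF \<psi>] _ O2(1)] O1(1)
    by (simp add: O1_def open_Times vimage_def Int_def)
  moreover have "(0, x q0) \<in> {p \<in> {-\<epsilon><..<\<epsilon>} \<times> O1. \<psi> p \<in> O2}"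
    using \<epsilon> O1(2) O2(3) \<psi>0[of "x q0"] by (simp add: O1_def)
  ultimately obtain I B where IB: "open I" "open B" "0 \<in> I" "x q0 \<in> B"
    "I \<times> B \<subseteq> {p \<in> {-\<epsilon><..<\<epsilon>} \<times> O1. \<psi> p \<in> O2}"
    by (elim open_prod_elim) auto
  obtain \<delta> where \<delta>: "\<delta> > 0" "ball 0 \<delta> \<subseteq> I" by (rule open_contains_ballE[OF IB(1,3)])
  have tI: "t \<in> I" if "t \<in> {-\<delta><..<\<delta>}" for t using that \<delta>(2) by (auto simp: dist_real_def subset_iff abs_less_iff)
  have t\<epsilon>: "t \<in> {-\<epsilon><..<\<epsilon>}" "- t \<in> {-\<epsilon><..<\<epsilon>}" if "t \<in> {-\<delta><..<\<delta>}" for t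
    using tI[OF that] IB(4,5) by auto
  have stay: "\<psi> (t, y) \<in> O2" "y \<in> O1" if "t \<in> {-\<delta><..<\<delta>}" "y \<in> B" for t y
    using tI[OF that(1)] IB(5) that(2) by auto
  \<comment> \<open>Otherwise \<open>\<epsilon>\<close> would be one of the times in the smaller
    interval, and \<open>t\<epsilon>\<close> would give
    \<open>\<epsilon> < \<epsilon>\<close>.\<close>
  have "\<delta> \<le> \<epsilon>"
  proof (rule ccontr)
    assume "\<not> \<delta> \<le> \<epsilon>"
    then have "\<epsilon> \<in> {-\<delta><..<\<delta>}" using \<epsilon> by auto
    from t\<epsilon>(1)[OF this] show False by simp
  qed
  have O1U: "y \<in> x ` U" if "y \<in> O1" for y
    using \<psi>UW[of 0 y] \<psi>0[of y] \<epsilon> that by (auto simp: O1_def)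
  \<comment> \<open>The local solution \<open>\<psi>\<close> is not known to obey a flow law by
    itself; the return to \<open>y\<close> is inherited from \<open>flow_inverse\<close> through the
    chart, as \<open>y\<close> and \<open>\<psi> (t, y)\<close> both lie in \<open>O1\<close>, where
    \<open>\<psi>\<close> represents \<open>\<phi>\<close>.\<close>
  have ret: "\<psi> (- t, \<psi> (t, y)) = y" if t: "t \<in> {-\<delta><..<\<delta>}" and y: "y \<in> B" for t y
  proof -
    define p where "p = xi y"
    have y1: "y \<in> O1" by (rule stay(2)[OF t y])
    have p: "p \<in> U" "x p = y" using O1U[OF y1] xi_in by (auto simp: p_def)
    have xp: "x p \<in> ball (x q0) \<rho>" using p y1 by (simp add: O1_def)
    have z1: "\<psi> (t, y) \<in> O1" using stay(1)[OF t y] O2(2) by blast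
    have q: "\<phi> t p = xi (\<psi> (t, y))" using \<phi>\<psi>[OF t\<epsilon>(1)[OF t] p(1) xp] p(2) by simp
    have xq: "x (\<phi> t p) = \<psi> (t, y)" and qU: "\<phi> t p \<in> U" using O1U[OF z1] xi_in by (simp_all add: q)
    have "xi (\<psi> (- t, \<psi> (t, y))) = \<phi> (- t) (\<phi> t p)"
      using \<phi>\<psi>[OF t\<epsilon>(2)[OF t] qU] z1 by (simp add: xq O1_def)
    also have "\<dots> = p" by (rule flow_inverse(2)[OF inW[OF p(1) xp] inJ[OF t\<epsilon>(1)[OF t] p(1) xp]])
    finally have "x (xi (\<psi> (- t, \<psi> (t, y)))) = y" using p(2) by simp
    moreover have "\<psi> (- t, \<psi> (t, y)) \<in> x ` U" using \<psi>UW[OF t\<epsilon>(2)[OF t], of "\<psi> (t, y)"] z1 by (auto simp: O1_def)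
    ultimately show ?thesis by simp
  qed
  have \<psi>s: "smooth_on O1 (\<lambda>y. \<psi> (t, y))" if "t \<in> {-\<epsilon><..<\<epsilon>}" for t
    by (rule smooth_on_compose[OF O1(1) \<psi> smooth_on_Pair[OF O1(1) smooth_on_const smooth_on_bounded_linear[OF bounded_linear_ident]]])
       (use that in \<open>auto simp: O1_def\<close>)
  have partial: "fderiv (\<lambda>y. \<psi> (t, y)) y u = fderiv \<psi> (t, y) (0, u)"
    if "t \<in> {-\<epsilon><..<\<epsilon>}" "y \<in> O1" for t y u
  proof -
    have "(\<psi> has_derivative fderiv \<psi> (t, y)) (at (t, y))"
      using that by (intro smooth_on_has_derivative[OF \<psi>]) (simp add: O1_def)
    then have "((\<lambda>y. \<psi> (t, y)) has_derivative (\<lambda>u. fderiv \<psi> (t, y) (0, u))) (at y)"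
      by (intro has_derivative_compose[of "\<lambda>z. (t, z)" "\<lambda>u. (0, u)" y UNIV \<psi>]) (auto intro!: derivative_intros)
    from frechet_derivative_at[OF this, symmetric] show ?thesis by simp
  qed
  have Tcoord: "vcoord (tangent_map A (\<phi> t) q v) = fderiv \<psi> (t, x q) (0, vcoord v)"
    if t: "t \<in> {-\<epsilon><..<\<epsilon>}" and q: "q \<in> U" "x q \<in> O1" and v: "v \<in> tangent_space A q" for t q v
  proof -
    have "vcoord (tangent_map A (\<phi> t) q v) = fderiv (\<lambda>y. \<psi> (t, y)) (x q) (vcoord v)"
      by (rule tangent_map_coord[OF q O1(1) \<psi>s[OF t] _ _ v])
         (use \<psi>UW[OF t] \<phi>\<psi>[OF t] in \<open>auto simp: O1_def\<close>)
    then show ?thesis by (simp add: partial[OF t q(2)])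
  qed
  define N where "N = {q \<in> U. x q \<in> B}"
  have inv: "pull t q \<sigma> \<in> D q" if q: "q \<in> N" and t: "t \<in> {-\<delta><..<\<delta>}" and \<sigma>: "\<sigma> \<in> D (\<phi> t q)" for q t \<sigma>
  proof -
    define y where "y = x q"
    define z where "z = \<psi> (t, y)"
    have qU: "q \<in> U" and yB: "y \<in> B" using q by (auto simp: N_def y_def)
    have y1: "y \<in> O1" and z2: "z \<in> O2" using stay[OF t yB] by (auto simp: z_def)
    have z1: "z \<in> O1" and zT: "z \<in> T" using z2 O2 by auto
    have xq: "x q \<in> ball (x q0) \<rho>" using y1 by (simp add: O1_def y_def)
    have qW: "q \<in> W" and tJ: "t \<in> J q" using inW[OF qU xq] inJ[OF t\<epsilon>(1)[OF t] qU xq] by auto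
    have \<phi>q: "\<phi> t q = xi z" using \<phi>\<psi>[OF t\<epsilon>(1)[OF t] qU xq] by (simp add: z_def y_def)
    have \<phi>qV: "\<phi> t q \<in> V" and \<phi>qU: "\<phi> t q \<in> U" and x\<phi>q: "x (\<phi> t q) = z"
      using xi_mem[of z V] VU T(3) zT x_xi[OF O1U[OF z1]] unfolding \<phi>q by auto
    \<comment> \<open>The frame is needed at the starting point too, to pair it with
      \<open>\<tau>\<close> there; this is \<open>stay\<close> at time 0.\<close>
    have "y \<in> T" using stay(1)[of 0 y] \<psi>0[of y] \<delta>(1) yB y1 O2(4) by (auto simp: O1_def)
    then have qV: "q \<in> V" using T(3) xi_mem[of y V] VU qU by (auto simp: y_def)
    note \<sigma>s = dirac_space[OF \<sigma>]
    have pm: "pull t q \<sigma> \<in> tangent_space A q \<times> cotangent_space A q"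
      using \<sigma>s by (intro pull_mem[OF qW tJ]) (simp add: mem_Times_iff)
    obtain c where c: "\<sigma> = lin_comb r c (\<lambda>i. (Y i (\<phi> t q), \<alpha> i (\<phi> t q)))"
      using \<sigma> unfolding span[OF \<phi>qV] by blast
    have \<sigma>v: "vcoord (fst \<sigma>) = (\<Sum>i<r. c i *\<^sub>R YC i z)" and \<sigma>c: "ccoord (\<phi> t q) (snd \<sigma>) = (\<Sum>i<r. c i *\<^sub>R AC i z)"
      by (simp_all add: c lin_comb_def vcoord_sum ccoord_sum YC_def AC_def \<phi>q)
    show ?thesis
    proof (rule dirac_memI[OF pm])
      fix \<tau> assume \<tau>: "\<tau> \<in> D q"
      obtain v \<eta> where v\<eta>: "\<tau> = (v, \<eta>)" by (cases \<tau>)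
      have v: "v \<in> tangent_space A q" and \<eta>: "\<eta> \<in> cotangent_space A q" using dirac_space[OF \<tau>] by (auto simp: v\<eta>)
      define P where "P = (\<lambda>u. fderiv \<psi> (- t, z) (0, u))"
      define w where "w = fderiv \<psi> (t, y) (0, vcoord v)"
      have "((\<lambda>y. \<psi> (- t, y)) has_derivative fderiv (\<lambda>y. \<psi> (- t, y)) z) (at z)"
        by (rule smooth_on_has_derivative[OF \<psi>s[OF t\<epsilon>(2)[OF t]] z1])
      moreover have "fderiv (\<lambda>y. \<psi> (- t, y)) z = P"
        by (rule ext) (simp add: P_def partial[OF t\<epsilon>(2)[OF t] z1])
      ultimately have "bounded_linear P" by (metis has_derivative_bounded_linear)
      then interpret P: bounded_linear P .
      have fstc: "vcoord (fst (pull t q \<sigma>)) = P (vcoord (fst \<sigma>))"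
        using Tcoord[OF t\<epsilon>(2)[OF t] \<phi>qU _ conjunct1[OF \<sigma>s]] z1 by (simp add: pull_def x\<phi>q P_def)
      have sndc: "snd (pull t q \<sigma>) v = ccoord (\<phi> t q) (snd \<sigma>) \<bullet> w"
        using v cotangent_apply[OF \<phi>qU conjunct2[OF \<sigma>s] tangent_map_flow[OF qW tJ v]]
          Tcoord[OF t\<epsilon>(1)[OF t] qU _ v] y1 by (simp add: pull_def y_def w_def)
      have zero: "ccoord q \<eta> \<bullet> P (YC i z) + AC i z \<bullet> w = 0" if i: "i < r" for i
        unfolding P_def w_def z_def
      proof (rule pairing_along_flow[OF flow open_ball _ \<delta>(1) \<open>\<delta> \<le> \<epsilon>\<close> O2(1) O2(2)[unfolded O1_def] _ _ Fs YCs ACs C _ _ t i])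
        show "y \<in> ball (x q0) \<rho>" using y1 by (simp add: O1_def)
        show "\<psi> (s, y) \<in> O2" if "s \<in> {-\<delta><..<\<delta>}" for s by (rule stay(1)[OF that yB])
        show "\<exists>N. open N \<and> y \<in> N \<and> N \<subseteq> ball (x q0) \<rho> \<and> (\<forall>y'\<in>N. \<psi> (- s, \<psi> (s, y')) = y')"
          if "s \<in> {-\<delta><..<\<delta>}" for s
          using IB(2) yB stay(2)[OF that] ret[OF that] by (intro exI[of _ B]) (auto simp: O1_def)
        show "bracket_coefficients C r field YC AC i z" if "z \<in> O2" "i < r" for z i
          using coef[OF subsetD[OF O2(4) that(1)] that(2)] .
        \<comment> \<open>Initial value of the linear system: it is zero because \<open>D q\<close>
          is isotropic and contains both the frame and \<open>\<tau>\<close>.\<close>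
        fix i assume i: "i < r"
        have "(Y i q, \<alpha> i q) = lin_comb r (\<lambda>j. if j = i then 1 else 0) (\<lambda>i. (Y i q, \<alpha> i q))"
          using lin_comb_unit[OF i, of "\<lambda>i. (Y i q, \<alpha> i q)"] by simp
        then have "(Y i q, \<alpha> i q) \<in> D q" unfolding span[OF qV] by blast
        from dirac_isotropic[OF this \<tau>] have "\<eta> (Y i q) + \<alpha> i q v = 0" by (simp add: v\<eta>)
        then show "ccoord q \<eta> \<bullet> YC i y + AC i y \<bullet> vcoord v = 0"
          using cotangent_apply[OF qU \<eta> vector_field_tangent[OF Y[OF i] qV]]
            cotangent_apply[OF qU one_form_cotangent[OF \<alpha>[OF i] qV] v]
          by (simp add: YC_def AC_def y_def qU)
      qed
      have "pairing (pull t q \<sigma>) \<tau> = \<eta> (fst (pull t q \<sigma>)) + snd (pull t q \<sigma>) v"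
        by (cases "pull t q \<sigma>") (simp add: v\<eta>)
      also have "\<eta> (fst (pull t q \<sigma>)) = ccoord q \<eta> \<bullet> P (vcoord (fst \<sigma>))"
        using cotangent_apply[OF qU \<eta>, of "fst (pull t q \<sigma>)"] pm fstc by (simp add: mem_Times_iff)
      also have "ccoord q \<eta> \<bullet> P (vcoord (fst \<sigma>)) + snd (pull t q \<sigma>) v
          = (\<Sum>i<r. c i * (ccoord q \<eta> \<bullet> P (YC i z) + AC i z \<bullet> w))"
        by (simp add: sndc \<sigma>v \<sigma>c P.sum P.scaleR inner_sum_left inner_sum_right sum.distrib distrib_left)
      also have "\<dots> = 0" using zero by simp
      finally show "pairing (pull t q \<sigma>) \<tau> = 0" .
    qed
  qed
  have "open N" "q0 \<in> N" using open_preimage[OF IB(2)] q0 IB(4) by (auto simp: N_def)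
  moreover have "q \<in> W" "t \<in> J q" if "q \<in> N" "t \<in> {-\<delta><..<\<delta>}" for q t
    using that inW inJ[OF t\<epsilon>(1)] stay(2)[OF that(2)] by (auto simp: N_def O1_def)
  ultimately show ?thesis using \<delta>(1) inv by (intro exI[of _ \<delta>] exI[of _ N] conjI ballI)
qed

end

context hamiltonian_flow
begin

lemma pull_invariant_local:
  assumes q0: "q0 \<in> W"
  shows "\<exists>\<delta> N. \<delta> > 0 \<and> open N \<and> q0 \<in> N \<and>
    (\<forall>q\<in>N. \<forall>t\<in>{-\<delta><..<\<delta>}. q \<in> W \<and> t \<in> J q \<and> (\<forall>\<sigma>\<in>D (\<phi> t q). pull t q \<sigma> \<in> D q))"
proof -
  obtain U x where c: "(U, x) \<in> A" "q0 \<in> U" using smooth_atlas_cover[OF atlas] by blast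
  have "hamiltonian_flow_chart A W X J \<phi> D f U x"
    by (intro hamiltonian_flow_chart.intro hamiltonian_flow_axioms smooth_chartI[OF atlas c(1)])
  then show ?thesis by (rule hamiltonian_flow_chart.pull_invariant_near) (use c q0 in auto)
qed

lemma pull_invariant:
  assumes p: "p \<in> W" and t: "t \<in> J p" and \<sigma>: "\<sigma> \<in> D (\<phi> t p)"
  shows "pull t p \<sigma> \<in> D p"
proof -
  define Q where "Q t \<longleftrightarrow> (\<forall>\<sigma>\<in>D (\<phi> t p). pull t p \<sigma> \<in> D p)" for t
  have "Q t"
  proof (rule open_interval_induction[of "J p" 0 t])
    show "open (J p)" "is_interval (J p)" using integral_curveD[OF flow_curve[OF p]] by blast+
    show "0 \<in> J p" by (rule zero_in[OF p])
    \<comment> \<open>Time 0 is a case of the local statement, which spares a computation of the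
      tangent map of the identity.\<close>
    show "Q 0"
    proof -
      obtain \<delta> N where N: "\<delta> > 0" "p \<in> N"
        "\<forall>q\<in>N. \<forall>t\<in>{-\<delta><..<\<delta>}. q \<in> W \<and> t \<in> J q \<and> (\<forall>\<sigma>\<in>D (\<phi> t q). pull t q \<sigma> \<in> D q)"
        using pull_invariant_local[OF p] by blast
      have "0 \<in> {-\<delta><..<\<delta>}" using N(1) by simp
      then show ?thesis unfolding Q_def using N(2,3) by blast
    qed
    fix a assume a: "a \<in> J p"
    obtain \<delta> N where N: "\<delta> > 0" "open N" "\<phi> a p \<in> N"
      and loc: "\<And>q t \<sigma>. q \<in> N \<Longrightarrow> t \<in> {-\<delta><..<\<delta>} \<Longrightarrow> t \<in> J q"
        "\<And>q t \<sigma>. q \<in> N \<Longrightarrow> t \<in> {-\<delta><..<\<delta>} \<Longrightarrow> \<sigma> \<in> D (\<phi> t q) \<Longrightarrow> pull t q \<sigma> \<in> D q"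
      using pull_invariant_local[OF flow_in[OF p a]] by blast
    have "open {s \<in> J p. \<phi> s p \<in> N}" by (rule integral_curve_open_preimage[OF flow_curve[OF p] N(2)])
    moreover have "a \<in> {s \<in> J p. \<phi> s p \<in> N}" using a N by auto
    ultimately obtain e where e: "e > 0" "ball a e \<subseteq> {s \<in> J p. \<phi> s p \<in> N}"
      by (rule open_contains_ballE)
    \<comment> \<open>Half of \<open>\<delta>\<close>, so that any two times in the ball differ by
      less than \<open>\<delta>\<close>.\<close>
    define e' where "e' = min e (\<delta> / 2)"
    have step: "Q u'" if u: "u \<in> ball a e'" "u' \<in> ball a e'" and Qu: "Q u" for u u'
      unfolding Q_def
    proof
      fix \<sigma> assume \<sigma>: "\<sigma> \<in> D (\<phi> u' p)"
      have h: "u' - u \<in> {-\<delta><..<\<delta>}" using u by (auto simp: e'_def dist_real_def abs_if split: if_splits)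
      have uJ: "u \<in> J p" "\<phi> u p \<in> N" using u(1) e(2) by (auto simp: e'_def)
      note hJ = loc(1)[OF uJ(2) h]
      have eq: "\<phi> u' p = \<phi> (u' - u) (\<phi> u p)" using flow_add(2)[OF p uJ(1) hJ] by simp
      have "pull (u' - u) (\<phi> u p) \<sigma> \<in> D (\<phi> u p)" using \<sigma> unfolding eq by (rule loc(2)[OF uJ(2) h])
      then have "pull u p (pull (u' - u) (\<phi> u p) \<sigma>) \<in> D p" using Qu by (simp add: Q_def)
      moreover have "pull (u' - u + u) p \<sigma> = pull u p (pull (u' - u) (\<phi> u p) \<sigma>)"
        using dirac_space[OF \<sigma>] by (intro pull_add[OF p uJ(1) hJ]) simp
      ultimately show "pull u' p \<sigma> \<in> D p" by simp
    qed
    have "e' > 0" using e N by (simp add: e'_def)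
    then show "\<exists>e>0. \<forall>u\<in>J p \<inter> ball a e. \<forall>u'\<in>J p \<inter> ball a e. Q u \<longrightarrow> Q u'"
    proof (intro exI[of _ e'] conjI ballI impI)
      fix u u' assume "u \<in> J p \<inter> ball a e'" "u' \<in> J p \<inter> ball a e'" "Q u"
      then show "Q u'" by (intro step[of u u']) blast+
    qed
  qed (rule t)
  then show ?thesis using \<sigma> by (simp add: Q_def)
qed

text \<open>Membership in the fibres is \<open>pull_invariant\<close>; what a section requires
  beyond it, smoothness and an open domain, comes from the smoothness of the flow.\<close>

lemma pullback_section:
  assumes "(Y, \<alpha>) \<in> sections A D V"
  shows "(flow_pullback_vec A \<phi> t Y, flow_pullback_form A \<phi> t \<alpha>) \<in> sections A D {p \<in> W. t \<in> J p \<and> \<phi> t p \<in> V}"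
proof -
  have V: "open V" and Y: "vector_field A V Y" and \<alpha>: "one_form A V \<alpha>" and YD: "\<And>p. p \<in> V \<Longrightarrow> (Y p, \<alpha> p) \<in> D p"
    using assms by (auto simp: sections_def)
  have "(flow_pullback_vec A \<phi> t Y p, flow_pullback_form A \<phi> t \<alpha> p) \<in> D p"
    if "p \<in> W" "t \<in> J p" "\<phi> t p \<in> V" for p
    using pull_invariant[OF that(1,2) YD[OF that(3)]]
    unfolding pull_def flow_pullback_vec_def flow_pullback_form_def[abs_def] fst_conv snd_conv .
  then show ?thesis
    using flow_domain_open[OF V] flow_pullback_vector_field[OF V Y] flow_pullback_one_form[OF V \<alpha>]
    by (simp add: sections_def)
qed

end

theorem theorem2p2:
  fixes A :: "('m::{t2_space,second_countable_topology}, 'e::euclidean_space) chart set"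
    and D :: "'m \<Rightarrow> ('m vec \<times> 'm covec) set"
    and W :: "'m set" and f :: "'m \<Rightarrow> real" and X\<^sub>f :: "'m \<Rightarrow> 'm vec"
    and J :: "'m \<Rightarrow> real set" and \<phi> :: "real \<Rightarrow> 'm \<Rightarrow> 'm"
  assumes "smooth_atlas A"
    and "closed_dirac_structure A D"
    and "open W"
    and "admissible A D W f"
    and "hamiltonian_vector_field A D W f X\<^sub>f"
    and "is_flow A W X\<^sub>f J \<phi>"
  shows "\<forall>t V X \<alpha>. (X, \<alpha>) \<in> sections A D V \<longrightarrow>
    (flow_pullback_vec A \<phi> t X, flow_pullback_form A \<phi> t \<alpha>)
      \<in> sections A D {p \<in> W. t \<in> J p \<and> \<phi> t p \<in> V}"
proof -
  have "(X\<^sub>f, differential A f) \<in> sections A D W"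
    using assms(5) by (simp add: hamiltonian_vector_field_def)
  moreover have "smooth_fun A W f" using assms(4) by (simp add: admissible_def)
  ultimately have "hamiltonian_flow A W X\<^sub>f J \<phi> D f"
    using assms(1-3,6) by unfold_locales (simp_all add: sections_def)
  then show ?thesis by (blast intro: hamiltonian_flow.pullback_section)
qed

end
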